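(* Let $\Lambda\subset\mathbb B_d$ be a countable subset and $\mathfrak a\subset\mathcal M_d$ a weak-$*$ closed ideal. Assume there is an invertible operator $X$ with $X^{-1}Z^{\mathfrak a}X=\bigoplus_{\lambda\in\Lambda}\lambda$. Then $\Lambda$ is a strongly separated sequence. Furthermore, letting $\mathfrak a_\lambda=\mathfrak v_0(\Lambda\setminus\{\lambda\})$ for $\lambda\in\Lambda$, there is for each $\lambda$ an inner multiplier $\Omega_\lambda$ with $\operatorname{ran}M_{\Omega_\lambda}=[\mathfrak a_\lambda H^2_d]$ and $$\inf_{\lambda\in\Lambda}\|\Omega_\lambda(\lambda)\|\ge\frac{1}{\|X\|\,\|X^{-1}\|}.$$
   Context: $\mathbb B_d$ is the open unit ball of $\mathbb C^d$; $H^2_d$ is the Drury–Arveson space (RKHS on $\mathbb B_d$ with kernel $(1-\langle z,w\rangle)^{-1}$) and $\mathcal M_d$ its multiplier algebra, viewed as multiplication operators $M_\phi$ on $H^2_d$, with norm $\|M_\phi\|$ and weak-$*$ topology. For a Hilbert space $\mathfrak X$, a function $\Omega:\mathbb B_d\to B(\mathfrak X,\mathbb C)$ is a multiplier if $M_\Omega:H^2_d\otimes\mathfrak X\to H^2_d$, $f\mapsto\Omega f$, is bounded; it is inner if $M_\Omega$ is a partial isometry. For an ideal $\mathfrak a$, $[\mathfrak aH^2_d]$ is the closed span of $\{\phi f:\phi\in\mathfrak a, f\in H^2_d\}$, $\mathcal H_{\mathfrak a}=H^2_d\ominus[\mathfrak aH^2_d]$, and $Z^{\mathfrak a}=(P_{\mathcal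 H_{\mathfrak a}}M_{x_j}|_{\mathcal H_{\mathfrak a}})_{j=1}^d$. $\bigoplus_{\lambda\in\Lambda}\lambda$ denotes the $d$-tuple of diagonal operators on $\ell^2(\Lambda)$ with $j$-th entry $e_\lambda\mapsto\lambda_je_\lambda$; the equation means $X^{-1}Z^{\mathfrak a}_jX$ equals its $j$-th entry for each $j$, with $X:\ell^2(\Lambda)\to\mathcal H_{\mathfrak a}$ bounded invertible. $\mathfrak v_0(\Omega)=\{\psi\in\mathcal M_d:\psi|_\Omega=0\}$. $\Lambda=\{\lambda_n\}$ is strongly separated if there is $\varepsilon>0$ and for each $n$ some $\omega_n\in\mathcal M_d$, $\|\omega_n\|\le1$, with $|\omega_n(\lambda_n)|\ge\varepsilon$ and $\omega_n(\lambda_m)=0$ for $m\ne n$. *)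

theory Defs
  imports "HOL-Analysis.Analysis"
begin

definition cinner :: "complex^'d \<Rightarrow> complex^'d \<Rightarrow> complex" where
  "cinner z w = (\<Sum>i\<in>UNIV. z$i * cnj (w$i))"

definition Ball_d :: "(complex^'d) set" where
  "Ball_d = {z. norm z < 1}"

definition DAkernel :: "complex^'d \<Rightarrow> complex^'d \<Rightarrow> complex" where
  "DAkernel z w = 1 / (1 - cinner z w)"

text \<open>Functions are taken to vanish off the ball (so that equality of functions
  is equality on the ball).  By Aronszajn's theory, f belongs to the RKHS of K with
  norm at most C iff |<f, sum b_i k_{z_i}>|^2 <= C^2 ||sum b_i k_{z_i}||^2 for all
  finite families, i.e. C^2 K - f (x) f^* is positive semidefinite.\<close>

definition h2_bound :: "(complex^'d \<Rightarrow> complex) \<Rightarrow> real \<Rightarrow> bool" where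
  "h2_bound f C \<longleftrightarrow> C \<ge> 0 \<and>
     (\<forall>(n::nat) (zs::nat \<Rightarrow> complex^'d) (b::nat \<Rightarrow> complex).
        (\<forall>i<n. zs i \<in> Ball_d) \<longrightarrow>
        (cmod (\<Sum>i<n. cnj (b i) * f (zs i)))\<^sup>2
          \<le> C\<^sup>2 * Re (\<Sum>i<n. \<Sum>j<n. b i * cnj (b j) * DAkernel (zs j) (zs i)))"

definition H2 :: "(complex^'d \<Rightarrow> complex) set" where
  "H2 = {f. (\<forall>z. z \<notin> Ball_d \<longrightarrow> f z = 0) \<and> (\<exists>C. h2_bound f C)}"

definition h2norm :: "(complex^'d \<Rightarrow> complex) \<Rightarrow> real" where
  "h2norm f = Inf {C. h2_bound f C}"

text \<open>Inner product (linear in the first argument) by polarization.\<close>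
definition h2inner :: "(complex^'d \<Rightarrow> complex) \<Rightarrow> (complex^'d \<Rightarrow> complex) \<Rightarrow> complex" where
  "h2inner f g = (1/4) * (\<Sum>k<(4::nat). \<i>^k * complex_of_real ((h2norm (\<lambda>z. f z + \<i>^k * g z))\<^sup>2))"

definition fmult :: "(complex^'d \<Rightarrow> complex) \<Rightarrow> (complex^'d \<Rightarrow> complex) \<Rightarrow> (complex^'d \<Rightarrow> complex)" where
  "fmult \<phi> f = (\<lambda>z. \<phi> z * f z)"

definition Md :: "(complex^'d \<Rightarrow> complex) set" where
  "Md = {\<phi>. (\<forall>z. z \<notin> Ball_d \<longrightarrow> \<phi> z = 0) \<and>
            (\<exists>C. \<forall>f\<in>H2. fmult \<phi> f \<in> H2 \<and> h2norm (fmult \<phi> f) \<le> C * h2norm f)}"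

definition mult_norm :: "(complex^'d \<Rightarrow> complex) \<Rightarrow> real" where
  "mult_norm \<phi> = Sup {h2norm (fmult \<phi> f) | f. f \<in> H2 \<and> h2norm f \<le> 1}"

definition coord :: "'d \<Rightarrow> (complex^'d \<Rightarrow> complex)" where
  "coord j = (\<lambda>z. if z \<in> Ball_d then z$j else 0)"

text \<open>Normal (weak-* continuous) functionals on B(H^2_d):
  T |-> sum_n <T x_n, y_n> with sum ||x_n||^2 < inf and sum ||y_n||^2 < inf.\<close>
definition sq_summable_h2 :: "(nat \<Rightarrow> (complex^'d \<Rightarrow> complex)) \<Rightarrow> bool" where
  "sq_summable_h2 xs \<longleftrightarrow> (\<forall>n. xs n \<in> H2) \<and> summable (\<lambda>n. (h2norm (xs n))\<^sup>2)"

definition wstar_fun :: "(nat \<Rightarrow> (complex^'d \<Rightarrow> complex)) \<Rightarrow> (nat \<Rightarrow> (complex^'d \<Rightarrow> complex))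
     \<Rightarrow> (complex^'d \<Rightarrow> complex) \<Rightarrow> complex" where
  "wstar_fun xs ys \<phi> = (\<Sum>n. h2inner (fmult \<phi> (xs n)) (ys n))"

text \<open>A set A of multipliers is weak-* closed iff its complement in M_d is open for
  the weak-* topology, i.e. the topology generated by the normal functionals.\<close>
definition wstar_closed :: "(complex^'d \<Rightarrow> complex) set \<Rightarrow> bool" where
  "wstar_closed A \<longleftrightarrow> A \<subseteq> Md \<and>
     (\<forall>\<psi>\<in>Md - A. \<exists>(N::nat) xs ys (\<epsilon>::real). \<epsilon> > 0 \<and>
        (\<forall>k<N. sq_summable_h2 (xs k) \<and> sq_summable_h2 (ys k)) \<and>
        (\<forall>\<phi>\<in>Md. (\<forall>k<N. cmod (wstar_fun (xs k) (ys k) \<phi> - wstar_fun (xs k) (ys k) \<psi>) < \<epsilon>)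
                 \<longrightarrow> \<phi> \<notin> A))"

definition is_ideal :: "(complex^'d \<Rightarrow> complex) set \<Rightarrow> bool" where
  "is_ideal A \<longleftrightarrow> A \<subseteq> Md \<and> (\<lambda>z. 0) \<in> A \<and>
     (\<forall>\<phi>\<in>A. \<forall>\<psi>\<in>A. (\<lambda>z. \<phi> z + \<psi> z) \<in> A) \<and>
     (\<forall>c. \<forall>\<phi>\<in>A. (\<lambda>z. c * \<phi> z) \<in> A) \<and>
     (\<forall>\<phi>\<in>Md. \<forall>\<psi>\<in>A. fmult \<phi> \<psi> \<in> A)"

definition h2span :: "(complex^'d \<Rightarrow> complex) set \<Rightarrow> (complex^'d \<Rightarrow> complex) set" where
  "h2span G = {(\<lambda>z. \<Sum>i<n. c i * g i z) | (n::nat) c g. \<forall>i<n. g i \<in> G}"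

definition h2closed_span :: "(complex^'d \<Rightarrow> complex) set \<Rightarrow> (complex^'d \<Rightarrow> complex) set" where
  "h2closed_span G = {f \<in> H2. \<forall>\<epsilon>>0. \<exists>g\<in>h2span G. h2norm (\<lambda>z. f z - g z) < \<epsilon>}"

definition idealH2 :: "(complex^'d \<Rightarrow> complex) set \<Rightarrow> (complex^'d \<Rightarrow> complex) set" where
  "idealH2 A = h2closed_span {fmult \<phi> f | \<phi> f. \<phi> \<in> A \<and> f \<in> H2}"

definition Ha :: "(complex^'d \<Rightarrow> complex) set \<Rightarrow> (complex^'d \<Rightarrow> complex) set" where
  "Ha A = {f \<in> H2. \<forall>g\<in>idealH2 A. h2inner f g = 0}"

definition h2proj :: "(complex^'d \<Rightarrow> complex) set \<Rightarrow> (complex^'d \<Rightarrow> complex) \<Rightarrow> (complex^'d \<Rightarrow> complex)" where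
  "h2proj S f = (THE g. g \<in> S \<and> (\<forall>h\<in>S. h2inner (\<lambda>z. f z - g z) h = 0))"

definition Zop :: "(complex^'d \<Rightarrow> complex) set \<Rightarrow> 'd \<Rightarrow> (complex^'d \<Rightarrow> complex) \<Rightarrow> (complex^'d \<Rightarrow> complex)" where
  "Zop A j f = h2proj (Ha A) (fmult (coord j) f)"

definition l2 :: "(complex^'d) set \<Rightarrow> (complex^'d \<Rightarrow> complex) set" where
  "l2 L = {e. (\<forall>x. x \<notin> L \<longrightarrow> e x = 0) \<and> (\<lambda>x. (cmod (e x))\<^sup>2) summable_on L}"

definition l2norm :: "(complex^'d) set \<Rightarrow> (complex^'d \<Rightarrow> complex) \<Rightarrow> real" where
  "l2norm L e = sqrt (infsum (\<lambda>x. (cmod (e x))\<^sup>2) L)"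

definition diag_op :: "'d \<Rightarrow> (complex^'d \<Rightarrow> complex) \<Rightarrow> (complex^'d \<Rightarrow> complex)" where
  "diag_op j e = (\<lambda>x. x$j * e x)"

text \<open>H^2_d (x) l^2(N) is identified with square-summable sequences in H^2_d
  (F = sum_n F_n (x) e_n).  A function Omega : B_d -> B(l^2(N), C) is represented by
  Omega z n = Omega(z) e_n, so that Omega(z) x = sum_n x_n Omega z n.\<close>

definition VH2 :: "(nat \<Rightarrow> (complex^'d \<Rightarrow> complex)) set" where
  "VH2 = {F. sq_summable_h2 F}"

definition vnorm :: "(nat \<Rightarrow> (complex^'d \<Rightarrow> complex)) \<Rightarrow> real" where
  "vnorm F = sqrt (\<Sum>n. (h2norm (F n))\<^sup>2)"

definition vinner :: "(nat \<Rightarrow> (complex^'d \<Rightarrow> complex)) \<Rightarrow> (nat \<Rightarrow> (complex^'d \<Rightarrow> complex)) \<Rightarrow> complex" where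
  "vinner F G = (\<Sum>n. h2inner (F n) (G n))"

definition vapply :: "(complex^'d \<Rightarrow> nat \<Rightarrow> complex) \<Rightarrow> (nat \<Rightarrow> (complex^'d \<Rightarrow> complex)) \<Rightarrow> (complex^'d \<Rightarrow> complex)" where
  "vapply \<Omega> F = (\<lambda>z. \<Sum>n. \<Omega> z n * F n z)"

definition vmultiplier :: "(complex^'d \<Rightarrow> nat \<Rightarrow> complex) \<Rightarrow> bool" where
  "vmultiplier \<Omega> \<longleftrightarrow>
     (\<forall>z. z \<notin> Ball_d \<longrightarrow> \<Omega> z = (\<lambda>n. 0)) \<and>
     (\<forall>z\<in>Ball_d. summable (\<lambda>n. (cmod (\<Omega> z n))\<^sup>2)) \<and>
     (\<exists>C. \<forall>F\<in>VH2. vapply \<Omega> F \<in> H2 \<and> h2norm (vapply \<Omega> F) \<le> C * vnorm F)"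

text \<open>Inner: M_Omega is a partial isometry, i.e. isometric on the orthogonal
  complement of its kernel.\<close>
definition inner_multiplier :: "(complex^'d \<Rightarrow> nat \<Rightarrow> complex) \<Rightarrow> bool" where
  "inner_multiplier \<Omega> \<longleftrightarrow> vmultiplier \<Omega> \<and>
     (\<forall>F\<in>VH2. (\<forall>G\<in>VH2. vapply \<Omega> G = (\<lambda>z. 0) \<longrightarrow> vinner F G = 0)
              \<longrightarrow> h2norm (vapply \<Omega> F) = vnorm F)"

definition vrange :: "(complex^'d \<Rightarrow> nat \<Rightarrow> complex) \<Rightarrow> (complex^'d \<Rightarrow> complex) set" where
  "vrange \<Omega> = {vapply \<Omega> F | F. F \<in> VH2}"

definition vpoint_norm :: "(complex^'d \<Rightarrow> nat \<Rightarrow> complex) \<Rightarrow> complex^'d \<Rightarrow> real" where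
  "vpoint_norm \<Omega> z = sqrt (\<Sum>n. (cmod (\<Omega> z n))\<^sup>2)"

definition v0 :: "(complex^'d) set \<Rightarrow> (complex^'d \<Rightarrow> complex) set" where
  "v0 S = {\<psi> \<in> Md. \<forall>x\<in>S. \<psi> x = 0}"

definition strongly_separated :: "(complex^'d) set \<Rightarrow> bool" where
  "strongly_separated L \<longleftrightarrow> (\<exists>\<epsilon>>0. \<forall>l\<in>L. \<exists>\<omega>\<in>Md. mult_norm \<omega> \<le> 1 \<and>
       cmod (\<omega> l) \<ge> \<epsilon> \<and> (\<forall>m\<in>L. m \<noteq> l \<longrightarrow> \<omega> m = 0))"

end

theory Submission
  imports Defs
begin

text \<open>Let \<open>Y = X\<^sup>-\<^sup>1 P\<close> with \<open>P\<close> the projection onto \<open>\<H>\<^sub>a\<close>. For \<open>l \<in> L\<close> the functional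
  \<open>f \<mapsto> (Y f) l\<close> intertwines multiplication by \<open>z\<^sub>j\<close> with multiplication by \<open>l\<^sub>j\<close>, and the identity
  \<open>k\<^sub>w = 1 + \<Sum>\<^sub>j cnj w\<^sub>j z\<^sub>j k\<^sub>w\<close> turns this into \<open>(Y f) l = c\<^sub>l f(l)\<close>. Hence \<open>f\<^sub>l = X e\<^sub>l\<close> vanishes on
  \<open>L - {l}\<close>, while \<open>\<bar>f\<^sub>l(l)\<bar> / (\<parallel>f\<^sub>l\<parallel> \<parallel>k\<^sub>l\<parallel>) \<ge> 1 / (\<parallel>X\<parallel> \<parallel>X\<^sup>-\<^sup>1\<parallel>)\<close>.

  Let \<open>N\<close> be the space of all functions in \<open>H\<^sup>2\<close> that vanish on \<open>L - {l}\<close>, with reproducing kernel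
  \<open>k\<^sub>N\<close>. Since the coordinate row is a contraction, \<open>(1 - \<langle>z,w\<rangle>) k\<^sub>N(z,w)\<close> is positive semidefinite;
  a Cholesky factorization along a dense sequence writes it as \<open>\<Omega>(z) \<Omega>(w)\<^sup>*\<close>. Then
  \<open>M\<^sub>\<Omega> M\<^sub>\<Omega>\<^sup>*\<close> is the projection onto \<open>N\<close>, so \<open>\<Omega>\<close> is inner with range \<open>N\<close>, its components lie in
  \<open>v\<^sub>0(L - {l})\<close>, and \<open>\<parallel>\<Omega>(l)\<parallel> = \<parallel>P\<^sub>N k\<^sub>l\<parallel> / \<parallel>k\<^sub>l\<parallel>\<close> dominates the quotient above. Applying \<open>\<Omega>\<close> to the
  unit vector in the direction of \<open>\<Omega>(l)\<^sup>*\<close> gives a contractive scalar multiplier that separates \<open>l\<close>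
  from the rest of \<open>L\<close>.\<close>

section \<open>Positive semidefinite kernels\<close>

text \<open>\<open>H2\<close> is given only through positivity bounds: its norm is an infimum and
  its inner product a polarization sum. Linearity of the inner product and the reproducing property
  therefore have to be derived, and both rest on the density of finite kernel combinations.

  The constant has two sources. Since \<open>Y\<close> sends \<open>f_l\<close> to the unit vector
  at \<open>l\<close>, \<open>c_l f_l(l) = 1\<close>, and the norm of \<open>f_l\<close> is at most
  that of \<open>X\<close>. Applying \<open>Y\<close> to the kernel function at \<open>l\<close>
  itself bounds \<open>|c_l|\<close> times the norm of that kernel function by the norm of the
  inverse of \<open>X\<close>. The product of the two estimates is the quotient in the overview.

  The space of all functions vanishing on the other points is used in place of the closed ideal
  space because vanishing is all that is known about \<open>f_l\<close> in advance. The
  factorization closes this gap: each function in the larger space is a norm limit of finite sums of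
  components of \<Omega> times functions in \<open>H2\<close>, hence lies in the closed ideal
  space.\<close>

definition form :: "('a \<Rightarrow> 'a \<Rightarrow> complex) \<Rightarrow> 'a set \<Rightarrow> ('a \<Rightarrow> complex) \<Rightarrow> ('a \<Rightarrow> complex) \<Rightarrow> complex" where
  "form G T b c = (\<Sum>z\<in>T. \<Sum>w\<in>T. cnj (b z) * c w * G z w)"

text \<open>A condition on real parts alone does not force Hermitian symmetry, so symmetry is a
  separate clause; together they make the quadratic form real.\<close>

definition psd :: "'a set \<Rightarrow> ('a \<Rightarrow> 'a \<Rightarrow> complex) \<Rightarrow> bool" where
  "psd B G \<longleftrightarrow> (\<forall>z\<in>B. \<forall>w\<in>B. G w z = cnj (G z w)) \<and>
     (\<forall>T b. finite T \<and> T \<subseteq> B \<longrightarrow> 0 \<le> Re (form G T b b))"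

text \<open>Coefficient families living on different finite sets are compared after extension by
  zero to a common superset, where Cauchy-Schwarz applies.\<close>

definition restr :: "'a set \<Rightarrow> ('a \<Rightarrow> complex) \<Rightarrow> 'a \<Rightarrow> complex" where
  "restr T b z = (if z \<in> T then b z else 0)"

lemma form_add_left: "form G T (\<lambda>z. b z + b' z) c = form G T b c + form G T b' c"
  by (simp add: form_def algebra_simps sum.distrib)

lemma form_add_right: "form G T b (\<lambda>z. c z + c' z) = form G T b c + form G T b c'"
  by (simp add: form_def algebra_simps sum.distrib)

lemma form_scale_left: "form G T (\<lambda>z. s * b z) c = cnj s * form G T b c"
  by (simp add: form_def sum_distrib_left mult_ac)

lemma form_scale_right: "form G T b (\<lambda>z. s * c z) = s * form G T b c"
  by (simp add: form_def sum_distrib_left mult_ac)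

lemma psd_herm:
  assumes "psd B G" "z \<in> B" "w \<in> B"
  shows "G w z = cnj (G z w)"
  by (rule assms(1)[unfolded psd_def, THEN conjunct1, THEN bspec, THEN bspec]) (rule assms)+

lemma psd_nonneg:
  assumes "psd B G" "finite T" "T \<subseteq> B"
  shows "0 \<le> Re (form G T b b)"
  using assms(1)[unfolded psd_def, THEN conjunct2] assms(2,3) by simp

lemma psdI:
  assumes "\<And>z w. z \<in> B \<Longrightarrow> w \<in> B \<Longrightarrow> G w z = cnj (G z w)"
    and "\<And>T b. finite T \<Longrightarrow> T \<subseteq> B \<Longrightarrow> 0 \<le> Re (form G T b b)"
  shows "psd B G"
  unfolding psd_def by (intro conjI ballI allI impI) (simp_all add: assms(2), rule assms(1))

lemma form_herm:
  assumes "psd B G" "T \<subseteq> B"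
  shows "form G T c b = cnj (form G T b c)"
proof -
  have "form G T c b = (\<Sum>w\<in>T. \<Sum>z\<in>T. cnj (c z) * b w * G z w)"
    unfolding form_def by (rule sum.swap)
  also have "\<dots> = (\<Sum>w\<in>T. \<Sum>z\<in>T. cnj (cnj (b w) * c z * G w z))"
  proof (intro sum.cong refl)
    fix w z assume "w \<in> T" "z \<in> T"
    then have *: "G z w = cnj (G w z)" using assms(2) by (intro psd_herm[OF assms(1)]) auto
    show "cnj (c z) * b w * G z w = cnj (cnj (b w) * c z * G w z)" by (subst *) simp
  qed
  finally show ?thesis by (simp add: form_def)
qed

lemma form_diag_real:
  assumes "psd B G" "T \<subseteq> B"
  shows "form G T b b = of_real (Re (form G T b b))"
  using form_herm[OF assms, of b b] by (simp add: complex_eq_iff)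

lemma psd_cauchy_schwarz:
  assumes "psd B G" "finite T" "T \<subseteq> B"
  shows "(cmod (form G T b c))\<^sup>2 \<le> Re (form G T b b) * Re (form G T c c)"
proof -
  define p where "p = form G T b c"
  define q where "q = Re (form G T b b)"
  define r where "r = Re (form G T c c)"
  have r0: "0 \<le> r" and q0: "0 \<le> q" unfolding r_def q_def using psd_nonneg assms by blast+
  have fb: "form G T b b = of_real q" and fc: "form G T c c = of_real r"
    unfolding q_def r_def by (rule form_diag_real[OF assms(1,3)])+
  have key: "0 \<le> q - 2 * t * (cmod p)\<^sup>2 + t\<^sup>2 * (cmod p)\<^sup>2 * r" for t :: real
  proof -
    \<comment> \<open>This direction makes each of the two cross terms equal to
      \<open>- t * (cmod p)^2\<close>, so a real quadratic in \<open>t\<close> remains.\<close>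
    define s where "s = - of_real t * cnj p"
    have "form G T (\<lambda>z. b z + s * c z) (\<lambda>z. b z + s * c z)
        = form G T b b + s * p + cnj s * cnj p + cnj s * s * form G T c c"
      by (simp add: form_add_left form_add_right form_scale_left form_scale_right p_def
          form_herm[OF assms(1,3), of c b] algebra_simps)
    also have "\<dots> = of_real (q - 2 * t * (cmod p)\<^sup>2 + t\<^sup>2 * (cmod p)\<^sup>2 * r)"
      unfolding fb fc of_real_add of_real_diff of_real_mult complex_norm_square
      by (simp add: s_def power2_eq_square algebra_simps)
    finally show ?thesis
      using psd_nonneg[OF assms, of "\<lambda>z. b z + s * c z"] by simp
  qed
  have "(cmod p)\<^sup>2 \<le> q * r"
  proof (cases "r = 0")
    case True
    \<comment> \<open>With \<open>r = 0\<close> the quadratic is affine in \<open>t\<close>; for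
      nonzero \<open>p\<close> the value of \<open>t\<close> chosen below would make it equal to
      -1.\<close>
    have "cmod p = 0"
    proof (rule ccontr)
      assume "cmod p \<noteq> 0"
      then have "0 < (cmod p)\<^sup>2" by simp
      then show False using key[of "(q + 1) / (2 * (cmod p)\<^sup>2)"] True by (simp add: field_simps)
    qed
    then show ?thesis using True by simp
  next
    case False
    then have "r > 0" using r0 by simp
    then have "q - (cmod p)\<^sup>2 / r \<ge> 0" using key[of "1 / r"]
      by (simp add: field_simps power2_eq_square)
    then show ?thesis using \<open>r > 0\<close> by (simp add: field_simps)
  qed
  then show ?thesis by (simp add: p_def q_def r_def)
qed

lemma sum_restr:
  assumes "finite V" "T \<subseteq> V" "\<And>z. h 0 z = (0::complex)"
  shows "(\<Sum>z\<in>V. h (restr T b z) z) = (\<Sum>z\<in>T. h (b z) z)"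
  by (rule sum.mono_neutral_cong_right) (use assms in \<open>auto simp: restr_def\<close>)

lemma form_restr:
  assumes "finite V" "T \<subseteq> V" "U \<subseteq> V"
  shows "form G V (restr T b) (restr U c) = (\<Sum>z\<in>T. \<Sum>w\<in>U. cnj (b z) * c w * G z w)"
proof -
  have "form G V (restr T b) (restr U c) = (\<Sum>z\<in>V. \<Sum>w\<in>U. cnj (restr T b z) * c w * G z w)"
    unfolding form_def by (intro sum.cong refl sum_restr[where h = "\<lambda>x w. _ * x * _ w"] assms) simp
  also have "\<dots> = (\<Sum>z\<in>T. \<Sum>w\<in>U. cnj (b z) * c w * G z w)"
    by (rule sum_restr[where h = "\<lambda>x z. \<Sum>w\<in>U. cnj x * c w * G z w"]) (use assms in auto)
  finally show ?thesis .
qed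

lemma form_two_points:
  assumes "finite T" "z \<in> T" "w \<in> T"
  shows "form G T (restr {z} (\<lambda>_. 1)) (restr {w} (\<lambda>_. 1)) = G z w"
  by (subst form_restr) (use assms in auto)

lemma psd_diag_real:
  assumes "psd B G" "z \<in> B"
  shows "G z z = of_real (Re (G z z))"
  using psd_herm[OF assms(1) assms(2) assms(2)] by (simp add: complex_eq_iff)

lemma psd_diag_nonneg:
  assumes "psd B G" "z \<in> B"
  shows "0 \<le> Re (G z z)"
  using psd_nonneg[OF assms(1), of "{z}" "restr {z} (\<lambda>_. 1)"] form_two_points[of "{z}" z z G] assms by simp

lemma psd_entry_cs:
  assumes "psd B G" "z \<in> B" "w \<in> B"
  shows "(cmod (G z w))\<^sup>2 \<le> Re (G z z) * Re (G w w)"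
  using psd_cauchy_schwarz[OF assms(1), of "{z,w}" "restr {z} (\<lambda>_. 1)" "restr {w} (\<lambda>_. 1)"] assms
  by (simp add: form_two_points)

lemma psd_zero_column:
  assumes "psd B G" "z \<in> B" "w \<in> B" "G w w = 0"
  shows "G z w = 0"
  using psd_entry_cs[OF assms(1-3)] assms(4) by simp

lemma psd_add:
  assumes "psd B G" "psd B H"
  shows "psd B (\<lambda>z w. G z w + H z w)"
proof -
  have "form (\<lambda>z w. G z w + H z w) T b b = form G T b b + form H T b b" for T b
    by (simp add: form_def algebra_simps sum.distrib)
  then show ?thesis
    by (intro psdI) (simp_all add: psd_herm[OF assms(1), symmetric] psd_herm[OF assms(2), symmetric]
        psd_nonneg[OF assms(1)] psd_nonneg[OF assms(2)])
qed

lemma psd_zero: "psd B (\<lambda>z w. 0)"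
  by (simp add: psd_def form_def)

lemma psd_sum:
  assumes "finite I" "\<And>i. i \<in> I \<Longrightarrow> psd B (G i)"
  shows "psd B (\<lambda>z w. \<Sum>i\<in>I. G i z w)"
  using assms
proof (induction I rule: finite_induct)
  case empty then show ?case using psd_zero by simp
next
  case (insert x F) then show ?case using psd_add[of B "G x" "\<lambda>z w. \<Sum>i\<in>F. G i z w"] by simp
qed

lemma psd_weight:
  assumes "psd B G"
  shows "psd B (\<lambda>z w. h z * cnj (h w) * G z w)"
proof -
  have "form (\<lambda>z w. h z * cnj (h w) * G z w) T b b = form G T (\<lambda>z. b z * cnj (h z)) (\<lambda>z. b z * cnj (h z))" for T b
    unfolding form_def by (intro sum.cong refl) (simp add: mult_ac)
  then show ?thesis
    by (intro psdI) (simp_all add: psd_herm[OF assms, symmetric] psd_nonneg[OF assms])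
qed

lemma form_rank_one: "form (\<lambda>z w. h z * cnj (h w)) T b b = of_real ((cmod (\<Sum>z\<in>T. cnj (b z) * h z))\<^sup>2)"
proof -
  have "form (\<lambda>z w. h z * cnj (h w)) T b b = (\<Sum>z\<in>T. cnj (b z) * h z) * cnj (\<Sum>z\<in>T. cnj (b z) * h z)"
    unfolding form_def cnj_sum sum_product by (simp add: mult_ac)
  then show ?thesis by (simp only: complex_norm_square)
qed

lemma psd_rank_one: "psd B (\<lambda>z w. h z * cnj (h w))"
  by (auto simp: psd_def form_rank_one mult.commute)

lemma psd_limit:
  assumes "\<And>n. psd B (G n)" "\<And>z w. z \<in> B \<Longrightarrow> w \<in> B \<Longrightarrow> (\<lambda>n. G n z w) \<longlonglongrightarrow> H z w"
  shows "psd B H"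
  unfolding psd_def
proof (intro conjI ballI allI impI)
  fix z w assume zw: "z \<in> B" "w \<in> B"
  have "(\<lambda>n. G n w z) = (\<lambda>n. cnj (G n z w))"
    using psd_herm[OF assms(1) zw] by simp
  then have "(\<lambda>n. G n w z) \<longlonglongrightarrow> cnj (H z w)" using tendsto_cnj[OF assms(2)[OF zw]] by simp
  then show "H w z = cnj (H z w)" using LIMSEQ_unique assms(2) zw by blast
next
  fix T b assume T: "finite T \<and> T \<subseteq> B"
  have "(\<lambda>n. Re (form (G n) T b b)) \<longlonglongrightarrow> Re (form H T b b)"
    unfolding form_def by (intro tendsto_intros assms(2)) (use T in auto)
  then show "0 \<le> Re (form H T b b)"
    by (rule LIMSEQ_le_const) (use psd_nonneg[OF assms(1)] T in auto)
qed

text \<open>Cauchy-Schwarz between \<open>b\<close> and the unit mass at \<open>p\<close> bounds the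
  form of the subtracted rank-one kernel by the form of \<open>G\<close>.\<close>

lemma psd_schur_complement:
  assumes G: "psd B G" and p: "p \<in> B"
  shows "psd B (\<lambda>z w. G z w - G z p * cnj (G w p) / G p p)"
  unfolding psd_def
proof (intro conjI ballI allI impI)
  fix z w assume zw: "z \<in> B" "w \<in> B"
  show "G w z - G w p * cnj (G z p) / G p p = cnj (G z w - G z p * cnj (G w p) / G p p)"
    using psd_herm[OF G zw] psd_herm[OF G p p, symmetric] by (simp add: mult.commute)
next
  fix T b assume T: "finite T \<and> T \<subseteq> B"
  define r where "r = Re (G p p)"
  have r: "G p p = of_real r" "0 \<le> r" unfolding r_def
    by (rule psd_diag_real[OF G p] psd_diag_nonneg[OF G p])+
  define s where "s = (\<Sum>z\<in>T. cnj (b z) * G z p)"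
  have "form (\<lambda>z w. G z w - G z p * cnj (G w p) / G p p) T b b
      = form G T b b - form (\<lambda>z w. G z p * cnj (G w p)) T b b / of_real r"
    by (simp add: form_def r algebra_simps sum_subtractf sum_divide_distrib)
  then have eq: "Re (form (\<lambda>z w. G z w - G z p * cnj (G w p) / G p p) T b b) = Re (form G T b b) - (cmod s)\<^sup>2 / r"
    by (simp add: form_rank_one s_def flip: of_real_divide of_real_power)
  have V: "finite (insert p T)" "insert p T \<subseteq> B" using T p by auto
  have "form G (insert p T) (restr T b) (restr {p} (\<lambda>_. 1)) = s"
    by (subst form_restr) (use T in \<open>auto simp: s_def\<close>)
  moreover have "form G (insert p T) (restr T b) (restr T b) = form G T b b"
    by (subst form_restr) (use T in \<open>auto simp: form_def\<close>)
  moreover have "form G (insert p T) (restr {p} (\<lambda>_. 1)) (restr {p} (\<lambda>_. 1)) = G p p"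
    by (rule form_two_points) (use T in auto)
  ultimately have "(cmod s)\<^sup>2 \<le> Re (form G T b b) * r"
    using psd_cauchy_schwarz[OF G V, of "restr T b" "restr {p} (\<lambda>_. 1)"] by (simp add: r_def)
  then have "(cmod s)\<^sup>2 / r \<le> Re (form G T b b)"
    using r(2) psd_nonneg[OF G, of T b] T by (cases "r = 0") (auto simp: field_simps)
  then show "0 \<le> Re (form (\<lambda>z w. G z w - G z p * cnj (G w p) / G p p) T b b)" unfolding eq by simp
qed

text \<open>A zero pivot is harmless: division by it yields 0, and a positive semidefinite kernel with a
  zero diagonal entry vanishes on the corresponding column.\<close>
primrec chol :: "('a \<Rightarrow> 'a \<Rightarrow> complex) \<Rightarrow> (nat \<Rightarrow> 'a) \<Rightarrow> nat \<Rightarrow> 'a \<Rightarrow> 'a \<Rightarrow> complex" where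
  "chol G p 0 = G"
| "chol G p (Suc n) = (\<lambda>z w. chol G p n z w - chol G p n z (p n) * cnj (chol G p n w (p n)) / chol G p n (p n) (p n))"

lemma psd_chol:
  assumes "psd B G" "\<And>n. p n \<in> B"
  shows "psd B (chol G p n)"
  by (induction n) (simp_all add: assms psd_schur_complement)

text \<open>A pivot step annihilates its own column. Later steps preserve this: the term subtracted
  in column \<open>p m\<close> carries the factor at \<open>(p m, p n)\<close>, which is already
  zero by Hermitian symmetry.\<close>

lemma chol_zero_column:
  assumes G: "psd B G" and p: "\<And>n. p n \<in> B" and "m < n" "z \<in> B"
  shows "chol G p n z (p m) = 0"
  using assms(3,4)
proof (induction n arbitrary: z)
  case 0 then show ?case by simp
next
  case (Suc n)
  note P = psd_chol[where p = p, OF G p, of n]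
  show ?case
  proof (cases "m = n")
    case True
    show ?thesis
    proof (cases "chol G p n (p n) (p n) = 0")
      case t: True
      then show ?thesis using psd_zero_column[OF P Suc.prems(2) p t] True by simp
    next
      case False
      have "cnj (chol G p n (p n) (p n)) = chol G p n (p n) (p n)"
        by (rule psd_herm[OF P p[of n] p[of n], symmetric])
      then show ?thesis using False True by simp
    qed
  next
    case False
    then have "chol G p n z (p m) = 0" "chol G p n (p n) (p m) = 0"
      using Suc p by auto
    moreover have "cnj (chol G p n (p m) (p n)) = chol G p n (p n) (p m)"
      by (rule psd_herm[OF P p[of m] p[of n], symmetric])
    ultimately show ?thesis by simp
  qed
qed

text \<open>The density hypothesis is density in the seminorm of \<open>G\<close> itself. The
  residual \<open>H\<close> left after all pivots is positive semidefinite and vanishes on every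
  pivot column. Since \<open>G - H\<close> is a sum of squares, the squared
  \<open>H\<close>-distance from \<open>z\<close> to a pivot, which is just \<open>H z z\<close>, is
  at most the squared \<open>G\<close>-distance, and that can be made arbitrarily small.\<close>

lemma psd_cholesky:
  fixes G :: "'a \<Rightarrow> 'a \<Rightarrow> complex" and p :: "nat \<Rightarrow> 'a"
  assumes G: "psd B G" and p: "\<And>n. p n \<in> B"
    and dense: "\<And>z \<epsilon>. z \<in> B \<Longrightarrow> \<epsilon> > 0 \<Longrightarrow>
       \<exists>n. Re (G z z) - 2 * Re (G z (p n)) + Re (G (p n) (p n)) < \<epsilon>"
  obtains \<Omega> :: "'a \<Rightarrow> nat \<Rightarrow> complex"
  where "\<And>z w. z \<in> B \<Longrightarrow> w \<in> B \<Longrightarrow> (\<lambda>n. \<Omega> z n * cnj (\<Omega> w n)) sums G z w"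
    and "\<And>z. z \<in> B \<Longrightarrow> summable (\<lambda>n. (cmod (\<Omega> z n))\<^sup>2)"
proof -
  define C where "C = chol G p"
  have P: "psd B (C n)" for n unfolding C_def by (rule psd_chol[where p = p, OF G p])
  define r where "r n = Re (C n (p n) (p n))" for n
  have r: "C n (p n) (p n) = of_real (r n)" "0 \<le> r n" for n
    unfolding r_def by (rule psd_diag_real[OF P p] psd_diag_nonneg[OF P p])+
  \<comment> \<open>Scaling the pivot column by the square root of the pivot makes each product of
    components the rank-one term removed at that step, so partial sums telescope. A zero pivot
    contributes a zero component.\<close>
  define \<Omega> where "\<Omega> z n = C n z (p n) / of_real (sqrt (r n))" for z n
  have prod: "\<Omega> z n * cnj (\<Omega> w n) = C n z (p n) * cnj (C n w (p n)) / C n (p n) (p n)" for z w n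
  proof -
    have "complex_of_real (sqrt (r n)) * of_real (sqrt (r n)) = of_real (r n)"
      using r(2)[of n] by (simp flip: of_real_mult)
    then show ?thesis by (simp add: \<Omega>_def r)
  qed
  have tele: "(\<Sum>k<n. \<Omega> z k * cnj (\<Omega> w k)) = G z w - C n z w" for n z w
    by (induction n) (simp_all add: prod, simp_all add: C_def)
  have sq: "complex_of_real ((cmod (\<Omega> z n))\<^sup>2) = \<Omega> z n * cnj (\<Omega> z n)" for z n
    by (rule complex_norm_square)
  have summ: "summable (\<lambda>n. (cmod (\<Omega> z n))\<^sup>2)" if z: "z \<in> B" for z
  proof (rule summableI_nonneg_bounded[where x = "Re (G z z)"])
    fix n
    have "complex_of_real (\<Sum>k<n. (cmod (\<Omega> z k))\<^sup>2) = G z z - C n z z"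
      unfolding of_real_sum sq tele ..
    then have "(\<Sum>k<n. (cmod (\<Omega> z k))\<^sup>2) = Re (G z z) - Re (C n z z)"
      by (metis Re_complex_of_real minus_complex.simps(1))
    then show "(\<Sum>k<n. (cmod (\<Omega> z k))\<^sup>2) \<le> Re (G z z)"
      using psd_diag_nonneg[OF P z] by simp
  qed simp
  have summ2: "summable (\<lambda>n. \<Omega> z n * cnj (\<Omega> w n))" if z: "z \<in> B" "w \<in> B" for z w
  proof (rule summable_comparison_test')
    show "summable (\<lambda>n. (cmod (\<Omega> z n))\<^sup>2 + (cmod (\<Omega> w n))\<^sup>2)"
      using summ z by (intro summable_add) auto
    fix n :: nat
    have "0 \<le> (cmod (\<Omega> z n) - cmod (\<Omega> w n))\<^sup>2" by simp
    then have "2 * (cmod (\<Omega> z n) * cmod (\<Omega> w n)) \<le> (cmod (\<Omega> z n))\<^sup>2 + (cmod (\<Omega> w n))\<^sup>2"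
      by (simp add: power2_diff)
    moreover have "0 \<le> cmod (\<Omega> z n) * cmod (\<Omega> w n)" by simp
    ultimately show "norm (\<Omega> z n * cnj (\<Omega> w n)) \<le> (cmod (\<Omega> z n))\<^sup>2 + (cmod (\<Omega> w n))\<^sup>2"
      unfolding norm_mult complex_mod_cnj by linarith
  qed
  define H where "H z w = G z w - (\<Sum>n. \<Omega> z n * cnj (\<Omega> w n))" for z w
  have lim: "(\<lambda>n. C n z w) \<longlonglongrightarrow> H z w" if "z \<in> B" "w \<in> B" for z w
  proof -
    have "(\<lambda>n. G z w - (\<Sum>k<n. \<Omega> z k * cnj (\<Omega> w k))) \<longlonglongrightarrow> H z w"
      unfolding H_def by (intro tendsto_intros summable_LIMSEQ summ2 that)
    then show ?thesis by (simp add: tele)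
  qed
  have H: "psd B H" by (rule psd_limit[where G = C]) (use P lim in auto)
  have Hp: "H z (p m) = 0" if "z \<in> B" for z m
  proof -
    have "eventually (\<lambda>n. C n z (p m) = 0) sequentially"
      using eventually_gt_at_top[of m] by eventually_elim (use chol_zero_column[where p = p, OF G p] that in \<open>auto simp: C_def\<close>)
    then have "(\<lambda>n. C n z (p m)) \<longlonglongrightarrow> 0" by (rule tendsto_eventually)
    then show ?thesis using lim[OF that p] LIMSEQ_unique by blast
  qed
  have Hzz: "H z z = 0" if z: "z \<in> B" for z
  proof -
    have "Re (H z z) \<le> \<epsilon>" if "\<epsilon> > 0" for \<epsilon>
    proof -
      obtain m where m: "Re (G z z) - 2 * Re (G z (p m)) + Re (G (p m) (p m)) < \<epsilon>"
        using dense[OF z \<open>\<epsilon> > 0\<close>] by blast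
      have s: "(\<lambda>n. Re (\<Omega> u n * cnj (\<Omega> v n))) sums (Re (G u v) - Re (H u v))" if "u \<in> B" "v \<in> B" for u v
        using sums_Re[OF summable_sums[OF summ2[OF that]]] by (simp add: H_def)
      have S: "(\<lambda>n. Re (\<Omega> z n * cnj (\<Omega> z n)) - 2 * Re (\<Omega> z n * cnj (\<Omega> (p m) n)) + Re (\<Omega> (p m) n * cnj (\<Omega> (p m) n)))
         sums ((Re (G z z) - Re (H z z)) - 2 * (Re (G z (p m)) - Re (H z (p m))) + (Re (G (p m) (p m)) - Re (H (p m) (p m))))"
        by (intro sums_add sums_diff sums_mult s z p)
      have E: "Re (\<Omega> z n * cnj (\<Omega> z n)) - 2 * Re (\<Omega> z n * cnj (\<Omega> (p m) n)) + Re (\<Omega> (p m) n * cnj (\<Omega> (p m) n))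
         = (Re (\<Omega> z n) - Re (\<Omega> (p m) n))\<^sup>2 + (Im (\<Omega> z n) - Im (\<Omega> (p m) n))\<^sup>2" for n
        by (simp add: power2_eq_square algebra_simps)
      have "0 \<le> (Re (G z z) - Re (H z z)) - 2 * (Re (G z (p m)) - Re (H z (p m))) + (Re (G (p m) (p m)) - Re (H (p m) (p m)))"
        by (rule sums_le[OF _ sums_zero S]) (unfold E, simp)
      then show ?thesis using m Hp[OF z] Hp[OF p] by simp
    qed
    then have "Re (H z z) \<le> 0" by (rule field_le_epsilon) simp
    then have "Re (H z z) = 0" using psd_diag_nonneg[OF H z] by simp
    then show ?thesis by (subst psd_diag_real[OF H z]) simp
  qed
  show ?thesis
  proof
    show "(\<lambda>n. \<Omega> z n * cnj (\<Omega> w n)) sums G z w" if "z \<in> B" "w \<in> B" for z w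
      using summable_sums[OF summ2[OF that]] psd_zero_column[OF H that Hzz[OF that(2)]] by (simp add: H_def)
  qed (rule summ)
qed

section \<open>Positivity of the Drury-Arveson kernel\<close>

lemma norm_cinner_le: "cmod (cinner z w) \<le> norm z * norm w"
proof -
  have "cmod (cinner z w) \<le> (\<Sum>i\<in>UNIV. \<bar>cmod (z $ i)\<bar> * \<bar>cmod (w $ i)\<bar>)"
    unfolding cinner_def by (rule order_trans[OF norm_sum]) (simp add: norm_mult)
  also have "\<dots> \<le> norm z * norm w"
    unfolding norm_vec_def by (rule L2_set_mult_ineq)
  finally show ?thesis .
qed

lemma norm_cinner_less_1:
  assumes "z \<in> Ball_d" "w \<in> Ball_d"
  shows "cmod (cinner z w) < 1"
proof -
  have "norm z * norm w \<le> norm z * 1"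
    using assms by (intro mult_left_mono) (auto simp: Ball_d_def)
  then show ?thesis using norm_cinner_le[of z w] assms by (simp add: Ball_d_def)
qed

lemma cinner_commute: "cinner w z = cnj (cinner z w)"
  by (simp add: cinner_def mult.commute)

lemma one_minus_cinner_nonzero: "z \<in> Ball_d \<Longrightarrow> w \<in> Ball_d \<Longrightarrow> 1 - cinner z w \<noteq> 0"
  using norm_cinner_less_1[of z w] by auto

text \<open>A finite sum of rank-one weights suffices here, so the general Schur product theorem is
  avoided.\<close>

lemma psd_cinner_mult:
  assumes "psd B G"
  shows "psd B (\<lambda>z w. cinner z w * G z w)"
proof -
  have "psd B (\<lambda>z w. \<Sum>i\<in>UNIV. z $ i * cnj (w $ i) * G z w)"
    by (intro psd_sum psd_weight assms) simp
  then show ?thesis by (simp add: cinner_def sum_distrib_right)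
qed

text \<open>The kernel is the limit of geometric partial sums. In Horner form each partial sum is 1
  plus \<open>cinner z w\<close> times the previous one, and both operations preserve
  positivity.\<close>

lemma psd_DAkernel: "psd Ball_d (DAkernel :: complex^'d \<Rightarrow> _)"
proof (rule psd_limit)
  show "psd Ball_d (\<lambda>z w :: complex^'d. \<Sum>k<n. cinner z w ^ k)" for n
  proof (induction n)
    case 0 show ?case using psd_zero by simp
  next
    case (Suc n)
    have "psd Ball_d (\<lambda>z w :: complex^'d. 1 + cinner z w * (\<Sum>k<n. cinner z w ^ k))"
      using psd_rank_one[of Ball_d "\<lambda>_. 1"] by (intro psd_add psd_cinner_mult Suc) simp
    then show ?case by (simp only: sum.lessThan_Suc_shift power_0 power_Suc sum_distrib_left)
  qed
  show "(\<lambda>n. \<Sum>k<n. cinner z w ^ k) \<longlonglongrightarrow> DAkernel z w" if "z \<in> Ball_d" "w \<in> Ball_d" for z w :: "complex^'d"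
    using geometric_sums[OF norm_cinner_less_1[OF that]] by (simp add: sums_def DAkernel_def)
qed

text \<open>The source of two later facts: the defect in the row contraction is the rank-one kernel
  1, and a kernel function is 1 plus a combination of its coordinate multiples.\<close>

lemma DAkernel_eq:
  assumes "z \<in> Ball_d" "w \<in> Ball_d"
  shows "cinner z w * DAkernel z w = DAkernel z w - 1"
  using one_minus_cinner_nonzero[OF assms] by (simp add: DAkernel_def field_simps)

section \<open>The Drury--Arveson space as a Hilbert space\<close>

definition kfun :: "complex^'d \<Rightarrow> complex^'d \<Rightarrow> complex" where
  "kfun w = (\<lambda>z. if z \<in> Ball_d then DAkernel z w else 0)"

definition comb :: "(complex^'d) set \<Rightarrow> (complex^'d \<Rightarrow> complex) \<Rightarrow> complex^'d \<Rightarrow> complex" where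
  "comb T b = (\<lambda>x. \<Sum>z\<in>T. b z * kfun z x)"

text \<open>The pairing of \<open>f\<close> with \<open>comb T b\<close>, available before any
  property of the inner product; \<open>h2inner_comb\<close> identifies the two.\<close>

definition ev :: "('a \<Rightarrow> complex) \<Rightarrow> 'a set \<Rightarrow> ('a \<Rightarrow> complex) \<Rightarrow> complex" where
  "ev f T b = (\<Sum>z\<in>T. cnj (b z) * f z)"

abbreviation kquad :: "(complex^'d) set \<Rightarrow> (complex^'d \<Rightarrow> complex) \<Rightarrow> real" where
  "kquad T b \<equiv> Re (form DAkernel T b b)"

lemma sum_regroup:
  fixes b :: "nat \<Rightarrow> complex"
  shows "(\<Sum>i<n. b i * h (zs i)) = (\<Sum>z\<in>zs ` {..<n}. (\<Sum>i\<in>{i \<in> {..<n}. zs i = z}. b i) * h z)"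
proof -
  have "(\<Sum>i<n. b i * h (zs i)) = (\<Sum>z\<in>zs ` {..<n}. \<Sum>i\<in>{i \<in> {..<n}. zs i = z}. b i * h (zs i))"
    by (rule sum.image_gen) simp
  also have "\<dots> = (\<Sum>z\<in>zs ` {..<n}. (\<Sum>i\<in>{i \<in> {..<n}. zs i = z}. b i) * h z)"
    by (rule sum.cong) (auto simp: sum_distrib_right)
  finally show ?thesis .
qed

text \<open>Tuples of points may contain repetitions, finite sets may not. One direction enumerates
  the set; the other adds the coefficients at equal points by \<open>sum_regroup\<close>.\<close>

lemma h2_bound_iff_sq:
  fixes f :: "complex^'d \<Rightarrow> complex"
  shows "h2_bound f C \<longleftrightarrow> C \<ge> 0 \<and> (\<forall>T b. finite T \<longrightarrow> T \<subseteq> Ball_d \<longrightarrow> (cmod (ev f T b))\<^sup>2 \<le> C\<^sup>2 * kquad T b)"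
proof (intro iffI conjI allI impI)
  assume h: "h2_bound f C"
  then show "C \<ge> 0" by (simp add: h2_bound_def)
  fix T :: "(complex^'d) set" and b assume T: "finite T" "T \<subseteq> Ball_d"
  obtain zs where zs: "bij_betw zs {0..<card T} T" using ex_bij_betw_nat_finite[OF T(1)] by blast
  then have zs': "bij_betw zs {..<card T} T" by (simp add: lessThan_atLeast0)
  have "(cmod (\<Sum>i<card T. cnj (b (zs i)) * f (zs i)))\<^sup>2
          \<le> C\<^sup>2 * Re (\<Sum>i<card T. \<Sum>j<card T. b (zs i) * cnj (b (zs j)) * DAkernel (zs j) (zs i))"
  proof -
    have "\<forall>i<card T. zs i \<in> Ball_d" using zs' T unfolding bij_betw_def by auto
    then show ?thesis
      by (rule h[unfolded h2_bound_def, THEN conjunct2, THEN spec[of _ "card T"], THEN spec[of _ zs],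
            THEN spec[of _ "\<lambda>i. b (zs i)"], THEN mp])
  qed
  moreover have "(\<Sum>i<card T. cnj (b (zs i)) * f (zs i)) = ev f T b"
    unfolding ev_def by (rule sum.reindex_bij_betw[OF zs'])
  moreover have "(\<Sum>i<card T. \<Sum>j<card T. b (zs i) * cnj (b (zs j)) * DAkernel (zs j) (zs i))
      = (\<Sum>w\<in>T. \<Sum>z\<in>T. b w * cnj (b z) * DAkernel z w)"
    (is "?l = _")
  proof -
    have "?l = (\<Sum>i<card T. \<Sum>z\<in>T. b (zs i) * cnj (b z) * DAkernel z (zs i))"
      by (intro sum.cong refl sum.reindex_bij_betw[OF zs', of "\<lambda>z. b _ * cnj (b z) * DAkernel z _"])
    also have "\<dots> = (\<Sum>w\<in>T. \<Sum>z\<in>T. b w * cnj (b z) * DAkernel z w)"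
      by (rule sum.reindex_bij_betw[OF zs', of "\<lambda>w. \<Sum>z\<in>T. b w * cnj (b z) * DAkernel z w"])
    finally show ?thesis .
  qed
  moreover have "(\<Sum>w\<in>T. \<Sum>z\<in>T. b w * cnj (b z) * DAkernel z w) = form DAkernel T b b"
    unfolding form_def by (subst sum.swap) (simp add: mult.commute)
  ultimately show "(cmod (ev f T b))\<^sup>2 \<le> C\<^sup>2 * kquad T b" by simp
next
  assume h: "C \<ge> 0 \<and> (\<forall>T b. finite T \<longrightarrow> T \<subseteq> Ball_d \<longrightarrow> (cmod (ev f T b))\<^sup>2 \<le> C\<^sup>2 * kquad T b)"
  show "h2_bound f C" unfolding h2_bound_def
  proof (intro conjI allI impI)
    show "C \<ge> 0" using h by simp
    fix n and zs :: "nat \<Rightarrow> complex^'d" and b :: "nat \<Rightarrow> complex"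
    assume zs: "\<forall>i<n. zs i \<in> Ball_d"
    define T where "T = zs ` {..<n}"
    define c where "c z = (\<Sum>i\<in>{i \<in> {..<n}. zs i = z}. b i)" for z
    have T: "finite T" "T \<subseteq> Ball_d" using zs by (auto simp: T_def)
    have 1: "(\<Sum>i<n. cnj (b i) * f (zs i)) = ev f T c"
      unfolding ev_def T_def c_def cnj_sum by (rule sum_regroup)
    have "(\<Sum>i<n. \<Sum>j<n. b i * cnj (b j) * DAkernel (zs j) (zs i))
        = (\<Sum>i<n. b i * (\<Sum>j<n. cnj (b j) * DAkernel (zs j) (zs i)))"
      by (simp add: sum_distrib_left mult.assoc)
    also have "\<dots> = (\<Sum>w\<in>T. c w * (\<Sum>j<n. cnj (b j) * DAkernel (zs j) w))"
      unfolding T_def c_def by (rule sum_regroup)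
    also have "\<dots> = (\<Sum>w\<in>T. c w * (\<Sum>z\<in>T. cnj (c z) * DAkernel z w))"
      by (intro sum.cong refl arg_cong2[of _ _ _ _ "(*)"])
        (unfold T_def c_def cnj_sum, rule sum_regroup)
    also have "\<dots> = (\<Sum>w\<in>T. \<Sum>z\<in>T. cnj (c z) * c w * DAkernel z w)"
      by (simp add: sum_distrib_left mult_ac)
    also have "\<dots> = form DAkernel T c c"
      unfolding form_def by (rule sum.swap)
    finally show "(cmod (\<Sum>i<n. cnj (b i) * f (zs i)))\<^sup>2
        \<le> C\<^sup>2 * Re (\<Sum>i<n. \<Sum>j<n. b i * cnj (b j) * DAkernel (zs j) (zs i))"
      using h T 1 by simp
  qed
qed

lemma kquad_nonneg: "finite T \<Longrightarrow> T \<subseteq> Ball_d \<Longrightarrow> 0 \<le> kquad T b"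
  by (rule psd_nonneg[OF psd_DAkernel])

lemma h2_bound_iff:
  "h2_bound f C \<longleftrightarrow> C \<ge> 0 \<and> (\<forall>T b. finite T \<longrightarrow> T \<subseteq> Ball_d \<longrightarrow> cmod (ev f T b) \<le> C * sqrt (kquad T b))"
proof -
  have "((cmod (ev f T b))\<^sup>2 \<le> C\<^sup>2 * kquad T b) = (cmod (ev f T b) \<le> C * sqrt (kquad T b))"
    if "C \<ge> 0" "finite T" "T \<subseteq> Ball_d" for T b
  proof -
    have "C\<^sup>2 * kquad T b = (C * sqrt (kquad T b))\<^sup>2"
      using kquad_nonneg[OF that(2,3), of b] by (simp add: power_mult_distrib)
    then show ?thesis using that kquad_nonneg[OF that(2,3), of b]
      by (simp add: power2_le_iff_abs_le)
  qed
  then show ?thesis unfolding h2_bound_iff_sq by blast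
qed

lemma h2_boundD:
  "h2_bound f C \<Longrightarrow> finite T \<Longrightarrow> T \<subseteq> Ball_d \<Longrightarrow> cmod (ev f T b) \<le> C * sqrt (kquad T b)"
  unfolding h2_bound_iff by blast

lemma h2_boundI:
  "C \<ge> 0 \<Longrightarrow> (\<And>T b. finite T \<Longrightarrow> T \<subseteq> Ball_d \<Longrightarrow> cmod (ev f T b) \<le> C * sqrt (kquad T b)) \<Longrightarrow> h2_bound f C"
  unfolding h2_bound_iff by blast

lemma h2_bound_nonneg: "h2_bound f C \<Longrightarrow> 0 \<le> C"
  by (simp add: h2_bound_def)

lemma ev_add: "ev (\<lambda>z. f z + g z) T b = ev f T b + ev g T b"
  by (simp add: ev_def algebra_simps sum.distrib)

lemma ev_diff: "ev (\<lambda>z. f z - g z) T b = ev f T b - ev g T b"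
  by (simp add: ev_def algebra_simps sum_subtractf)

lemma ev_scale: "ev (\<lambda>z. c * f z) T b = c * ev f T b"
  by (simp add: ev_def sum_distrib_left mult_ac)

lemma h2_bound_zero: "h2_bound (\<lambda>z. 0) 0"
  by (rule h2_boundI) (simp_all add: ev_def)

lemma h2_bound_scale:
  assumes "h2_bound f C" shows "h2_bound (\<lambda>z. c * f z) (cmod c * C)"
proof (rule h2_boundI)
  show "0 \<le> cmod c * C" using h2_bound_nonneg[OF assms] by simp
  show "cmod (ev (\<lambda>z. c * f z) T b) \<le> cmod c * C * sqrt (kquad T b)" if "finite T" "T \<subseteq> Ball_d" for T b
    using h2_boundD[OF assms that, of b] by (simp add: ev_scale norm_mult mult.assoc mult_left_mono)
qed

lemma h2_bound_add:
  assumes "h2_bound f C" "h2_bound g D" shows "h2_bound (\<lambda>z. f z + g z) (C + D)"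
proof (rule h2_boundI)
  show "0 \<le> C + D" using assms[THEN h2_bound_nonneg] by simp
  show "cmod (ev (\<lambda>z. f z + g z) T b) \<le> (C + D) * sqrt (kquad T b)" if "finite T" "T \<subseteq> Ball_d" for T b
    using h2_boundD[OF assms(1) that, of b] h2_boundD[OF assms(2) that, of b]
      norm_triangle_ineq[of "ev f T b" "ev g T b"]
    by (simp add: ev_add algebra_simps)
qed

lemma H2I: "(\<And>z. z \<notin> Ball_d \<Longrightarrow> f z = 0) \<Longrightarrow> h2_bound f C \<Longrightarrow> f \<in> H2"
  by (auto simp: H2_def)

lemma H2_off_ball: "f \<in> H2 \<Longrightarrow> z \<notin> Ball_d \<Longrightarrow> f z = 0"
  by (simp add: H2_def)

lemma h2norm_le: "h2_bound f C \<Longrightarrow> h2norm f \<le> C"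
  unfolding h2norm_def by (intro cInf_lower bdd_belowI[of _ 0]) (auto simp: h2_bound_nonneg)

lemma h2norm_nonneg: "f \<in> H2 \<Longrightarrow> 0 \<le> h2norm f"
  unfolding h2norm_def H2_def by (intro cInf_greatest) (auto simp: h2_bound_nonneg)

text \<open>The infimum is attained, because each pair \<open>T\<close>, \<open>b\<close> imposes a
  closed condition on the constant. Where \<open>kquad T b\<close> vanishes, any one finite bound
  already forces \<open>ev f T b\<close> to be zero.\<close>

lemma h2_bound_h2norm:
  assumes "f \<in> H2" shows "h2_bound f (h2norm f)"
proof (rule h2_boundI)
  show "0 \<le> h2norm f" by (rule h2norm_nonneg[OF assms])
  fix T :: "(complex^'a) set" and b assume T: "finite T" "T \<subseteq> Ball_d"
  obtain C where C: "h2_bound f C" using assms by (auto simp: H2_def)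
  show "cmod (ev f T b) \<le> h2norm f * sqrt (kquad T b)"
  proof (cases "kquad T b = 0")
    case True then show ?thesis using h2_boundD[OF C T, of b] by simp
  next
    case False
    then have pos: "sqrt (kquad T b) > 0" using kquad_nonneg[OF T, of b] by simp
    have "cmod (ev f T b) / sqrt (kquad T b) \<le> h2norm f"
      unfolding h2norm_def
      by (intro cInf_greatest) (use C h2_boundD[OF _ T] pos in \<open>auto simp: field_simps\<close>)
    then show ?thesis using pos by (simp add: field_simps)
  qed
qed

lemma cmod_ev_le: "f \<in> H2 \<Longrightarrow> finite T \<Longrightarrow> T \<subseteq> Ball_d \<Longrightarrow> cmod (ev f T b) \<le> h2norm f * sqrt (kquad T b)"
  using h2_boundD h2_bound_h2norm by blast

lemma H2_zero [simp]: "(\<lambda>z. 0) \<in> H2"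
  using h2_bound_zero by (auto simp: H2_def)

lemma H2_scale: "f \<in> H2 \<Longrightarrow> (\<lambda>z. c * f z) \<in> H2"
  by (rule H2I[OF _ h2_bound_scale[OF h2_bound_h2norm]]) (auto simp: H2_off_ball)

lemma H2_add: "f \<in> H2 \<Longrightarrow> g \<in> H2 \<Longrightarrow> (\<lambda>z. f z + g z) \<in> H2"
  by (rule H2I[OF _ h2_bound_add[OF h2_bound_h2norm h2_bound_h2norm]]) (auto simp: H2_off_ball)

lemma H2_diff: "f \<in> H2 \<Longrightarrow> g \<in> H2 \<Longrightarrow> (\<lambda>z. f z - g z) \<in> H2"
  using H2_add[of f "\<lambda>z. - 1 * g z"] H2_scale[of g "- 1"] by simp

lemma H2_sum: "finite I \<Longrightarrow> (\<And>i. i \<in> I \<Longrightarrow> f i \<in> H2) \<Longrightarrow> (\<lambda>z. \<Sum>i\<in>I. f i z) \<in> H2"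
  by (induction I rule: finite_induct) (auto intro: H2_add)

lemma h2norm_zero [simp]: "h2norm (\<lambda>z. 0) = 0"
  by (rule antisym[OF h2norm_le[OF h2_bound_zero] h2norm_nonneg[OF H2_zero]])

lemma h2norm_scale_le: "f \<in> H2 \<Longrightarrow> h2norm (\<lambda>z. c * f z) \<le> cmod c * h2norm f"
  by (rule h2norm_le[OF h2_bound_scale[OF h2_bound_h2norm]])

lemma h2norm_scale:
  assumes "f \<in> H2" shows "h2norm (\<lambda>z. c * f z) = cmod c * h2norm f"
proof (cases "c = 0")
  case False
  have "h2norm (\<lambda>z. inverse c * (c * f z)) \<le> cmod (inverse c) * h2norm (\<lambda>z. c * f z)"
    by (rule h2norm_scale_le[OF H2_scale[OF assms]])
  moreover have "(\<lambda>z. inverse c * (c * f z)) = f" using False by (auto simp: fun_eq_iff)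
  ultimately have "cmod c * h2norm f \<le> h2norm (\<lambda>z. c * f z)"
    using False by (simp add: norm_inverse inverse_eq_divide norm_divide pos_le_divide_eq mult.commute)
  then show ?thesis using h2norm_scale_le[OF assms, of c] by simp
qed simp

lemma h2norm_triangle: "f \<in> H2 \<Longrightarrow> g \<in> H2 \<Longrightarrow> h2norm (\<lambda>z. f z + g z) \<le> h2norm f + h2norm g"
  by (rule h2norm_le[OF h2_bound_add[OF h2_bound_h2norm h2_bound_h2norm]])

lemma h2norm_minus_commute:
  assumes "f \<in> H2" "g \<in> H2"
  shows "h2norm (\<lambda>z. f z - g z) = h2norm (\<lambda>z. g z - f z)"
  using h2norm_scale[OF H2_diff[OF assms], of "- 1"] by simp

lemma h2norm_triangle_diff:
  assumes "f \<in> H2" "g \<in> H2" "h \<in> H2"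
  shows "h2norm (\<lambda>z. f z - h z) \<le> h2norm (\<lambda>z. f z - g z) + h2norm (\<lambda>z. g z - h z)"
  using h2norm_triangle[OF H2_diff[OF assms(1,2)] H2_diff[OF assms(2,3)]] by simp

lemma h2norm_abs_diff_le:
  assumes "f \<in> H2" "g \<in> H2"
  shows "\<bar>h2norm f - h2norm g\<bar> \<le> h2norm (\<lambda>z. f z - g z)"
  using h2norm_triangle[OF H2_diff[OF assms] assms(2)] h2norm_triangle[OF H2_diff[OF assms(2,1)] assms(1)]
    h2norm_minus_commute[OF assms] by simp

lemma ev_point: "ev f {z} (\<lambda>_. 1) = f z"
  by (simp add: ev_def)

lemma cmod_le_h2norm:
  assumes "f \<in> H2" "z \<in> Ball_d"
  shows "cmod (f z) \<le> h2norm f * sqrt (Re (DAkernel z z))"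
  using cmod_ev_le[OF assms(1), of "{z}" "\<lambda>_. 1"] assms(2) by (simp add: ev_point) (simp add: form_def)

lemma h2norm_eq_zero:
  assumes "f \<in> H2" "h2norm f = 0" shows "f = (\<lambda>z. 0)"
proof
  fix z show "f z = 0"
    using cmod_le_h2norm[OF assms(1), of z] assms H2_off_ball[of f z] by (cases "z \<in> Ball_d") auto
qed

lemma ev_restr: "finite V \<Longrightarrow> T \<subseteq> V \<Longrightarrow> ev f V (restr T b) = ev f T b"
  unfolding ev_def by (rule sum_restr) auto

lemma comb_restr: "finite V \<Longrightarrow> T \<subseteq> V \<Longrightarrow> comb V (restr T b) = comb T b"
  unfolding comb_def by (rule ext, rule sum_restr) auto

lemma kquad_restr: "finite V \<Longrightarrow> T \<subseteq> V \<Longrightarrow> kquad V (restr T b) = kquad T b"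
  by (subst form_restr) (auto simp: form_def)

lemma ev_comb:
  assumes "T \<subseteq> Ball_d"
  shows "ev (comb T c) T b = form DAkernel T b c"
  unfolding ev_def comb_def form_def sum_distrib_left
  by (intro sum.cong refl) (use assms in \<open>auto simp: kfun_def\<close>)

lemma comb_off_ball: "z \<notin> Ball_d \<Longrightarrow> comb T b z = 0"
  by (simp add: comb_def kfun_def)

lemma h2_bound_comb:
  assumes "finite T" "T \<subseteq> Ball_d"
  shows "h2_bound (comb T b) (sqrt (kquad T b))"
proof (rule h2_boundI)
  show "0 \<le> sqrt (kquad T b)" using kquad_nonneg[OF assms] by simp
  fix U :: "(complex^'a) set" and c assume U: "finite U" "U \<subseteq> Ball_d"
  define V where "V = T \<union> U"
  have V: "finite V" "V \<subseteq> Ball_d" "T \<subseteq> V" "U \<subseteq> V" using assms U by (auto simp: V_def)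
  have "ev (comb T b) U c = form DAkernel V (restr U c) (restr T b)"
    using ev_comb[OF V(2), of "restr T b" "restr U c"] V by (simp add: ev_restr comb_restr)
  then have "(cmod (ev (comb T b) U c))\<^sup>2 \<le> kquad U c * kquad T b"
    using psd_cauchy_schwarz[OF psd_DAkernel V(1,2), of "restr U c" "restr T b"] V
    by (simp add: kquad_restr)
  then have "cmod (ev (comb T b) U c) \<le> sqrt (kquad U c * kquad T b)"
    by (rule real_le_rsqrt)
  then show "cmod (ev (comb T b) U c) \<le> sqrt (kquad T b) * sqrt (kquad U c)"
    by (simp add: real_sqrt_mult mult.commute)
qed

lemma comb_H2: "finite T \<Longrightarrow> T \<subseteq> Ball_d \<Longrightarrow> comb T b \<in> H2"
  by (rule H2I[OF comb_off_ball h2_bound_comb])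

text \<open>Cauchy-Schwarz gave the upper bound; testing the combination against its own
  coefficients gives \<open>q^2 \<le> N * q\<close>, hence equality.\<close>

lemma h2norm_comb_sq:
  assumes "finite T" "T \<subseteq> Ball_d"
  shows "(h2norm (comb T b))\<^sup>2 = kquad T b"
proof -
  define N where "N = h2norm (comb T b)"
  define q where "q = sqrt (kquad T b)"
  have q: "0 \<le> q" "kquad T b = q\<^sup>2" unfolding q_def using kquad_nonneg[OF assms, of b] by simp_all
  have N: "N \<le> q" "0 \<le> N" unfolding N_def q_def
    using h2norm_le[OF h2_bound_comb[OF assms]] h2norm_nonneg[OF comb_H2[OF assms]] by auto
  have "q\<^sup>2 \<le> N * q"
  proof -
    have "cmod (ev (comb T b) T b) \<le> N * q"
      unfolding N_def q_def by (rule cmod_ev_le[OF comb_H2[OF assms] assms])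
    moreover have "q\<^sup>2 \<le> cmod (ev (comb T b) T b)"
      unfolding ev_comb[OF assms(2)] q(2)[symmetric] by (rule complex_Re_le_cmod)
    ultimately show ?thesis by simp
  qed
  then have "q \<le> N" using q(1) N by (cases "q = 0") (auto simp: power2_eq_square)
  then have "N = q" using N by simp
  then show ?thesis using q by (simp add: N_def)
qed

lemma form_kernel_bound:
  "form (\<lambda>z w. of_real (C\<^sup>2) * DAkernel z w - f z * cnj (f w)) T b c
     = of_real (C\<^sup>2) * form DAkernel T b c - ev f T b * cnj (ev f T c)"
proof -
  have "ev f T b * cnj (ev f T c) = (\<Sum>z\<in>T. \<Sum>w\<in>T. cnj (b z) * c w * (f z * cnj (f w)))"
    unfolding ev_def cnj_sum sum_product by (simp add: mult_ac)
  then show ?thesis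
    by (simp add: form_def algebra_simps sum_subtractf sum_distrib_left)
qed

lemma h2_bound_psd:
  assumes "h2_bound f C"
  shows "psd Ball_d (\<lambda>z w. of_real (C\<^sup>2) * DAkernel z w - f z * cnj (f w))"
proof (rule psdI)
  show "of_real (C\<^sup>2) * DAkernel w z - f w * cnj (f z) = cnj (of_real (C\<^sup>2) * DAkernel z w - f z * cnj (f w))"
    if "z \<in> Ball_d" "w \<in> Ball_d" for z w
    using psd_herm[OF psd_DAkernel that] by (simp add: mult.commute)
  fix T :: "(complex^'a) set" and b assume T: "finite T" "T \<subseteq> Ball_d"
  have "(cmod (ev f T b))\<^sup>2 \<le> C\<^sup>2 * kquad T b" using assms T by (simp add: h2_bound_iff_sq)
  moreover have "ev f T b * cnj (ev f T b) = of_real ((cmod (ev f T b))\<^sup>2)"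
    by (simp only: complex_norm_square)
  ultimately show "0 \<le> Re (form (\<lambda>z w. of_real (C\<^sup>2) * DAkernel z w - f z * cnj (f w)) T b b)"
    unfolding form_kernel_bound by (simp flip: of_real_power)
qed

text \<open>If \<open>b\<close> nearly norms the functional given by \<open>f\<close>, then the Cauchy-Schwarz inequality for the
  positive semidefinite kernel \<open>C\<^sup>2 K - f f\<^sup>*\<close> forces \<open>f\<close> to be nearly a multiple of \<open>comb T b\<close>.\<close>
lemma comb_dense:
  assumes f: "f \<in> H2" and e: "\<epsilon> > 0"
  obtains T b where "finite T" "T \<subseteq> Ball_d" "h2norm (\<lambda>z. f z - comb T b z) < \<epsilon>"
proof (cases "h2norm f = 0")
  case True
  then have "h2norm (\<lambda>z. f z - comb {} b z) < \<epsilon>" for b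
    using e h2norm_eq_zero[OF f] by (simp add: comb_def)
  then show ?thesis using that[of "{}"] by simp
next
  case False
  define C where "C = h2norm f"
  define \<delta> where "\<delta> = \<epsilon> / 2"
  have C: "C > 0" using False h2norm_nonneg[OF f] by (simp add: C_def)
  have d: "\<delta> > 0" using e by (simp add: \<delta>_def)
  \<comment> \<open>Slightly smaller than the norm, so it fails as a bound. The value is chosen so
    that this failure, cleared of denominators, is the inequality \<open>main\<close>.\<close>
  define D where "D = C\<^sup>2 / sqrt (C\<^sup>2 + \<delta>\<^sup>2)"
  have sq: "sqrt (C\<^sup>2 + \<delta>\<^sup>2) > C" using C d by (simp add: real_less_rsqrt)
  have D: "0 \<le> D" by (simp add: D_def)
  have DC: "D < C"
  proof -
    have "sqrt (C\<^sup>2 + \<delta>\<^sup>2) > 0" using sq C by linarith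
    then show ?thesis unfolding D_def using sq C by (simp only: pos_divide_less_eq power2_eq_square mult_strict_left_mono)
  qed
  have "\<not> h2_bound f D" using h2norm_le[of f D] DC by (auto simp: C_def)
  then obtain T b where T: "finite T" "T \<subseteq> Ball_d" and big: "D\<^sup>2 * kquad T b < (cmod (ev f T b))\<^sup>2"
    using D unfolding h2_bound_iff_sq by (meson not_le)
  define p where "p = ev f T b"
  have p0: "(cmod p)\<^sup>2 > 0"
  proof -
    have "0 \<le> D\<^sup>2 * kquad T b" using kquad_nonneg[OF T, of b] by simp
    then show ?thesis using big unfolding p_def by linarith
  qed
  then have pnz: "p \<noteq> 0" by auto
  have D2: "D\<^sup>2 = C^4 / (C\<^sup>2 + \<delta>\<^sup>2)" unfolding D_def by (simp add: power_divide)
  have pos: "C\<^sup>2 + \<delta>\<^sup>2 > 0" using C d by (simp add: add_pos_pos)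
  have main: "C\<^sup>2 * (C\<^sup>2 * kquad T b - (cmod p)\<^sup>2) \<le> \<delta>\<^sup>2 * (cmod p)\<^sup>2"
  proof -
    have "C^4 * kquad T b \<le> (C\<^sup>2 + \<delta>\<^sup>2) * (cmod p)\<^sup>2"
      using big pos unfolding D2 p_def by (simp add: field_simps)
    moreover have "C\<^sup>2 * (C\<^sup>2 * kquad T b) = C^4 * kquad T b" by (simp add: power4_eq_xxxx power2_eq_square)
    ultimately show ?thesis by (simp add: algebra_simps)
  qed
  \<comment> \<open>With this factor the error functional equals minus the mixed value of the kernel
    \<open>B\<close> divided by \<open>cnj p\<close>, to which Cauchy-Schwarz applies.\<close>
  define s where "s = of_real (C\<^sup>2) / cnj p"
  have "h2_bound (\<lambda>z. f z - comb T (\<lambda>z. s * b z) z) \<delta>"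
    unfolding h2_bound_iff_sq
  proof (intro conjI allI impI)
    show "0 \<le> \<delta>" using d by simp
    fix U :: "(complex^'a) set" and c assume U: "finite U" "U \<subseteq> Ball_d"
    define V where "V = T \<union> U"
    have V: "finite V" "V \<subseteq> Ball_d" "T \<subseteq> V" "U \<subseteq> V" using T U by (auto simp: V_def)
    define B where "B = (\<lambda>z w. of_real (C\<^sup>2) * DAkernel z w - f z * cnj (f w))"
    have psdB: "psd Ball_d B" unfolding B_def by (rule h2_bound_psd) (simp add: C_def h2_bound_h2norm f)
    define k where "k = form DAkernel V (restr U c) (restr T b)"
    have B1: "form B V (restr U c) (restr T b) = of_real (C\<^sup>2) * k - ev f U c * cnj p"
      unfolding B_def form_kernel_bound k_def p_def using V by (simp add: ev_restr)
    have sqn: "Re (x * cnj x) = (cmod x)\<^sup>2" for x unfolding cmod_power2 by (simp add: power2_eq_square)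
    have B2: "Re (form B V (restr U c) (restr U c)) \<le> C\<^sup>2 * kquad U c"
      unfolding B_def form_kernel_bound using V by (simp add: ev_restr kquad_restr sqn flip: of_real_power del: complex_mult_cnj)
    have B3: "Re (form B V (restr T b) (restr T b)) = C\<^sup>2 * kquad T b - (cmod p)\<^sup>2"
      unfolding B_def form_kernel_bound using V by (simp add: ev_restr kquad_restr p_def cmod_power2 flip: of_real_power) (simp add: power2_eq_square)
    have B3': "0 \<le> C\<^sup>2 * kquad T b - (cmod p)\<^sup>2"
      using psd_nonneg[OF psdB V(1,2), of "restr T b"] B3 by simp
    have "ev (comb T (\<lambda>z. s * b z)) U c = s * k"
    proof -
      have "comb T (\<lambda>z. s * b z) = (\<lambda>x. s * comb V (restr T b) x)"
        unfolding comb_restr[OF V(1,3)] by (simp add: comb_def sum_distrib_left mult.assoc)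
      then have "ev (comb T (\<lambda>z. s * b z)) V (restr U c) = s * k"
        by (simp add: ev_scale ev_comb[OF V(2)] k_def)
      then show ?thesis by (simp add: ev_restr V)
    qed
    then have "ev (\<lambda>z. f z - comb T (\<lambda>z. s * b z) z) U c = ev f U c - s * k"
      by (simp add: ev_diff)
    also have "\<dots> = - form B V (restr U c) (restr T b) / cnj p"
      unfolding B1 s_def using pnz by (simp add: field_simps)
    finally have "(cmod (ev (\<lambda>z. f z - comb T (\<lambda>z. s * b z) z) U c))\<^sup>2
        = (cmod (form B V (restr U c) (restr T b)))\<^sup>2 / (cmod p)\<^sup>2"
      by (simp add: norm_divide power_divide)
    also have "\<dots> \<le> (C\<^sup>2 * kquad U c * (C\<^sup>2 * kquad T b - (cmod p)\<^sup>2)) / (cmod p)\<^sup>2"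
    proof (rule divide_right_mono)
      have "(cmod (form B V (restr U c) (restr T b)))\<^sup>2
          \<le> Re (form B V (restr U c) (restr U c)) * (C\<^sup>2 * kquad T b - (cmod p)\<^sup>2)"
        using psd_cauchy_schwarz[OF psdB V(1,2), of "restr U c" "restr T b"] B3 by simp
      also have "\<dots> \<le> C\<^sup>2 * kquad U c * (C\<^sup>2 * kquad T b - (cmod p)\<^sup>2)"
        using B2 B3' by (rule mult_right_mono)
      finally show "(cmod (form B V (restr U c) (restr T b)))\<^sup>2 \<le> C\<^sup>2 * kquad U c * (C\<^sup>2 * kquad T b - (cmod p)\<^sup>2)" .
    qed simp
    also have "\<dots> = kquad U c * (C\<^sup>2 * (C\<^sup>2 * kquad T b - (cmod p)\<^sup>2)) / (cmod p)\<^sup>2"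
      by (simp add: mult_ac)
    also have "\<dots> \<le> kquad U c * (\<delta>\<^sup>2 * (cmod p)\<^sup>2) / (cmod p)\<^sup>2"
      by (intro divide_right_mono mult_left_mono main kquad_nonneg U) simp
    also have "\<dots> = \<delta>\<^sup>2 * kquad U c" using p0 by simp
    finally show "(cmod (ev (\<lambda>z. f z - comb T (\<lambda>z. s * b z) z) U c))\<^sup>2 \<le> \<delta>\<^sup>2 * kquad U c" .
  qed
  then have "h2norm (\<lambda>z. f z - comb T (\<lambda>z. s * b z) z) \<le> \<delta>" by (rule h2norm_le)
  then show ?thesis using that[OF T, of "\<lambda>z. s * b z"] e by (simp add: \<delta>_def)
qed

section \<open>Norm convergence and the inner product\<close>

definition h2conv :: "(nat \<Rightarrow> complex^'d \<Rightarrow> complex) \<Rightarrow> (complex^'d \<Rightarrow> complex) \<Rightarrow> bool" where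
  "h2conv fs f \<longleftrightarrow> (\<forall>n. fs n \<in> H2) \<and> f \<in> H2 \<and> (\<lambda>n. h2norm (\<lambda>z. fs n z - f z)) \<longlonglongrightarrow> 0"

lemma h2convI:
  assumes "\<And>n. fs n \<in> H2" "f \<in> H2" "\<And>n. h2norm (\<lambda>z. fs n z - f z) \<le> e n" "e \<longlonglongrightarrow> 0"
  shows "h2conv fs f"
proof -
  have "(\<lambda>n. h2norm (\<lambda>z. fs n z - f z)) \<longlonglongrightarrow> 0"
    by (rule tendsto_sandwich[OF _ _ tendsto_const assms(4)])
      (auto intro!: always_eventually h2norm_nonneg H2_diff assms)
  then show ?thesis using assms by (simp add: h2conv_def)
qed

lemma h2conv_comb_exists:
  assumes "f \<in> H2"
  obtains Ts bs where "\<And>n. finite (Ts n)" "\<And>n. Ts n \<subseteq> Ball_d" "h2conv (\<lambda>n. comb (Ts n) (bs n)) f"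
proof -
  have "\<forall>n. \<exists>Tb. finite (fst Tb) \<and> fst Tb \<subseteq> Ball_d \<and> h2norm (\<lambda>z. f z - comb (fst Tb) (snd Tb) z) < inverse (real (Suc n))"
  proof
    fix n
    obtain T b where "finite T" "T \<subseteq> Ball_d" "h2norm (\<lambda>z. f z - comb T b z) < inverse (real (Suc n))"
      by (rule comb_dense[OF assms, of "inverse (real (Suc n))"]) auto
    then show "\<exists>Tb. finite (fst Tb) \<and> fst Tb \<subseteq> Ball_d \<and> h2norm (\<lambda>z. f z - comb (fst Tb) (snd Tb) z) < inverse (real (Suc n))"
      by (intro exI[of _ "(T, b)"]) simp
  qed
  then obtain Tb where Tb: "\<And>n. finite (fst (Tb n))" "\<And>n. fst (Tb n) \<subseteq> Ball_d"
    "\<And>n. h2norm (\<lambda>z. f z - comb (fst (Tb n)) (snd (Tb n)) z) < inverse (real (Suc n))"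
    by metis
  have "h2conv (\<lambda>n. comb (fst (Tb n)) (snd (Tb n))) f"
  proof (rule h2convI[OF comb_H2[OF Tb(1,2)] assms _ LIMSEQ_inverse_real_of_nat])
    show "h2norm (\<lambda>z. comb (fst (Tb n)) (snd (Tb n)) z - f z) \<le> inverse (real (Suc n))" for n
      unfolding h2norm_minus_commute[OF comb_H2[OF Tb(1,2)] assms] by (rule less_imp_le[OF Tb(3)])
  qed
  then show ?thesis by (rule that[OF Tb(1,2)])
qed

lemma h2conv_H2: "h2conv fs f \<Longrightarrow> fs n \<in> H2" "h2conv fs f \<Longrightarrow> f \<in> H2"
  by (simp_all add: h2conv_def)

lemma h2conv_norm: "h2conv fs f \<Longrightarrow> (\<lambda>n. h2norm (fs n)) \<longlonglongrightarrow> h2norm f"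
  unfolding tendsto_iff dist_real_def
proof (intro allI impI)
  fix e :: real assume c: "h2conv fs f" and "e > 0"
  then have "eventually (\<lambda>n. h2norm (\<lambda>z. fs n z - f z) < e) sequentially"
    unfolding h2conv_def by (intro order_tendstoD(2)[of _ 0]) auto
  then show "eventually (\<lambda>n. \<bar>h2norm (fs n) - h2norm f\<bar> < e) sequentially"
    by eventually_elim (rule le_less_trans[OF h2norm_abs_diff_le[OF h2conv_H2[OF c]]])
qed

lemma h2conv_const: "f \<in> H2 \<Longrightarrow> h2conv (\<lambda>_. f) f"
  by (simp add: h2conv_def)

lemma h2conv_scale: "h2conv fs f \<Longrightarrow> h2conv (\<lambda>n z. c * fs n z) (\<lambda>z. c * f z)"
proof -
  assume c: "h2conv fs f"
  have "h2norm (\<lambda>z. c * fs n z - c * f z) = cmod c * h2norm (\<lambda>z. fs n z - f z)" for n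
    using h2norm_scale[OF H2_diff[OF h2conv_H2[OF c]], of c n] by (simp add: right_diff_distrib)
  moreover have "(\<lambda>n. cmod c * h2norm (\<lambda>z. fs n z - f z)) \<longlonglongrightarrow> 0"
    using c unfolding h2conv_def by (intro tendsto_mult_right_zero) simp
  ultimately show ?thesis using c by (simp add: h2conv_def H2_scale)
qed

lemma h2conv_add:
  assumes "h2conv fs f" "h2conv gs g"
  shows "h2conv (\<lambda>n z. fs n z + gs n z) (\<lambda>z. f z + g z)"
proof (rule h2convI)
  note fg = h2conv_H2[OF assms(1)] h2conv_H2[OF assms(2)]
  show "(\<lambda>z. fs n z + gs n z) \<in> H2" "(\<lambda>z. f z + g z) \<in> H2" for n by (intro H2_add fg)+
  show "h2norm (\<lambda>z. fs n z + gs n z - (f z + g z)) \<le> h2norm (\<lambda>z. fs n z - f z) + h2norm (\<lambda>z. gs n z - g z)" for n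
    using h2norm_triangle[OF H2_diff[OF fg(1,2)] H2_diff[OF fg(3,4)], of n n] by (simp add: algebra_simps)
  show "(\<lambda>n. h2norm (\<lambda>z. fs n z - f z) + h2norm (\<lambda>z. gs n z - g z)) \<longlonglongrightarrow> 0"
    using assms by (intro tendsto_add_zero) (simp_all add: h2conv_def)
qed

lemma h2conv_inner:
  assumes "h2conv fs f" "h2conv gs g"
  shows "(\<lambda>n. h2inner (fs n) (gs n)) \<longlonglongrightarrow> h2inner f g"
  unfolding h2inner_def
  by (intro tendsto_intros h2conv_norm h2conv_add h2conv_scale assms)

lemma h2conv_point:
  assumes "h2conv fs f" shows "(\<lambda>n. fs n z) \<longlonglongrightarrow> f z"
proof (cases "z \<in> Ball_d")
  case True
  have "(\<lambda>n. fs n z - f z) \<longlonglongrightarrow> 0"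
  proof (rule Lim_null_comparison)
    show "eventually (\<lambda>n. norm (fs n z - f z) \<le> h2norm (\<lambda>z. fs n z - f z) * sqrt (Re (DAkernel z z))) sequentially"
      by (intro always_eventually allI cmod_le_h2norm[OF H2_diff[OF h2conv_H2[OF assms]] True])
    show "(\<lambda>n. h2norm (\<lambda>z. fs n z - f z) * sqrt (Re (DAkernel z z))) \<longlonglongrightarrow> 0"
      using assms unfolding h2conv_def by (intro tendsto_mult_left_zero) simp
  qed
  then show ?thesis by (simp add: LIM_zero_iff)
next
  case False
  then show ?thesis using assms by (simp add: H2_off_ball h2conv_H2[OF assms])
qed

lemma h2conv_ev: "h2conv fs f \<Longrightarrow> (\<lambda>n. ev (fs n) T b) \<longlonglongrightarrow> ev f T b"
  unfolding ev_def by (intro tendsto_intros h2conv_point)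

lemma comb_add_scale: "comb T (\<lambda>z. a z + s * b z) = (\<lambda>x. comb T a x + s * comb T b x)"
  by (simp add: comb_def algebra_simps sum.distrib sum_distrib_left)

text \<open>Expand the four squared norms in the polarization sum. The sums of \<open>\<i>^k\<close>
  and of \<open>\<i>^(2*k)\<close> over \<open>k < 4\<close> vanish, so only the term carrying the
  conjugate of \<open>\<i>^k\<close> survives, four times.\<close>

lemma h2inner_comb_comb:
  assumes T: "finite T" "T \<subseteq> Ball_d"
  shows "h2inner (comb T a) (comb T b) = form DAkernel T b a"
proof -
  have n: "complex_of_real ((h2norm (\<lambda>x. comb T a x + s * comb T b x))\<^sup>2)
      = form DAkernel T a a + s * form DAkernel T a b + cnj s * form DAkernel T b a + cnj s * s * form DAkernel T b b" for s
  proof -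
    have "complex_of_real ((h2norm (\<lambda>x. comb T a x + s * comb T b x))\<^sup>2)
        = form DAkernel T (\<lambda>z. a z + s * b z) (\<lambda>z. a z + s * b z)"
      unfolding comb_add_scale[symmetric] h2norm_comb_sq[OF T]
      by (rule form_diag_real[OF psd_DAkernel T(2), symmetric])
    then show ?thesis
      by (simp add: form_add_left form_add_right form_scale_left form_scale_right algebra_simps)
  qed
  show ?thesis
    unfolding h2inner_def n by (simp add: numeral_eq_Suc algebra_simps)
qed

text \<open>For \<open>f\<close> a kernel combination both sides are the same form on the union of
  the supports. Both sides are continuous under \<open>h2conv\<close>, so density extends the
  formula to every \<open>f\<close>.\<close>

lemma h2inner_comb:
  assumes f: "f \<in> H2" and T: "finite T" "T \<subseteq> Ball_d"
  shows "h2inner f (comb T b) = ev f T b"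
proof -
  have *: "h2inner (comb U a) (comb T b) = ev (comb U a) T b" if U: "finite U" "U \<subseteq> Ball_d" for U a
  proof -
    define V where "V = T \<union> U"
    have V: "finite V" "V \<subseteq> Ball_d" "T \<subseteq> V" "U \<subseteq> V" using T U by (auto simp: V_def)
    show ?thesis
      using h2inner_comb_comb[OF V(1,2), of "restr U a" "restr T b"] ev_comb[OF V(2), of "restr U a" "restr T b"]
      by (simp add: comb_restr ev_restr V)
  qed
  obtain Ts bs where c: "\<And>n. finite (Ts n)" "\<And>n. Ts n \<subseteq> Ball_d" "h2conv (\<lambda>n. comb (Ts n) (bs n)) f"
    using h2conv_comb_exists[OF f] by blast
  have "(\<lambda>n. h2inner (comb (Ts n) (bs n)) (comb T b)) \<longlonglongrightarrow> h2inner f (comb T b)"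
    by (rule h2conv_inner[OF c(3) h2conv_const[OF comb_H2[OF T]]])
  then have "(\<lambda>n. ev (comb (Ts n) (bs n)) T b) \<longlonglongrightarrow> h2inner f (comb T b)"
    by (simp add: * c)
  then show ?thesis using h2conv_ev[OF c(3)] LIMSEQ_unique by blast
qed

text \<open>Polarization alone does not show additivity. Against a kernel combination it is the
  additivity of \<open>ev\<close>; approximating \<open>g\<close> by such combinations gives the
  general case.\<close>

lemma h2inner_add_left:
  assumes "f \<in> H2" "f' \<in> H2" "g \<in> H2"
  shows "h2inner (\<lambda>z. f z + f' z) g = h2inner f g + h2inner f' g"
proof -
  obtain Ts bs where c: "\<And>n. finite (Ts n)" "\<And>n. Ts n \<subseteq> Ball_d" "h2conv (\<lambda>n. comb (Ts n) (bs n)) g"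
    using h2conv_comb_exists[OF assms(3)] by blast
  have "h2inner (\<lambda>z. f z + f' z) (comb (Ts n) (bs n)) = h2inner f (comb (Ts n) (bs n)) + h2inner f' (comb (Ts n) (bs n))" for n
    by (simp add: h2inner_comb assms c H2_add ev_add)
  then have "(\<lambda>n. h2inner (\<lambda>z. f z + f' z) (comb (Ts n) (bs n))) \<longlonglongrightarrow> h2inner f g + h2inner f' g"
    by (simp only:) (intro tendsto_intros h2conv_inner h2conv_const assms c)
  moreover have "(\<lambda>n. h2inner (\<lambda>z. f z + f' z) (comb (Ts n) (bs n))) \<longlonglongrightarrow> h2inner (\<lambda>z. f z + f' z) g"
    by (intro h2conv_inner h2conv_const H2_add assms c)
  ultimately show ?thesis using LIMSEQ_unique by blast
qed

lemma h2inner_scale_left: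
  assumes "f \<in> H2" "g \<in> H2"
  shows "h2inner (\<lambda>z. s * f z) g = s * h2inner f g"
proof -
  obtain Ts bs where c: "\<And>n. finite (Ts n)" "\<And>n. Ts n \<subseteq> Ball_d" "h2conv (\<lambda>n. comb (Ts n) (bs n)) g"
    using h2conv_comb_exists[OF assms(2)] by blast
  have "h2inner (\<lambda>z. s * f z) (comb (Ts n) (bs n)) = s * h2inner f (comb (Ts n) (bs n))" for n
    by (simp add: h2inner_comb assms c H2_scale ev_scale)
  then have "(\<lambda>n. h2inner (\<lambda>z. s * f z) (comb (Ts n) (bs n))) \<longlonglongrightarrow> s * h2inner f g"
    by (simp only:) (intro tendsto_intros h2conv_inner h2conv_const assms c)
  moreover have "(\<lambda>n. h2inner (\<lambda>z. s * f z) (comb (Ts n) (bs n))) \<longlonglongrightarrow> h2inner (\<lambda>z. s * f z) g"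
    by (intro h2conv_inner h2conv_const H2_scale assms c)
  ultimately show ?thesis using LIMSEQ_unique by blast
qed

lemma h2inner_cauchy_schwarz:
  assumes "f \<in> H2" "g \<in> H2"
  shows "cmod (h2inner f g) \<le> h2norm f * h2norm g"
proof -
  obtain Ts bs where c: "\<And>n. finite (Ts n)" "\<And>n. Ts n \<subseteq> Ball_d" "h2conv (\<lambda>n. comb (Ts n) (bs n)) g"
    using h2conv_comb_exists[OF assms(2)] by blast
  have "cmod (h2inner f (comb (Ts n) (bs n))) \<le> h2norm f * h2norm (comb (Ts n) (bs n))" for n
  proof -
    have "h2norm (comb (Ts n) (bs n)) = sqrt (kquad (Ts n) (bs n))"
      using h2norm_comb_sq[OF c(1,2), of n "bs n"] h2norm_nonneg[OF comb_H2[OF c(1,2)]]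
      by (metis real_sqrt_unique)
    then show ?thesis using cmod_ev_le[OF assms(1) c(1,2)] by (simp add: h2inner_comb assms c)
  qed
  moreover have "(\<lambda>n. cmod (h2inner f (comb (Ts n) (bs n)))) \<longlonglongrightarrow> cmod (h2inner f g)"
    by (intro tendsto_intros h2conv_inner h2conv_const assms c)
  moreover have "(\<lambda>n. h2norm f * h2norm (comb (Ts n) (bs n))) \<longlonglongrightarrow> h2norm f * h2norm g"
    by (intro tendsto_intros h2conv_norm c)
  ultimately show ?thesis by (intro LIMSEQ_le) auto
qed

lemma h2inner_self:
  assumes "f \<in> H2" shows "h2inner f f = of_real ((h2norm f)\<^sup>2)"
proof -
  have *: "h2norm (\<lambda>z. f z + s * f z) = cmod (1 + s) * h2norm f" for s
    using h2norm_scale[OF assms, of "1 + s"] by (simp add: algebra_simps)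
  have "cmod (1 + \<i>) = cmod (1 - \<i>)" by (simp add: cmod_def)
  then show ?thesis
    unfolding h2inner_def * by (simp add: numeral_eq_Suc power_mult_distrib algebra_simps)
qed

lemma h2inner_commute:
  assumes "f \<in> H2" "g \<in> H2" shows "h2inner g f = cnj (h2inner f g)"
proof -
  \<comment> \<open>Multiplication by a unimodular scalar exchanges the roles of \<open>f\<close>
    and \<open>g\<close>; applied to the four powers of \<open>\<i>\<close> it permutes the
    polarization terms.\<close>
  have *: "h2norm (\<lambda>z. g z + s * f z) = h2norm (\<lambda>z. f z + t * g z)" if "cmod s = 1" "s * t = 1" for s t
  proof -
    have "h2norm (\<lambda>z. s * (f z + t * g z)) = h2norm (\<lambda>z. f z + t * g z)"
      using h2norm_scale[OF H2_add[OF assms(1) H2_scale[OF assms(2)]], of s t] that by simp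
    moreover have "(\<lambda>z. s * (f z + t * g z)) = (\<lambda>z. g z + s * f z)"
      using that(2) by (auto simp: algebra_simps mult.assoc[symmetric])
    ultimately show ?thesis by simp
  qed
  show ?thesis
    unfolding h2inner_def
    using *[of 1 1] *[of "\<i>" "- \<i>"] *[of "- 1" "- 1"] *[of "- \<i>" "\<i>"]
    by (simp add: numeral_eq_Suc algebra_simps)
qed

lemma h2inner_diff_left:
  assumes "f \<in> H2" "f' \<in> H2" "g \<in> H2"
  shows "h2inner (\<lambda>z. f z - f' z) g = h2inner f g - h2inner f' g"
  using h2inner_add_left[OF assms(1) H2_scale[OF assms(2), of "- 1"] assms(3)]
    h2inner_scale_left[OF assms(2,3), of "- 1"] by simp

lemma h2inner_add_right:
  assumes "f \<in> H2" "g \<in> H2" "g' \<in> H2"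
  shows "h2inner f (\<lambda>z. g z + g' z) = h2inner f g + h2inner f g'"
  using h2inner_add_left[OF assms(2,3,1)]
  by (simp add: h2inner_commute[OF assms(2,1)] h2inner_commute[OF assms(3,1)] h2inner_commute[OF H2_add[OF assms(2,3)] assms(1)])

lemma h2inner_scale_right:
  assumes "f \<in> H2" "g \<in> H2"
  shows "h2inner f (\<lambda>z. s * g z) = cnj s * h2inner f g"
  using h2inner_scale_left[OF assms(2,1), of s]
  by (simp add: h2inner_commute[OF assms(2,1)] h2inner_commute[OF H2_scale[OF assms(2)] assms(1)])

lemma h2inner_diff_right:
  assumes "f \<in> H2" "g \<in> H2" "g' \<in> H2"
  shows "h2inner f (\<lambda>z. g z - g' z) = h2inner f g - h2inner f g'"
  using h2inner_add_right[OF assms(1,2) H2_scale[OF assms(3), of "- 1"]]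
    h2inner_scale_right[OF assms(1,3), of "- 1"] by simp

lemma h2inner_zero_right [simp]: "g \<in> H2 \<Longrightarrow> h2inner g (\<lambda>z. 0) = 0"
  using h2inner_scale_right[of g "\<lambda>z. 0" 0] by simp

lemma h2inner_sum_right:
  assumes "finite I" "\<And>i. i \<in> I \<Longrightarrow> f i \<in> H2" "g \<in> H2"
  shows "h2inner g (\<lambda>z. \<Sum>i\<in>I. f i z) = (\<Sum>i\<in>I. h2inner g (f i))"
  using assms(1,2)
  by (induction I rule: finite_induct) (simp_all add: h2inner_add_right H2_sum assms(3))

lemma comb_singleton: "comb {w} (\<lambda>_. 1) = kfun w"
  by (simp add: comb_def)

lemma kfun_H2: "w \<in> Ball_d \<Longrightarrow> kfun w \<in> H2"
  using comb_H2[of "{w}" "\<lambda>_. 1"] by (simp add: comb_singleton)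

lemma h2inner_kfun: "f \<in> H2 \<Longrightarrow> w \<in> Ball_d \<Longrightarrow> h2inner f (kfun w) = f w"
  using h2inner_comb[of f "{w}" "\<lambda>_. 1"] by (simp add: comb_singleton ev_point)

lemma h2norm_kfun_sq: "w \<in> Ball_d \<Longrightarrow> (h2norm (kfun w))\<^sup>2 = Re (DAkernel w w)"
  using h2norm_comb_sq[of "{w}" "\<lambda>_. 1"] by (simp add: comb_singleton) (simp add: form_def)

lemma h2norm_sq_diff_scale:
  assumes "u \<in> H2" "h \<in> H2"
  shows "(h2norm (\<lambda>z. u z - t * h z))\<^sup>2 = (h2norm u)\<^sup>2 - 2 * Re (cnj t * h2inner u h) + (cmod t)\<^sup>2 * (h2norm h)\<^sup>2"
proof -
  have m: "(\<lambda>z. t * h z) \<in> H2" by (rule H2_scale[OF assms(2)])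
  have "complex_of_real ((h2norm (\<lambda>z. u z - t * h z))\<^sup>2) = h2inner (\<lambda>z. u z - t * h z) (\<lambda>z. u z - t * h z)"
    by (rule h2inner_self[OF H2_diff[OF assms(1) m], symmetric])
  also have "\<dots> = h2inner u u - cnj t * h2inner u h - t * cnj (h2inner u h) + t * cnj t * h2inner h h"
    by (simp add: h2inner_diff_left h2inner_diff_right assms m H2_diff h2inner_scale_left h2inner_scale_right
        h2inner_commute[OF assms] algebra_simps)
  also have "\<dots> = of_real ((h2norm u)\<^sup>2) - (cnj t * h2inner u h + cnj (cnj t * h2inner u h)) + of_real ((cmod t)\<^sup>2) * of_real ((h2norm h)\<^sup>2)"
    unfolding h2inner_self[OF assms(1)] h2inner_self[OF assms(2)] complex_norm_square by simp
  also have "\<dots> = of_real ((h2norm u)\<^sup>2 - 2 * Re (cnj t * h2inner u h) + (cmod t)\<^sup>2 * (h2norm h)\<^sup>2)"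
    unfolding complex_add_cnj by simp
  finally show ?thesis by (simp only: of_real_eq_iff)
qed

section \<open>Completeness and orthogonal projections\<close>

lemma H2_complete:
  assumes fs: "\<And>n. fs n \<in> H2"
    and cauchy: "\<And>\<epsilon>. \<epsilon> > 0 \<Longrightarrow> \<exists>N. \<forall>m\<ge>N. \<forall>n\<ge>N. h2norm (\<lambda>z. fs m z - fs n z) < \<epsilon>"
  obtains f where "h2conv fs f"
proof -
  have ptw: "\<exists>y. (\<lambda>n. fs n z) \<longlonglongrightarrow> y" for z
  proof (cases "z \<in> Ball_d")
    case True
    define K where "K = sqrt (Re (DAkernel z z)) + 1"
    have K: "K > 0" unfolding K_def using psd_diag_nonneg[OF psd_DAkernel True] by (simp add: add_nonneg_pos)
    have "Cauchy (\<lambda>n. fs n z)" unfolding Cauchy_def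
    proof (intro allI impI)
      fix e :: real assume "e > 0"
      then have "e / K > 0" using K by simp
      then obtain N where N: "\<forall>m\<ge>N. \<forall>n\<ge>N. h2norm (\<lambda>z. fs m z - fs n z) < e / K" using cauchy by blast
      have "dist (fs m z) (fs n z) < e" if "m \<ge> N" "n \<ge> N" for m n
      proof -
        have d: "(\<lambda>z. fs m z - fs n z) \<in> H2" using fs H2_diff by blast
        have "dist (fs m z) (fs n z) \<le> h2norm (\<lambda>z. fs m z - fs n z) * sqrt (Re (DAkernel z z))"
          unfolding dist_norm using cmod_le_h2norm[OF d True] by simp
        also have "\<dots> \<le> h2norm (\<lambda>z. fs m z - fs n z) * K"
          unfolding K_def by (intro mult_left_mono h2norm_nonneg d) simp
        also have "\<dots> < e / K * K" using N that K by (intro mult_strict_right_mono) auto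
        finally show ?thesis using K by simp
      qed
      then show "\<exists>M. \<forall>m\<ge>M. \<forall>n\<ge>M. dist (fs m z) (fs n z) < e" by blast
    qed
    then show ?thesis using Cauchy_convergent convergent_def by blast
  next
    case False
    then have "fs n z = 0" for n using fs H2_off_ball by blast
    then show ?thesis by auto
  qed
  define f where "f z = lim (\<lambda>n. fs n z)" for z
  have lim: "(\<lambda>n. fs n z) \<longlonglongrightarrow> f z" for z
    unfolding f_def using ptw[of z] convergent_def convergent_LIMSEQ_iff by blast
  \<comment> \<open>For a fixed finite family the Cauchy estimate involves finitely many point
    values, so it survives the pointwise limit in \<open>n\<close>.\<close>
  have bound: "\<exists>N. \<forall>m\<ge>N. h2_bound (\<lambda>z. fs m z - f z) \<epsilon>" if e: "\<epsilon> > 0" for \<epsilon>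
  proof -
    obtain N where N: "\<forall>m\<ge>N. \<forall>n\<ge>N. h2norm (\<lambda>z. fs m z - fs n z) < \<epsilon>" using cauchy[OF e] by blast
    have "h2_bound (\<lambda>z. fs m z - f z) \<epsilon>" if m: "m \<ge> N" for m
    proof (rule h2_boundI)
      show "0 \<le> \<epsilon>" using e by simp
      fix T :: "(complex^'a) set" and b assume T: "finite T" "T \<subseteq> Ball_d"
      have "(\<lambda>n. cmod (ev (\<lambda>z. fs m z - fs n z) T b)) \<longlonglongrightarrow> cmod (ev (\<lambda>z. fs m z - f z) T b)"
        unfolding ev_def by (intro tendsto_intros lim)
      then show "cmod (ev (\<lambda>z. fs m z - f z) T b) \<le> \<epsilon> * sqrt (kquad T b)"
      proof (rule LIMSEQ_le_const2)
        have "cmod (ev (\<lambda>z. fs m z - fs n z) T b) \<le> \<epsilon> * sqrt (kquad T b)" if "n \<ge> N" for n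
          by (rule order_trans[OF cmod_ev_le[OF H2_diff[OF fs fs] T]], rule mult_right_mono)
            (use N m that kquad_nonneg[OF T] in \<open>auto intro: less_imp_le\<close>)
        then show "\<exists>N. \<forall>n\<ge>N. cmod (ev (\<lambda>z. fs m z - fs n z) T b) \<le> \<epsilon> * sqrt (kquad T b)" by blast
      qed
    qed
    then show ?thesis by blast
  qed
  have off: "f z = 0" if "z \<notin> Ball_d" for z
    using lim[of z] that H2_off_ball[OF fs] by (simp add: LIMSEQ_const_iff)
  obtain N where N: "h2_bound (\<lambda>z. fs N z - f z) 1" using bound[of 1] by auto
  have "(\<lambda>z. fs N z - f z) \<in> H2" using N off H2_off_ball[OF fs] by (intro H2I) auto
  then have f: "f \<in> H2" using H2_diff[OF fs[of N], of "\<lambda>z. fs N z - f z"] by simp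
  have "(\<lambda>n. h2norm (\<lambda>z. fs n z - f z)) \<longlonglongrightarrow> 0"
  proof (rule LIMSEQ_I)
    fix r :: real assume "r > 0"
    then obtain N where "\<forall>m\<ge>N. h2_bound (\<lambda>z. fs m z - f z) (r / 2)" using bound[of "r / 2"] by auto
    then have "norm (h2norm (\<lambda>z. fs m z - f z) - 0) < r" if "m \<ge> N" for m
      using h2norm_le[of "\<lambda>z. fs m z - f z" "r / 2"] h2norm_nonneg[OF H2_diff[OF fs[of m] f]] that \<open>r > 0\<close> by auto
    then show "\<exists>no. \<forall>n\<ge>no. norm (h2norm (\<lambda>z. fs n z - f z) - 0) < r" by blast
  qed
  then show ?thesis using fs f by (intro that[of f]) (simp add: h2conv_def)
qed

definition closed_subspace :: "(complex^'d \<Rightarrow> complex) set \<Rightarrow> bool" where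
  "closed_subspace S \<longleftrightarrow> S \<subseteq> H2 \<and> (\<lambda>z. 0) \<in> S \<and> (\<forall>f\<in>S. \<forall>g\<in>S. \<forall>c. (\<lambda>z. f z + c * g z) \<in> S) \<and>
     (\<forall>fs f. h2conv fs f \<longrightarrow> (\<forall>n. fs n \<in> S) \<longrightarrow> f \<in> S)"

text \<open>A quantitative form of the orthogonality of a minimizer. Moving \<open>g\<close> by the
  optimal multiple of \<open>h\<close> lowers the squared distance by
  \<open>(cmod p)^2 / (h2norm h)^2\<close>, and this gain cannot exceed the slack
  \<open>\<eta>^2\<close>.\<close>

lemma near_minimizer_orthogonal:
  assumes S: "closed_subspace S" and f: "f \<in> H2" and g: "g \<in> S" and h: "h \<in> S"
    and d: "\<And>g. g \<in> S \<Longrightarrow> d \<le> h2norm (\<lambda>z. f z - g z)" "0 \<le> d"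
    and near: "(h2norm (\<lambda>z. f z - g z))\<^sup>2 \<le> d\<^sup>2 + \<eta>\<^sup>2" "0 \<le> \<eta>"
  shows "cmod (h2inner (\<lambda>z. f z - g z) h) \<le> \<eta> * h2norm h"
proof -
  have gh: "g \<in> H2" "h \<in> H2" using S g h by (auto simp: closed_subspace_def)
  define u where "u = (\<lambda>z. f z - g z)"
  have u: "u \<in> H2" unfolding u_def by (rule H2_diff[OF f gh(1)])
  define p where "p = h2inner u h"
  show ?thesis
  proof (cases "h2norm h = 0")
    case True
    then show ?thesis using h2inner_cauchy_schwarz[OF u gh(2)] by (simp add: u_def)
  next
    case False
    then have hp: "h2norm h > 0" using h2norm_nonneg[OF gh(2)] by simp
    define t where "t = p / of_real ((h2norm h)\<^sup>2)"
    have "(\<lambda>z. g z + t * h z) \<in> S" using S g h by (simp add: closed_subspace_def)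
    then have "d \<le> h2norm (\<lambda>z. u z - t * h z)" using d(1)[of "\<lambda>z. g z + t * h z"] by (simp add: u_def algebra_simps)
    then have "d\<^sup>2 \<le> (h2norm (\<lambda>z. u z - t * h z))\<^sup>2" using d(2) by (rule power_mono)
    also have "\<dots> = (h2norm u)\<^sup>2 - 2 * Re (cnj t * p) + (cmod t)\<^sup>2 * (h2norm h)\<^sup>2"
      unfolding p_def by (rule h2norm_sq_diff_scale[OF u gh(2)])
    also have "Re (cnj t * p) = (cmod p)\<^sup>2 / (h2norm h)\<^sup>2"
    proof -
      have "cnj t * p = of_real ((cmod p)\<^sup>2) / of_real ((h2norm h)\<^sup>2)"
        unfolding t_def complex_norm_square by (simp add: mult.commute)
      then show ?thesis by (simp flip: of_real_divide of_real_power)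
    qed
    also have "(cmod t)\<^sup>2 * (h2norm h)\<^sup>2 = (cmod p)\<^sup>2 / (h2norm h)\<^sup>2"
      unfolding t_def using hp by (simp add: norm_divide norm_mult power2_eq_square)
    finally have "(cmod p)\<^sup>2 / (h2norm h)\<^sup>2 \<le> \<eta>\<^sup>2" using near(1) by (simp add: u_def)
    then have "(cmod p)\<^sup>2 \<le> (\<eta> * h2norm h)\<^sup>2" using hp by (simp add: pos_divide_le_eq power_mult_distrib)
    then have "cmod p \<le> \<eta> * h2norm h" using near(2) hp by (auto intro: power2_le_imp_le[of "cmod p"])
    then show ?thesis by (simp add: p_def u_def)
  qed
qed

lemma projection_exists:
  assumes S: "closed_subspace S" and f: "f \<in> H2"
  obtains g where "g \<in> S" "\<And>h. h \<in> S \<Longrightarrow> h2inner (\<lambda>z. f z - g z) h = 0"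
proof -
  have SH: "S \<subseteq> H2" and S0: "(\<lambda>z. 0) \<in> S" using S by (auto simp: closed_subspace_def)
  define d where "d = Inf ((\<lambda>g. h2norm (\<lambda>z. f z - g z)) ` S)"
  have nn: "0 \<le> h2norm (\<lambda>z. f z - g z)" if "g \<in> S" for g
    using that SH f by (intro h2norm_nonneg H2_diff) auto
  have d: "d \<le> h2norm (\<lambda>z. f z - g z)" if "g \<in> S" for g
    unfolding d_def using that nn by (intro cInf_lower bdd_belowI[of _ 0]) auto
  have d0: "0 \<le> d" unfolding d_def using S0 nn by (intro cInf_greatest) auto
  define \<eta> where "\<eta> n = inverse (real (Suc n))" for n
  have e0: "\<eta> n > 0" for n by (simp add: \<eta>_def)
  have "\<exists>g\<in>S. (h2norm (\<lambda>z. f z - g z))\<^sup>2 \<le> d\<^sup>2 + (\<eta> n)\<^sup>2" for n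
  proof -
    have "d < sqrt (d\<^sup>2 + (\<eta> n)\<^sup>2)" using e0[of n] d0 by (simp add: real_less_rsqrt)
    then obtain g where "g \<in> S" "h2norm (\<lambda>z. f z - g z) < sqrt (d\<^sup>2 + (\<eta> n)\<^sup>2)"
      using cInf_lessD[of "(\<lambda>g. h2norm (\<lambda>z. f z - g z)) ` S"] S0 unfolding d_def by blast
    then show ?thesis using nn[of g]
      by (intro bexI[of _ g] sqrt_ge_absD) auto
  qed
  then obtain gs where gs: "\<And>n. gs n \<in> S" and near: "\<And>n. (h2norm (\<lambda>z. f z - gs n z))\<^sup>2 \<le> d\<^sup>2 + (\<eta> n)\<^sup>2"
    by metis
  have gH: "gs n \<in> H2" for n using gs SH by auto
  have orth: "cmod (h2inner (\<lambda>z. f z - gs n z) h) \<le> \<eta> n * h2norm h" if "h \<in> S" for n h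
    by (rule near_minimizer_orthogonal[OF S f gs that d d0 near less_imp_le[OF e0]])
  \<comment> \<open>The difference of two near minimizers lies in \<open>S\<close> and is also the
    difference of their residuals. Being nearly orthogonal to both residuals, it is nearly
    orthogonal to itself; this replaces the parallelogram law.\<close>
  have dist: "h2norm (\<lambda>z. gs m z - gs n z) \<le> \<eta> m + \<eta> n" for m n
  proof -
    define h where "h = (\<lambda>z. gs m z - gs n z)"
    have "(\<lambda>z. gs m z + (- 1) * gs n z) \<in> S" using S gs unfolding closed_subspace_def by blast
    then have hS: "h \<in> S" by (simp add: h_def)
    then have hH: "h \<in> H2" using SH by auto
    have "h = (\<lambda>z. (f z - gs n z) - (f z - gs m z))" by (simp add: h_def)
    then have "h2inner h h = h2inner (\<lambda>z. f z - gs n z) h - h2inner (\<lambda>z. f z - gs m z) h"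
      using h2inner_diff_left[OF H2_diff[OF f gH[of n]] H2_diff[OF f gH[of m]] hH] by simp
    then have "cmod (h2inner h h) \<le> \<eta> n * h2norm h + \<eta> m * h2norm h"
      using norm_triangle_ineq4[of "h2inner (\<lambda>z. f z - gs n z) h" "h2inner (\<lambda>z. f z - gs m z) h"]
        orth[OF hS, of n] orth[OF hS, of m] by simp
    then have "(h2norm h)\<^sup>2 \<le> (\<eta> m + \<eta> n) * h2norm h"
      by (simp add: h2inner_self[OF hH] norm_power algebra_simps)
    then have "h2norm h \<le> \<eta> m + \<eta> n"
      using h2norm_nonneg[OF hH] e0[of m] e0[of n] by (cases "h2norm h = 0") (auto simp: power2_eq_square)
    then show ?thesis by (simp add: h_def)
  qed
  have elim: "\<eta> \<longlonglongrightarrow> 0" unfolding \<eta>_def by (rule LIMSEQ_inverse_real_of_nat)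
  obtain g where g: "h2conv gs g"
  proof (rule H2_complete[OF gH])
    fix \<epsilon> :: real assume "\<epsilon> > 0"
    then have "eventually (\<lambda>n. \<eta> n < \<epsilon> / 2) sequentially" using elim by (intro order_tendstoD) auto
    then obtain N where N: "\<forall>n\<ge>N. \<eta> n < \<epsilon> / 2" unfolding eventually_sequentially by blast
    have "h2norm (\<lambda>z. gs m z - gs n z) < \<epsilon>" if "m \<ge> N" "n \<ge> N" for m n
    proof -
      have "\<eta> m < \<epsilon> / 2" "\<eta> n < \<epsilon> / 2" using N that by auto
      then show ?thesis using dist[of m n] by simp
    qed
    then show "\<exists>N. \<forall>m\<ge>N. \<forall>n\<ge>N. h2norm (\<lambda>z. gs m z - gs n z) < \<epsilon>" by blast
  qed
  have gS: "g \<in> S" using S g gs unfolding closed_subspace_def by blast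
  have "h2inner (\<lambda>z. f z - g z) h = 0" if h: "h \<in> S" for h
  proof -
    have hH: "h \<in> H2" using h SH by auto
    have "h2conv (\<lambda>n z. f z + (- 1) * gs n z) (\<lambda>z. f z + (- 1) * g z)"
      by (intro h2conv_add h2conv_scale h2conv_const f g)
    then have "(\<lambda>n. h2inner (\<lambda>z. f z - gs n z) h) \<longlonglongrightarrow> h2inner (\<lambda>z. f z - g z) h"
      using h2conv_inner[OF _ h2conv_const[OF hH]] by fastforce
    moreover have "(\<lambda>n. h2inner (\<lambda>z. f z - gs n z) h) \<longlonglongrightarrow> 0"
    proof (rule Lim_null_comparison)
      show "eventually (\<lambda>n. norm (h2inner (\<lambda>z. f z - gs n z) h) \<le> \<eta> n * h2norm h) sequentially"
        using orth[OF h] by simp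
      show "(\<lambda>n. \<eta> n * h2norm h) \<longlonglongrightarrow> 0" by (rule tendsto_mult_left_zero[OF elim])
    qed
    ultimately show ?thesis using LIMSEQ_unique by blast
  qed
  then show ?thesis using that gS by blast
qed

section \<open>Reproducing kernels of spaces of functions with prescribed zeros\<close>

text \<open>The coordinates are moved into the coefficients, giving families \<open>c j\<close>.
  After Cauchy-Schwarz over \<open>j\<close> the estimate reduces to the sum of
  \<open>kquad T (c j)\<close>, which by \<open>DAkernel_eq\<close> is \<open>kquad T b\<close>
  minus the square of a modulus.\<close>

lemma row_contraction_bound:
  fixes f :: "'d \<Rightarrow> complex^'d \<Rightarrow> complex"
  assumes f: "\<And>j. f j \<in> H2"
  shows "h2_bound (\<lambda>z. \<Sum>j\<in>UNIV. coord j z * f j z) (sqrt (\<Sum>j\<in>UNIV. (h2norm (f j))\<^sup>2))"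
proof (rule h2_boundI)
  show "0 \<le> sqrt (\<Sum>j\<in>UNIV. (h2norm (f j))\<^sup>2)" by (simp add: sum_nonneg)
  fix T :: "(complex^'d) set" and b :: "complex^'d \<Rightarrow> complex" assume T: "finite T" "T \<subseteq> Ball_d"
  define c where "c j = (\<lambda>z. b z * cnj (z $ j))" for j
  have "ev (\<lambda>z. \<Sum>j\<in>UNIV. coord j z * f j z) T b = (\<Sum>z\<in>T. \<Sum>j\<in>UNIV. cnj (c j z) * f j z)"
    unfolding ev_def sum_distrib_left
    by (intro sum.cong refl) (use T in \<open>auto simp: coord_def c_def\<close>)
  also have "\<dots> = (\<Sum>j\<in>UNIV. ev (f j) T (c j))" unfolding ev_def by (rule sum.swap)
  finally have "cmod (ev (\<lambda>z. \<Sum>j\<in>UNIV. coord j z * f j z) T b) \<le> (\<Sum>j\<in>UNIV. cmod (ev (f j) T (c j)))"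
    by (simp add: norm_sum)
  also have "\<dots> \<le> (\<Sum>j\<in>UNIV. \<bar>h2norm (f j)\<bar> * \<bar>sqrt (kquad T (c j))\<bar>)"
    by (intro sum_mono) (use cmod_ev_le[OF f T] h2norm_nonneg[OF f] kquad_nonneg[OF T] in auto)
  also have "\<dots> \<le> sqrt (\<Sum>j\<in>UNIV. (h2norm (f j))\<^sup>2) * sqrt (\<Sum>j\<in>UNIV. (sqrt (kquad T (c j)))\<^sup>2)"
    using L2_set_mult_ineq[of "\<lambda>j. h2norm (f j)" "\<lambda>j. sqrt (kquad T (c j))" UNIV] by (simp add: L2_set_def)
  also have "(\<Sum>j\<in>UNIV. (sqrt (kquad T (c j)))\<^sup>2) = (\<Sum>j\<in>UNIV. kquad T (c j))"
    using kquad_nonneg[OF T] by simp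
  also have "(\<Sum>j\<in>UNIV. kquad T (c j)) = kquad T b - (cmod (\<Sum>z\<in>T. cnj (b z) * 1))\<^sup>2"
  proof -
    have "(\<Sum>j\<in>UNIV. form DAkernel T (c j) (c j)) = (\<Sum>z\<in>T. \<Sum>w\<in>T. \<Sum>j\<in>UNIV. cnj (c j z) * c j w * DAkernel z w)"
      unfolding form_def by (subst sum.swap, intro sum.cong refl, rule sum.swap)
    also have "\<dots> = (\<Sum>z\<in>T. \<Sum>w\<in>T. cnj (b z) * b w * (cinner z w * DAkernel z w))"
      by (intro sum.cong refl) (simp add: c_def cinner_def sum_distrib_left sum_distrib_right mult_ac)
    also have "\<dots> = (\<Sum>z\<in>T. \<Sum>w\<in>T. cnj (b z) * b w * (DAkernel z w - 1))"
      by (intro sum.cong refl) (use T DAkernel_eq in auto)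
    also have "\<dots> = form DAkernel T b b - form (\<lambda>z w. 1 * cnj 1) T b b"
      by (simp add: form_def algebra_simps sum_subtractf)
    finally show ?thesis unfolding form_rank_one by (simp flip: Re_sum of_real_power)
  qed
  finally show "cmod (ev (\<lambda>z. \<Sum>j\<in>UNIV. coord j z * f j z) T b) \<le> sqrt (\<Sum>j\<in>UNIV. (h2norm (f j))\<^sup>2) * sqrt (kquad T b)"
    by (elim order_trans) (intro mult_left_mono real_sqrt_le_mono, auto intro: sum_nonneg)
qed

lemma row_H2:
  assumes "\<And>j. f j \<in> H2"
  shows "(\<lambda>z. \<Sum>j\<in>UNIV. coord j z * f j z) \<in> H2"
  by (rule H2I[OF _ row_contraction_bound[OF assms]]) (simp add: coord_def)

lemma coord_mult_bound:
  assumes "f \<in> H2"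
  shows "h2_bound (fmult (coord j) f) (h2norm f)"
proof -
  define g where "g i = (if i = j then f else (\<lambda>z. 0))" for i
  have g: "g i \<in> H2" for i using assms by (simp add: g_def)
  have "(\<lambda>z. \<Sum>i\<in>UNIV. coord i z * g i z) = fmult (coord j) f"
  proof
    fix z
    have "(\<Sum>i\<in>UNIV. coord i z * g i z) = (\<Sum>i\<in>UNIV. if i = j then coord i z * f z else 0)"
      by (rule sum.cong) (auto simp: g_def)
    then show "(\<Sum>i\<in>UNIV. coord i z * g i z) = fmult (coord j) f z" by (simp add: fmult_def)
  qed
  moreover have "(\<Sum>i\<in>UNIV. (h2norm (g i))\<^sup>2) = (\<Sum>i\<in>UNIV. if i = j then (h2norm f)\<^sup>2 else 0)"
    by (rule sum.cong) (auto simp: g_def)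
  ultimately show ?thesis
    using row_contraction_bound[of g, OF g] h2norm_nonneg[OF assms] by simp
qed

lemma coord_mult_H2: "f \<in> H2 \<Longrightarrow> fmult (coord j) f \<in> H2"
  by (rule H2I[OF _ coord_mult_bound]) (auto simp: fmult_def coord_def)

lemma h2norm_coord_mult_le: "f \<in> H2 \<Longrightarrow> h2norm (fmult (coord j) f) \<le> h2norm f"
  by (rule h2norm_le[OF coord_mult_bound])

section \<open>Zero-based subspaces, their kernels and the factorization\<close>

definition zero_space :: "(complex^'d) set \<Rightarrow> (complex^'d \<Rightarrow> complex) set" where
  "zero_space S = {f \<in> H2. \<forall>z\<in>S. f z = 0}"

lemma closed_subspace_zero_space: "closed_subspace (zero_space S)"
  unfolding closed_subspace_def
proof (intro conjI allI ballI impI)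
  fix fs f assume c: "h2conv fs f" and s: "\<forall>n. fs n \<in> zero_space S"
  have "f z = 0" if "z \<in> S" for z
    using h2conv_point[OF c, of z] s that by (simp add: zero_space_def LIMSEQ_const_iff)
  then show "f \<in> zero_space S" using h2conv_H2[OF c] by (simp add: zero_space_def)
qed (auto simp: zero_space_def intro: H2_add H2_scale)

lemma h2norm_diff_sq_kfun:
  assumes "z \<in> Ball_d" "w \<in> Ball_d"
  shows "(h2norm (\<lambda>x. kfun w x - kfun z x))\<^sup>2 = Re (DAkernel w w) - 2 * Re (DAkernel z w) + Re (DAkernel z z)"
  using h2norm_sq_diff_scale[OF kfun_H2[OF assms(2)] kfun_H2[OF assms(1)], of 1] assms
  by (simp add: h2inner_kfun kfun_H2 h2norm_kfun_sq) (simp add: kfun_def)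

lemma tendsto_DAkernel:
  assumes "(\<lambda>n. u n) \<longlonglongrightarrow> z" "(\<lambda>n. v n) \<longlonglongrightarrow> w" "z \<in> Ball_d" "w \<in> Ball_d"
  shows "(\<lambda>n. DAkernel (u n) (v n)) \<longlonglongrightarrow> DAkernel z w"
  unfolding DAkernel_def cinner_def
  by (intro tendsto_intros tendsto_vec_nth assms)
    (use one_minus_cinner_nonzero[OF assms(3,4)] in \<open>simp add: cinner_def\<close>)

lemma h2conv_kfun:
  assumes x: "x \<longlonglongrightarrow> z" "\<And>n. x n \<in> Ball_d" "z \<in> Ball_d"
  shows "h2conv (\<lambda>n. kfun (x n)) (kfun z)"
proof -
  have "(\<lambda>n. (h2norm (\<lambda>y. kfun (x n) y - kfun z y))\<^sup>2) \<longlonglongrightarrow> Re (DAkernel z z) - 2 * Re (DAkernel z z) + Re (DAkernel z z)"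
    unfolding h2norm_diff_sq_kfun[OF x(3,2)]
    by (intro tendsto_intros tendsto_DAkernel x)
  then have "(\<lambda>n. sqrt ((h2norm (\<lambda>y. kfun (x n) y - kfun z y))\<^sup>2)) \<longlonglongrightarrow> sqrt 0"
    by (intro tendsto_real_sqrt) simp
  moreover have "0 \<le> h2norm (\<lambda>y. kfun (x n) y - kfun z y)" for n
    by (intro h2norm_nonneg H2_diff kfun_H2 x)
  ultimately show ?thesis using x by (simp add: h2conv_def kfun_H2)
qed

text \<open>The function at \<open>w\<close> is the orthogonal projection of \<open>kfun w\<close>;
  the remainder is orthogonal to the subspace, so pairing with the projection still evaluates at
  \<open>w\<close>.\<close>

lemma zero_space_kernel_exists:
  fixes S :: "(complex^'d) set"
  obtains kN where "\<And>w. w \<in> Ball_d \<Longrightarrow> kN w \<in> zero_space S"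
    "\<And>w h. w \<in> Ball_d \<Longrightarrow> h \<in> zero_space S \<Longrightarrow> h2inner h (kN w) = h w"
proof -
  have "\<exists>g. w \<in> Ball_d \<longrightarrow> g \<in> zero_space S \<and> (\<forall>h\<in>zero_space S. h2inner h g = h w)" for w
  proof (cases "w \<in> Ball_d")
    case True
    obtain g where g: "g \<in> zero_space S" "\<And>h. h \<in> zero_space S \<Longrightarrow> h2inner (\<lambda>z. kfun w z - g z) h = 0"
      by (rule projection_exists[OF closed_subspace_zero_space[of S] kfun_H2[OF True]]) blast
    have "h2inner h g = h w" if h: "h \<in> zero_space S" for h
    proof -
      have H: "h \<in> H2" "g \<in> H2" using g h by (auto simp: zero_space_def)
      have "h2inner h (\<lambda>z. kfun w z - g z) = 0"
        using g(2)[OF h] h2inner_commute[OF H2_diff[OF kfun_H2[OF True] H(2)] H(1)] by simp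
      then show ?thesis
        using h2inner_diff_right[OF H(1) kfun_H2[OF True] H(2)] h2inner_kfun[OF H(1) True] by simp
    qed
    then show ?thesis using g by blast
  qed simp
  then show ?thesis using that by metis
qed

text \<open>Mind the argument order: \<open>kN w\<close> is the kernel function at \<open>w\<close>,
  so the kernel value usually written K(z,w) is \<open>kN w z\<close>.\<close>

locale zero_kernel =
  fixes S :: "(complex^'d) set" and kN :: "complex^'d \<Rightarrow> complex^'d \<Rightarrow> complex"
  assumes kN: "\<And>w. w \<in> Ball_d \<Longrightarrow> kN w \<in> zero_space S"
    and repro: "\<And>w h. w \<in> Ball_d \<Longrightarrow> h \<in> zero_space S \<Longrightarrow> h2inner h (kN w) = h w"
begin

lemma kN_H2: "w \<in> Ball_d \<Longrightarrow> kN w \<in> H2"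
  using kN by (simp add: zero_space_def)

lemma zs_H2: "f \<in> zero_space S \<Longrightarrow> f \<in> H2"
  by (simp add: zero_space_def)

definition ncomb :: "(complex^'d) set \<Rightarrow> (complex^'d \<Rightarrow> complex) \<Rightarrow> complex^'d \<Rightarrow> complex" where
  "ncomb T b = (\<lambda>x. \<Sum>w\<in>T. b w * kN w x)"

lemma ncomb_zero_space:
  assumes "finite T" "T \<subseteq> Ball_d" shows "ncomb T b \<in> zero_space S"
proof -
  have "ncomb T b \<in> H2" unfolding ncomb_def
    using assms by (intro H2_sum H2_scale kN_H2) auto
  moreover have "ncomb T b z = 0" if "z \<in> S" for z
    unfolding ncomb_def using assms kN that by (intro sum.neutral) (auto simp: zero_space_def)
  ultimately show ?thesis by (simp add: zero_space_def)
qed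

lemma h2inner_ncomb:
  assumes "finite T" "T \<subseteq> Ball_d" "f \<in> zero_space S"
  shows "h2inner f (ncomb T b) = ev f T b"
proof -
  have "h2inner f (ncomb T b) = (\<Sum>w\<in>T. h2inner f (\<lambda>z. b w * kN w z))"
    unfolding ncomb_def using assms by (intro h2inner_sum_right H2_scale kN_H2 zs_H2) auto
  also have "\<dots> = (\<Sum>w\<in>T. cnj (b w) * f w)"
    by (intro sum.cong refl) (use assms in \<open>auto simp: h2inner_scale_right zs_H2 kN_H2 repro\<close>)
  finally show ?thesis by (simp add: ev_def)
qed

lemma ev_ncomb: "ev (ncomb T c) T b = form (\<lambda>z w. kN w z) T b c"
  by (simp add: ev_def ncomb_def form_def sum_distrib_left mult.assoc)

lemma h2norm_ncomb_sq:
  assumes "finite T" "T \<subseteq> Ball_d"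
  shows "form (\<lambda>z w. kN w z) T b b = of_real ((h2norm (ncomb T b))\<^sup>2)"
  using h2inner_ncomb[OF assms ncomb_zero_space[OF assms]] h2inner_self[OF zs_H2[OF ncomb_zero_space[OF assms]]]
  by (simp add: ev_ncomb)

lemma h2norm_ncomb_le:
  assumes T: "finite T" "T \<subseteq> Ball_d"
  shows "h2norm (ncomb T b) \<le> sqrt (kquad T b)"
proof -
  note n = zs_H2[OF ncomb_zero_space[OF T]]
  have "(h2norm (ncomb T b))\<^sup>2 = cmod (ev (ncomb T b) T b)"
    unfolding ev_ncomb h2norm_ncomb_sq[OF T] by (simp add: norm_power)
  also have "\<dots> \<le> h2norm (ncomb T b) * sqrt (kquad T b)" by (rule cmod_ev_le[OF n T])
  finally show ?thesis using h2norm_nonneg[OF n, of b] kquad_nonneg[OF T, of b]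
    by (cases "h2norm (ncomb T b) = 0") (auto simp: power2_eq_square)
qed

lemma kN_commute:
  assumes "z \<in> Ball_d" "w \<in> Ball_d" shows "kN z w = cnj (kN w z)"
proof -
  have "kN z w = h2inner (kN z) (kN w)" using assms repro kN by simp
  also have "\<dots> = cnj (h2inner (kN w) (kN z))" using assms by (intro h2inner_commute kN_H2)
  finally show ?thesis using assms repro kN by simp
qed

text \<open>The subspace is invariant under the coordinates, so the row of coordinate multipliers
  stays a contraction on it, and so does its adjoint. Concretely, let \<open>h\<close> combine the
  kernel functions with coefficients \<open>b\<close>, and let \<open>g j\<close> do so with the
  coordinate absorbed. The form is \<open>(h2norm h)^2 - s\<close>, where \<open>s\<close> sums the
  squared norms of the \<open>g j\<close>. The row applied to \<open>g\<close> gives a function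
  \<open>q\<close> in the subspace whose pairing with \<open>h\<close> is \<open>s\<close>, and
  contractivity yields \<open>s \<le> sqrt s * h2norm h\<close>.\<close>

lemma psd_quotient: "psd Ball_d (\<lambda>z w. (1 - cinner z w) * kN w z)"
proof (rule psdI)
  show "(1 - cinner w z) * kN z w = cnj ((1 - cinner z w) * kN w z)" if "z \<in> Ball_d" "w \<in> Ball_d" for z w
    unfolding kN_commute[OF that] cinner_commute[of w z] by simp
  fix T :: "(complex^'d) set" and b :: "complex^'d \<Rightarrow> complex" assume T: "finite T" "T \<subseteq> Ball_d"
  define c where "c j = (\<lambda>z. b z * cnj (z $ j))" for j
  define h where "h = ncomb T b"
  define g where "g j = ncomb T (c j)" for j
  have h: "h \<in> zero_space S" unfolding h_def by (rule ncomb_zero_space[OF T])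
  have g: "g j \<in> zero_space S" for j unfolding g_def by (rule ncomb_zero_space[OF T])
  define s where "s = (\<Sum>j\<in>UNIV. (h2norm (g j))\<^sup>2)"
  have s0: "0 \<le> s" by (simp add: s_def sum_nonneg)
  have form_g: "(\<Sum>j\<in>UNIV. form (\<lambda>z w. kN w z) T (c j) (c j)) = of_real s"
    unfolding s_def g_def h2norm_ncomb_sq[OF T] by simp
  have "(\<Sum>j\<in>UNIV. form (\<lambda>z w. kN w z) T (c j) (c j)) = (\<Sum>z\<in>T. \<Sum>w\<in>T. \<Sum>j\<in>UNIV. cnj (c j z) * c j w * kN w z)"
    unfolding form_def by (subst sum.swap, intro sum.cong refl, rule sum.swap)
  also have "\<dots> = (\<Sum>z\<in>T. \<Sum>w\<in>T. cnj (b z) * b w * (cinner z w * kN w z))"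
    by (intro sum.cong refl) (simp add: c_def cinner_def sum_distrib_left sum_distrib_right mult_ac)
  finally have "form (\<lambda>z w. (1 - cinner z w) * kN w z) T b b = form (\<lambda>z w. kN w z) T b b - of_real s"
    unfolding form_g[symmetric] by (simp add: form_def algebra_simps sum_subtractf)
  then have eq: "Re (form (\<lambda>z w. (1 - cinner z w) * kN w z) T b b) = (h2norm h)\<^sup>2 - s"
    unfolding h2norm_ncomb_sq[OF T] by (simp add: h_def flip: of_real_power)
  define q where "q = (\<lambda>z. \<Sum>j\<in>UNIV. coord j z * g j z)"
  have qH: "q \<in> H2" unfolding q_def by (rule row_H2[OF zs_H2[OF g]])
  have q: "q \<in> zero_space S" using qH g by (auto simp: zero_space_def q_def intro!: sum.neutral)
  have "h2inner q h = ev q T b" unfolding h_def by (rule h2inner_ncomb[OF T q])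
  also have "\<dots> = (\<Sum>z\<in>T. \<Sum>j\<in>UNIV. cnj (c j z) * g j z)"
    unfolding ev_def q_def sum_distrib_left
    by (intro sum.cong refl) (use T in \<open>auto simp: coord_def c_def\<close>)
  also have "\<dots> = (\<Sum>j\<in>UNIV. ev (g j) T (c j))" unfolding ev_def by (rule sum.swap)
  also have "\<dots> = of_real s" unfolding form_g[symmetric] g_def ev_ncomb ..
  finally have "s = cmod (h2inner q h)" using s0 by simp
  also have "\<dots> \<le> h2norm q * h2norm h" by (rule h2inner_cauchy_schwarz[OF qH zs_H2[OF h]])
  also have "\<dots> \<le> sqrt s * h2norm h"
    unfolding q_def s_def by (intro mult_right_mono h2norm_le row_contraction_bound zs_H2[OF g] h2norm_nonneg[OF zs_H2[OF h]])
  finally have "sqrt s * sqrt s \<le> sqrt s * h2norm h" using s0 by simp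
  then have "sqrt s \<le> h2norm h" if "s \<noteq> 0"
    by (rule mult_left_le_imp_le) (use that s0 in simp)
  then have "sqrt s \<le> h2norm h" using h2norm_nonneg[OF zs_H2[OF h]] by (cases "s = 0") auto
  then have "s \<le> (h2norm h)\<^sup>2" by (rule sqrt_le_D)
  then show "0 \<le> Re (form (\<lambda>z w. (1 - cinner z w) * kN w z) T b b)" unfolding eq by simp
qed

text \<open>Projection does not increase distances: the difference of two projected kernel functions
  has the same pairing with itself as with the difference of the original ones. This continuity
  supplies the density needed for the pivots.\<close>

lemma h2conv_kN:
  assumes x: "x \<longlonglongrightarrow> z" "\<And>n. x n \<in> Ball_d" "z \<in> Ball_d"
  shows "h2conv (\<lambda>n. kN (x n)) (kN z)"
proof -
  have le: "h2norm (\<lambda>y. kN (x n) y - kN z y) \<le> h2norm (\<lambda>y. kfun (x n) y - kfun z y)" for n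
  proof -
    define h where "h = (\<lambda>y. kN (x n) y - kN z y)"
    have h: "h \<in> zero_space S" unfolding h_def
      using kN[OF x(2)[of n]] kN[OF x(3)] by (simp add: zero_space_def H2_diff)
    note hH = zs_H2[OF h]
    have d: "(\<lambda>y. kfun (x n) y - kfun z y) \<in> H2" by (intro H2_diff kfun_H2 x)
    have "h2inner h h = h2inner h (kN (x n)) - h2inner h (kN z)"
      using h2inner_diff_right[OF hH kN_H2[OF x(2)[of n]] kN_H2[OF x(3)]] by (simp add: h_def)
    also have "\<dots> = h2inner h (\<lambda>y. kfun (x n) y - kfun z y)"
      by (simp add: repro h x h2inner_diff_right[OF hH kfun_H2 kfun_H2] h2inner_kfun hH)
    finally have "cmod (h2inner h h) \<le> h2norm h * h2norm (\<lambda>y. kfun (x n) y - kfun z y)"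
      using h2inner_cauchy_schwarz[OF hH d] by simp
    then have "(h2norm h)\<^sup>2 \<le> h2norm h * h2norm (\<lambda>y. kfun (x n) y - kfun z y)"
      by (simp add: h2inner_self[OF hH] norm_power)
    then have "h2norm h \<le> h2norm (\<lambda>y. kfun (x n) y - kfun z y)"
      using h2norm_nonneg[OF hH] h2norm_nonneg[OF d] by (cases "h2norm h = 0") (auto simp: power2_eq_square)
    then show ?thesis by (simp add: h_def)
  qed
  have "(\<lambda>n. h2norm (\<lambda>y. kfun (x n) y - kfun z y)) \<longlonglongrightarrow> 0"
    using h2conv_kfun[OF x] by (simp add: h2conv_def)
  then show ?thesis by (rule h2convI[OF kN_H2[OF x(2)] kN_H2[OF x(3)] le])
qed

text \<open>The pivots enumerate a countable dense subset of the ball, so \<Omega> is indexed by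
  \<open>nat\<close>. Along a sequence of pivots tending to \<open>z\<close> every kernel entry in
  the seminorm distance converges to the entry at \<open>(z, z)\<close>, so the distance tends to
  0.\<close>

lemma factor_exists:
  obtains \<Omega> :: "complex^'d \<Rightarrow> nat \<Rightarrow> complex"
  where "\<And>z w. z \<in> Ball_d \<Longrightarrow> w \<in> Ball_d \<Longrightarrow> (\<lambda>n. \<Omega> z n * cnj (\<Omega> w n)) sums ((1 - cinner z w) * kN w z)"
    and "\<And>z. z \<in> Ball_d \<Longrightarrow> summable (\<lambda>n. (cmod (\<Omega> z n))\<^sup>2)"
    and "\<And>z. z \<notin> Ball_d \<Longrightarrow> \<Omega> z = (\<lambda>n. 0)"
proof -
  obtain D where D: "countable D" "D \<subseteq> (Ball_d :: (complex^'d) set)" "Ball_d \<subseteq> closure D"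
    using separable by metis
  have "0 \<in> (Ball_d :: (complex^'d) set)" by (simp add: Ball_d_def)
  then have "D \<noteq> {}" using D(3) by auto
  then have range: "range (from_nat_into D) = D" using D(1) by (rule range_from_nat_into)
  define G where "G = (\<lambda>z w. (1 - cinner z w) * kN w z)"
  have psdG: "psd Ball_d G" unfolding G_def by (rule psd_quotient)
  have pB: "from_nat_into D n \<in> Ball_d" for n using range D(2) by blast
  have dense: "\<exists>n. Re (G z z) - 2 * Re (G z (from_nat_into D n)) + Re (G (from_nat_into D n) (from_nat_into D n)) < \<epsilon>"
    if z: "z \<in> Ball_d" and e: "\<epsilon> > 0" for z \<epsilon>
  proof -
    obtain x where x: "\<And>n. x n \<in> D" "x \<longlonglongrightarrow> z"
      using z D(3) closure_sequential by (metis subsetD)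
    have xB: "x n \<in> Ball_d" for n using x D(2) by blast
    note c = h2conv_kN[OF x(2) xB z]
    have cin: "(\<lambda>n. cinner (u n) (v n)) \<longlonglongrightarrow> cinner p q" if "u \<longlonglongrightarrow> p" "v \<longlonglongrightarrow> q" for u v p q
      unfolding cinner_def by (intro tendsto_intros tendsto_vec_nth that)
    have k1: "(\<lambda>n. kN (x n) z) \<longlonglongrightarrow> kN z z" by (rule h2conv_point[OF c])
    have "(\<lambda>n. h2inner (kN (x n)) (kN (x n))) \<longlonglongrightarrow> h2inner (kN z) (kN z)" by (rule h2conv_inner[OF c c])
    then have k2: "(\<lambda>n. kN (x n) (x n)) \<longlonglongrightarrow> kN z z" by (simp add: repro kN xB z)
    have "(\<lambda>n. Re (G z z) - 2 * Re (G z (x n)) + Re (G (x n) (x n))) \<longlonglongrightarrow> Re (G z z) - 2 * Re (G z z) + Re (G z z)"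
      unfolding G_def by (intro tendsto_intros cin k1 k2 x)
    then have "eventually (\<lambda>n. Re (G z z) - 2 * Re (G z (x n)) + Re (G (x n) (x n)) < \<epsilon>) sequentially"
      using e by (intro order_tendstoD) auto
    then obtain n where "Re (G z z) - 2 * Re (G z (x n)) + Re (G (x n) (x n)) < \<epsilon>"
      unfolding eventually_sequentially by blast
    moreover obtain m where "x n = from_nat_into D m" using x(1)[of n] range by (metis imageE)
    ultimately show ?thesis by auto
  qed
  show ?thesis
  proof (rule psd_cholesky[OF psdG pB dense])
    fix \<Omega> :: "complex^'d \<Rightarrow> nat \<Rightarrow> complex"
    assume \<Omega>: "\<And>z w. z \<in> Ball_d \<Longrightarrow> w \<in> Ball_d \<Longrightarrow> (\<lambda>n. \<Omega> z n * cnj (\<Omega> w n)) sums G z w"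
      "\<And>z. z \<in> Ball_d \<Longrightarrow> summable (\<lambda>n. (cmod (\<Omega> z n))\<^sup>2)"
    show ?thesis
      by (rule that[of "\<lambda>z. if z \<in> Ball_d then \<Omega> z else (\<lambda>n. 0)"]) (use \<Omega> in \<open>auto simp: G_def\<close>)
  qed assumption+
qed

end

section \<open>Inner multipliers\<close>

lemma suminf_cauchy_schwarz:
  fixes a c :: "nat \<Rightarrow> real"
  assumes a: "summable (\<lambda>n. (a n)\<^sup>2)" and c: "summable (\<lambda>n. (c n)\<^sup>2)"
    and nn: "\<And>n. 0 \<le> a n" "\<And>n. 0 \<le> c n"
  shows "summable (\<lambda>n. a n * c n)" "(\<Sum>n. a n * c n) \<le> sqrt (\<Sum>n. (a n)\<^sup>2) * sqrt (\<Sum>n. (c n)\<^sup>2)"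
proof -
  have fin: "(\<Sum>k<n. a k * c k) \<le> sqrt (\<Sum>n. (a n)\<^sup>2) * sqrt (\<Sum>n. (c n)\<^sup>2)" for n
  proof -
    have "(\<Sum>k<n. a k * c k) \<le> sqrt (\<Sum>k<n. (a k)\<^sup>2) * sqrt (\<Sum>k<n. (c k)\<^sup>2)"
      using L2_set_mult_ineq[of a c "{..<n}"] nn by (simp add: L2_set_def)
    also have "\<dots> \<le> sqrt (\<Sum>n. (a n)\<^sup>2) * sqrt (\<Sum>n. (c n)\<^sup>2)"
      by (intro mult_mono real_sqrt_le_mono sum_le_suminf a c) (auto intro: sum_nonneg suminf_nonneg a)
    finally show ?thesis .
  qed
  show s: "summable (\<lambda>n. a n * c n)"
    by (rule summableI_nonneg_bounded[OF _ fin]) (simp add: nn)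
  show "(\<Sum>n. a n * c n) \<le> sqrt (\<Sum>n. (a n)\<^sup>2) * sqrt (\<Sum>n. (c n)\<^sup>2)"
    by (rule suminf_le_const[OF s fin])
qed

section \<open>Square-summable sequences in \<open>H2\<close>\<close>

lemma VH2D: "F \<in> VH2 \<Longrightarrow> F n \<in> H2" "F \<in> VH2 \<Longrightarrow> summable (\<lambda>n. (h2norm (F n))\<^sup>2)"
  by (simp_all add: VH2_def sq_summable_h2_def)

lemma VH2I: "(\<And>n. F n \<in> H2) \<Longrightarrow> summable (\<lambda>n. (h2norm (F n))\<^sup>2) \<Longrightarrow> F \<in> VH2"
  by (simp add: VH2_def sq_summable_h2_def)

lemma vnorm_nonneg: "F \<in> VH2 \<Longrightarrow> 0 \<le> vnorm F"
  unfolding vnorm_def by (intro real_sqrt_ge_zero suminf_nonneg VH2D(2)) auto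

lemma vnorm_sq: "F \<in> VH2 \<Longrightarrow> (vnorm F)\<^sup>2 = (\<Sum>n. (h2norm (F n))\<^sup>2)"
  unfolding vnorm_def by (intro real_sqrt_pow2 suminf_nonneg VH2D(2)) auto

lemma VH2_diff:
  assumes "F \<in> VH2" "G \<in> VH2" shows "(\<lambda>n z. F n z - G n z) \<in> VH2"
proof (rule VH2I)
  note FG = VH2D(1)[OF assms(1)] VH2D(1)[OF assms(2)]
  show H: "(\<lambda>z. F n z - G n z) \<in> H2" for n by (rule H2_diff[OF FG])
  show "summable (\<lambda>n. (h2norm (\<lambda>z. F n z - G n z))\<^sup>2)"
  proof (rule summable_comparison_test')
    show "summable (\<lambda>n. 2 * (h2norm (F n))\<^sup>2 + 2 * (h2norm (G n))\<^sup>2)"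
      by (intro summable_add summable_mult VH2D assms)
    fix n :: nat
    have "h2norm (\<lambda>z. F n z - G n z) \<le> h2norm (F n) + h2norm (G n)"
      using h2norm_triangle[OF FG(1) H2_scale[OF FG(2), of "- 1"], of n n] h2norm_scale[OF FG(2), of "- 1" n] by simp
    then have "(h2norm (\<lambda>z. F n z - G n z))\<^sup>2 \<le> (h2norm (F n) + h2norm (G n))\<^sup>2"
      using h2norm_nonneg[OF H] by (rule power_mono)
    also have "\<dots> \<le> 2 * (h2norm (F n))\<^sup>2 + 2 * (h2norm (G n))\<^sup>2"
      using sum_squares_bound[of "h2norm (F n)" "h2norm (G n)"] by (simp add: power2_sum)
    finally show "norm ((h2norm (\<lambda>z. F n z - G n z))\<^sup>2) \<le> 2 * (h2norm (F n))\<^sup>2 + 2 * (h2norm (G n))\<^sup>2" by simp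
  qed
qed

lemma vinner_cauchy_schwarz:
  assumes "F \<in> VH2" "G \<in> VH2"
  shows "summable (\<lambda>n. h2inner (F n) (G n))" "cmod (vinner F G) \<le> vnorm F * vnorm G"
proof -
  note F = VH2D[OF assms(1)] and G = VH2D[OF assms(2)]
  note cs = suminf_cauchy_schwarz[OF F(2) G(2) h2norm_nonneg[OF F(1)] h2norm_nonneg[OF G(1)]]
  have le: "cmod (h2inner (F n) (G n)) \<le> h2norm (F n) * h2norm (G n)" for n
    by (rule h2inner_cauchy_schwarz[OF F(1) G(1)])
  have sn: "summable (\<lambda>n. cmod (h2inner (F n) (G n)))"
    by (rule summable_comparison_test'[OF cs(1)]) (use le in simp)
  then show "summable (\<lambda>n. h2inner (F n) (G n))" by (rule summable_norm_cancel)
  have "cmod (vinner F G) \<le> (\<Sum>n. cmod (h2inner (F n) (G n)))"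
    unfolding vinner_def by (rule summable_norm[OF sn])
  also have "\<dots> \<le> (\<Sum>n. h2norm (F n) * h2norm (G n))" by (rule suminf_le[OF le sn cs(1)])
  also have "\<dots> \<le> vnorm F * vnorm G" unfolding vnorm_def by (rule cs(2))
  finally show "cmod (vinner F G) \<le> vnorm F * vnorm G" .
qed

lemma vinner_self:
  assumes "F \<in> VH2" shows "vinner F F = of_real ((vnorm F)\<^sup>2)"
proof -
  have "h2inner (F n) (F n) = complex_of_real ((h2norm (F n))\<^sup>2)" for n
    by (rule h2inner_self[OF VH2D(1)[OF assms]])
  then show ?thesis
    unfolding vinner_def vnorm_sq[OF assms] by (simp only: suminf_of_real[OF VH2D(2)[OF assms]])
qed

lemma vinner_diff_right:
  assumes "F \<in> VH2" "G \<in> VH2" "G' \<in> VH2"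
  shows "vinner F (\<lambda>n z. G n z - G' n z) = vinner F G - vinner F G'"
  unfolding vinner_def
  by (simp add: h2inner_diff_right VH2D assms suminf_diff vinner_cauchy_schwarz(1)[OF assms(1,2)]
      vinner_cauchy_schwarz(1)[OF assms(1,3)])

text \<open>On truncations \<open>vapply\<close> is a finite sum, where finite additivity of
  \<open>h2inner\<close> is enough; \<open>vnorm_tail_tendsto\<close> controls the error.\<close>

definition vtrunc :: "nat \<Rightarrow> (nat \<Rightarrow> complex^'d \<Rightarrow> complex) \<Rightarrow> nat \<Rightarrow> complex^'d \<Rightarrow> complex" where
  "vtrunc m F = (\<lambda>n. if n < m then F n else (\<lambda>z. 0))"

lemma vtrunc_sums: "(\<lambda>n. (h2norm (vtrunc m F n))\<^sup>2) sums (\<Sum>n<m. (h2norm (F n))\<^sup>2)"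
proof -
  have "(\<lambda>n. if n \<in> {..<m} then (h2norm (F n))\<^sup>2 else 0) sums (\<Sum>n<m. (h2norm (F n))\<^sup>2)"
    by (rule sums_If_finite_set) simp
  moreover have "(\<lambda>n. if n \<in> {..<m} then (h2norm (F n))\<^sup>2 else 0) = (\<lambda>n. (h2norm (vtrunc m F n))\<^sup>2)"
    by (auto simp: vtrunc_def)
  ultimately show ?thesis by simp
qed

lemma vtrunc_VH2: "(\<And>n. F n \<in> H2) \<Longrightarrow> vtrunc m F \<in> VH2"
  by (rule VH2I) (simp_all add: vtrunc_def[abs_def] sums_summable[OF vtrunc_sums, unfolded vtrunc_def])

lemma vnorm_vtrunc: "vnorm (vtrunc m F) = sqrt (\<Sum>n<m. (h2norm (F n))\<^sup>2)"
  unfolding vnorm_def sums_unique[OF vtrunc_sums, symmetric] ..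

lemma vapply_vtrunc: "vapply \<Omega> (vtrunc m F) = (\<lambda>z. \<Sum>n<m. \<Omega> z n * F n z)"
proof
  fix z
  have "(\<Sum>n. \<Omega> z n * vtrunc m F n z) = (\<Sum>n<m. \<Omega> z n * vtrunc m F n z)"
    by (rule suminf_finite) (auto simp: vtrunc_def)
  then show "vapply \<Omega> (vtrunc m F) z = (\<Sum>n<m. \<Omega> z n * F n z)" by (simp add: vapply_def vtrunc_def)
qed

lemma vnorm_tail_tendsto:
  assumes "F \<in> VH2"
  shows "(\<lambda>m. vnorm (\<lambda>n z. F n z - vtrunc m F n z)) \<longlonglongrightarrow> 0"
proof -
  note s = VH2D(2)[OF assms]
  have "vnorm (\<lambda>n z. F n z - vtrunc m F n z) = sqrt ((\<Sum>n. (h2norm (F n))\<^sup>2) - (\<Sum>n<m. (h2norm (F n))\<^sup>2))" for m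
  proof -
    have "(\<lambda>n. (h2norm (F n))\<^sup>2 - (h2norm (vtrunc m F n))\<^sup>2) sums ((\<Sum>n. (h2norm (F n))\<^sup>2) - (\<Sum>n<m. (h2norm (F n))\<^sup>2))"
      by (intro sums_diff summable_sums s vtrunc_sums)
    moreover have "(\<lambda>n. (h2norm (F n))\<^sup>2 - (h2norm (vtrunc m F n))\<^sup>2) = (\<lambda>n. (h2norm (\<lambda>z. F n z - vtrunc m F n z))\<^sup>2)"
      by (auto simp: vtrunc_def)
    ultimately show ?thesis unfolding vnorm_def by (simp add: sums_iff)
  qed
  moreover have "(\<lambda>m. sqrt ((\<Sum>n. (h2norm (F n))\<^sup>2) - (\<Sum>n<m. (h2norm (F n))\<^sup>2))) \<longlonglongrightarrow> sqrt ((\<Sum>n. (h2norm (F n))\<^sup>2) - (\<Sum>n. (h2norm (F n))\<^sup>2))"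
    by (intro tendsto_intros summable_LIMSEQ s)
  ultimately show ?thesis by simp
qed

section \<open>The multiplication operator of the factor and its adjoint\<close>

locale zero_factor = zero_kernel S kN
  for S :: "(complex^'d) set" and kN :: "complex^'d \<Rightarrow> complex^'d \<Rightarrow> complex" +
  fixes \<Omega> :: "complex^'d \<Rightarrow> nat \<Rightarrow> complex"
  assumes factor: "\<And>z w. z \<in> Ball_d \<Longrightarrow> w \<in> Ball_d \<Longrightarrow> (\<lambda>n. \<Omega> z n * cnj (\<Omega> w n)) sums ((1 - cinner z w) * kN w z)"
    and square_summable: "\<And>z. z \<in> Ball_d \<Longrightarrow> summable (\<lambda>n. (cmod (\<Omega> z n))\<^sup>2)"
    and off_ball: "\<And>z. z \<notin> Ball_d \<Longrightarrow> \<Omega> z = (\<lambda>n. 0)"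
begin

lemma factor_kernel:
  assumes "z \<in> Ball_d" "w \<in> Ball_d"
  shows "(\<lambda>n. \<Omega> z n * cnj (\<Omega> w n) * DAkernel z w) sums kN w z"
  using sums_mult2[OF factor[OF assms], of "DAkernel z w"] one_minus_cinner_nonzero[OF assms]
  by (simp add: DAkernel_def)

lemma vapply_sums:
  assumes F: "F \<in> VH2"
  shows "(\<lambda>n. \<Omega> z n * F n z) sums vapply \<Omega> F z"
proof (cases "z \<in> Ball_d")
  case True
  have nn: "0 \<le> Re (DAkernel z z)" by (rule psd_diag_nonneg[OF psd_DAkernel True])
  have "summable (\<lambda>n. h2norm (F n) * cmod (\<Omega> z n))"
    by (rule suminf_cauchy_schwarz(1)[OF VH2D(2)[OF F] square_summable[OF True] h2norm_nonneg[OF VH2D(1)[OF F]]]) simp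
  then have s: "summable (\<lambda>n. h2norm (F n) * cmod (\<Omega> z n) * sqrt (Re (DAkernel z z)))"
    by (rule summable_mult2)
  have "summable (\<lambda>n. \<Omega> z n * F n z)"
  proof (rule summable_comparison_test'[OF s])
    fix n :: nat
    have "cmod (\<Omega> z n) * cmod (F n z) \<le> cmod (\<Omega> z n) * (h2norm (F n) * sqrt (Re (DAkernel z z)))"
      by (intro mult_left_mono cmod_le_h2norm[OF VH2D(1)[OF F] True]) simp
    then show "norm (\<Omega> z n * F n z) \<le> h2norm (F n) * cmod (\<Omega> z n) * sqrt (Re (DAkernel z z))"
      by (simp add: norm_mult mult_ac)
  qed
  then show ?thesis unfolding vapply_def by (rule summable_sums)
next
  case False
  then show ?thesis by (simp add: vapply_def off_ball)
qed

lemma vapply_off_ball: "z \<notin> Ball_d \<Longrightarrow> vapply \<Omega> F z = 0"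
  by (simp add: vapply_def off_ball)

text \<open>The vector version of the row estimate. Moving \<Omega> into the coefficients gives
  families \<open>c n\<close>, and the factorization sums their values \<open>kquad T (c n)\<close>
  to the squared norm of \<open>ncomb T b\<close>. That norm is at most the norm of the unprojected
  combination.\<close>

lemma vapply_bound:
  assumes F: "F \<in> VH2"
  shows "h2_bound (vapply \<Omega> F) (vnorm F)"
proof (rule h2_boundI)
  show "0 \<le> vnorm F" by (rule vnorm_nonneg[OF F])
  fix T :: "(complex^'d) set" and b :: "complex^'d \<Rightarrow> complex" assume T: "finite T" "T \<subseteq> Ball_d"
  define c where "c n = (\<lambda>z. b z * cnj (\<Omega> z n))" for n
  have "(\<lambda>n. \<Sum>z\<in>T. cnj (b z) * (\<Omega> z n * F n z)) sums (\<Sum>z\<in>T. cnj (b z) * vapply \<Omega> F z)"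
    by (intro sums_sum sums_mult vapply_sums[OF F])
  then have e: "(\<lambda>n. ev (F n) T (c n)) sums ev (vapply \<Omega> F) T b"
    by (simp add: ev_def c_def mult.assoc)
  have "(\<lambda>n. \<Sum>z\<in>T. \<Sum>w\<in>T. cnj (b z) * b w * (\<Omega> z n * cnj (\<Omega> w n) * DAkernel z w))
      sums (\<Sum>z\<in>T. \<Sum>w\<in>T. cnj (b z) * b w * kN w z)"
    by (intro sums_sum sums_mult factor_kernel) (use T in auto)
  then have "(\<lambda>n. form DAkernel T (c n) (c n)) sums form (\<lambda>z w. kN w z) T b b"
    by (simp add: form_def c_def mult_ac)
  then have q: "(\<lambda>n. kquad T (c n)) sums (h2norm (ncomb T b))\<^sup>2"
    using sums_Re unfolding h2norm_ncomb_sq[OF T] by fastforce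
  have q2: "(\<lambda>n. (sqrt (kquad T (c n)))\<^sup>2) = (\<lambda>n. kquad T (c n))" using kquad_nonneg[OF T] by simp
  have sq: "summable (\<lambda>n. (sqrt (kquad T (c n)))\<^sup>2)" unfolding q2 by (rule sums_summable[OF q])
  have le: "cmod (ev (F n) T (c n)) \<le> h2norm (F n) * sqrt (kquad T (c n))" for n
    by (rule cmod_ev_le[OF VH2D(1)[OF F] T])
  note cs = suminf_cauchy_schwarz[OF VH2D(2)[OF F] sq h2norm_nonneg[OF VH2D(1)[OF F]] real_sqrt_ge_zero[OF kquad_nonneg[OF T]]]
  have sn: "summable (\<lambda>n. cmod (ev (F n) T (c n)))"
    by (rule summable_comparison_test'[OF cs(1)]) (use le in simp)
  have "cmod (ev (vapply \<Omega> F) T b) \<le> (\<Sum>n. cmod (ev (F n) T (c n)))"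
    using summable_norm[OF sn] sums_unique[OF e] by simp
  also have "\<dots> \<le> (\<Sum>n. h2norm (F n) * sqrt (kquad T (c n)))" by (rule suminf_le[OF le sn cs(1)])
  also have "\<dots> \<le> vnorm F * sqrt (\<Sum>n. (sqrt (kquad T (c n)))\<^sup>2)" unfolding vnorm_def by (rule cs(2))
  also have "(\<Sum>n. (sqrt (kquad T (c n)))\<^sup>2) = (h2norm (ncomb T b))\<^sup>2" unfolding q2 by (rule sums_unique[OF q, symmetric])
  also have "sqrt ((h2norm (ncomb T b))\<^sup>2) = h2norm (ncomb T b)"
    using h2norm_nonneg[OF zs_H2[OF ncomb_zero_space[OF T]]] by simp
  also have "vnorm F * h2norm (ncomb T b) \<le> vnorm F * sqrt (kquad T b)"
    by (intro mult_left_mono h2norm_ncomb_le[OF T] vnorm_nonneg[OF F])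
  finally show "cmod (ev (vapply \<Omega> F) T b) \<le> vnorm F * sqrt (kquad T b)" .
qed

lemma vapply_H2: "F \<in> VH2 \<Longrightarrow> vapply \<Omega> F \<in> H2"
  by (rule H2I[OF vapply_off_ball vapply_bound])

lemma h2norm_vapply_le: "F \<in> VH2 \<Longrightarrow> h2norm (vapply \<Omega> F) \<le> vnorm F"
  by (rule h2norm_le[OF vapply_bound])

lemma vapply_diff:
  assumes "F \<in> VH2" "G \<in> VH2"
  shows "vapply \<Omega> (\<lambda>n z. F n z - G n z) = (\<lambda>z. vapply \<Omega> F z - vapply \<Omega> G z)"
proof
  fix z
  have "(\<lambda>n. \<Omega> z n * (F n z - G n z)) sums (vapply \<Omega> F z - vapply \<Omega> G z)"
    unfolding right_diff_distrib by (intro sums_diff vapply_sums assms)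
  then show "vapply \<Omega> (\<lambda>n z. F n z - G n z) z = vapply \<Omega> F z - vapply \<Omega> G z"
    unfolding vapply_def by (rule sums_unique[symmetric])
qed

lemma h2conv_partial:
  assumes F: "F \<in> VH2"
  shows "h2conv (\<lambda>m z. \<Sum>n<m. \<Omega> z n * F n z) (vapply \<Omega> F)"
proof -
  have t: "vtrunc m F \<in> VH2" for m by (rule vtrunc_VH2[OF VH2D(1)[OF F]])
  have H: "(\<lambda>z. \<Sum>n<m. \<Omega> z n * F n z) \<in> H2" for m
    using vapply_H2[OF t[of m]] by (simp add: vapply_vtrunc)
  have "h2norm (\<lambda>z. (\<Sum>n<m. \<Omega> z n * F n z) - vapply \<Omega> F z) \<le> vnorm (\<lambda>n z. F n z - vtrunc m F n z)" for m
  proof -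
    have "h2norm (\<lambda>z. (\<Sum>n<m. \<Omega> z n * F n z) - vapply \<Omega> F z) = h2norm (\<lambda>z. vapply \<Omega> F z - vapply \<Omega> (vtrunc m F) z)"
      unfolding vapply_vtrunc by (rule h2norm_minus_commute[OF H vapply_H2[OF F]])
    also have "\<dots> \<le> vnorm (\<lambda>n z. F n z - vtrunc m F n z)"
      unfolding vapply_diff[OF F t, symmetric] by (rule h2norm_vapply_le[OF VH2_diff[OF F t]])
    finally show ?thesis .
  qed
  then show ?thesis by (rule h2convI[OF H vapply_H2[OF F] _ vnorm_tail_tendsto[OF F]])
qed

lemma zero_on_S:
  assumes "z \<in> S" shows "\<Omega> z = (\<lambda>n. 0)"
proof (cases "z \<in> Ball_d")
  case True
  have "kN z z = 0" using kN[OF True] assms by (simp add: zero_space_def)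
  then have "(\<lambda>n. \<Omega> z n * cnj (\<Omega> z n)) sums 0" using factor[OF True True] by simp
  then have "(\<lambda>n. complex_of_real ((cmod (\<Omega> z n))\<^sup>2)) sums of_real 0"
    unfolding complex_norm_square by simp
  then have "(\<lambda>n. (cmod (\<Omega> z n))\<^sup>2) sums 0" by (simp only: sums_of_real_iff)
  then have "(\<Sum>n. (cmod (\<Omega> z n))\<^sup>2) = 0" by (simp add: sums_iff)
  then have "\<forall>n. (cmod (\<Omega> z n))\<^sup>2 = 0" using suminf_eq_zero_iff[OF square_summable[OF True]] by simp
  then show ?thesis by auto
qed (rule off_ball)

lemma vapply_zero_space: "F \<in> VH2 \<Longrightarrow> vapply \<Omega> F \<in> zero_space S"
  using vapply_H2[of F] by (simp add: zero_space_def vapply_def zero_on_S)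

text \<open>The map sending \<open>f\<close> to \<open>v\<close> tensor \<open>f\<close> multiplies
  norms by the norm of \<open>v\<close>. Composing it with \<open>vapply \<Omega>\<close> produces
  the scalar multipliers used below: unit vectors give the components of \<Omega>, a suitable
  \<open>v\<close> gives the extremal multiplier.\<close>

lemma combination_vapply:
  fixes v :: "nat \<Rightarrow> complex"
  assumes v: "summable (\<lambda>n. (cmod (v n))\<^sup>2)" and f: "f \<in> H2"
  defines "F \<equiv> (\<lambda>n z. v n * f z)"
  shows "F \<in> VH2" "vnorm F = sqrt (\<Sum>n. (cmod (v n))\<^sup>2) * h2norm f"
    "fmult (\<lambda>z. \<Sum>n. \<Omega> z n * v n) f = vapply \<Omega> F"
proof -
  have n: "(h2norm (F n))\<^sup>2 = (cmod (v n))\<^sup>2 * (h2norm f)\<^sup>2" for n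
    unfolding F_def h2norm_scale[OF f] by (rule power_mult_distrib)
  show F: "F \<in> VH2"
    by (rule VH2I) (use v f in \<open>simp_all only: n summable_mult2\<close>, simp_all add: F_def H2_scale f)
  show "vnorm F = sqrt (\<Sum>n. (cmod (v n))\<^sup>2) * h2norm f"
    unfolding vnorm_def n suminf_mult2[OF v, symmetric] using h2norm_nonneg[OF f] by (simp add: real_sqrt_mult)
  show "fmult (\<lambda>z. \<Sum>n. \<Omega> z n * v n) f = vapply \<Omega> F"
  proof
    fix z
    have s: "summable (\<lambda>n. \<Omega> z n * v n)"
    proof (cases "z \<in> Ball_d")
      case True
      have "summable (\<lambda>n. cmod (\<Omega> z n) * cmod (v n))"
        by (rule suminf_cauchy_schwarz(1)[OF square_summable[OF True] v]) simp_all
      then show ?thesis by (intro summable_norm_cancel[of "\<lambda>n. \<Omega> z n * v n"]) (simp add: norm_mult)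
    qed (simp add: off_ball)
    show "fmult (\<lambda>z. \<Sum>n. \<Omega> z n * v n) f z = vapply \<Omega> F z"
      unfolding fmult_def vapply_def F_def suminf_mult2[OF s] by (simp add: mult.assoc)
  qed
qed

lemma combination_multiplier:
  fixes v :: "nat \<Rightarrow> complex"
  assumes v: "summable (\<lambda>n. (cmod (v n))\<^sup>2)" and 1: "(\<Sum>n. (cmod (v n))\<^sup>2) \<le> 1"
  defines "\<omega> \<equiv> (\<lambda>z. \<Sum>n. \<Omega> z n * v n)"
  shows "\<omega> \<in> v0 S" "mult_norm \<omega> \<le> 1" "\<And>f. f \<in> H2 \<Longrightarrow> fmult \<omega> f \<in> H2"
    "\<And>f. f \<in> H2 \<Longrightarrow> h2norm (fmult \<omega> f) \<le> h2norm f"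
proof -
  show H: "fmult \<omega> f \<in> H2" if "f \<in> H2" for f
    unfolding \<omega>_def combination_vapply(3)[OF v that] by (rule vapply_H2[OF combination_vapply(1)[OF v that]])
  show N: "h2norm (fmult \<omega> f) \<le> h2norm f" if "f \<in> H2" for f
  proof -
    have "h2norm (fmult \<omega> f) \<le> sqrt (\<Sum>n. (cmod (v n))\<^sup>2) * h2norm f"
      unfolding \<omega>_def combination_vapply(3)[OF v that] combination_vapply(2)[OF v that, symmetric]
      by (rule h2norm_vapply_le[OF combination_vapply(1)[OF v that]])
    also have "\<dots> \<le> 1 * h2norm f" by (intro mult_right_mono h2norm_nonneg that) (use 1 in simp)
    finally show ?thesis by simp
  qed
  have "\<omega> \<in> Md" unfolding Md_def
    using H N by (auto simp: \<omega>_def off_ball intro!: exI[of _ 1])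
  then show "\<omega> \<in> v0 S" by (simp add: v0_def) (simp add: \<omega>_def zero_on_S)
  show "mult_norm \<omega> \<le> 1" unfolding mult_norm_def
  proof (rule cSup_least)
    have "h2norm (fmult \<omega> (\<lambda>z. 0)) \<in> {h2norm (fmult \<omega> f) |f. f \<in> H2 \<and> h2norm f \<le> 1}"
      by (intro CollectI exI[of _ "\<lambda>z. 0"]) simp
    then show "{h2norm (fmult \<omega> f) |f. f \<in> H2 \<and> h2norm f \<le> 1} \<noteq> {}" by blast
  qed (use N in fastforce)
qed

lemma component:
  shows "(\<lambda>z. \<Omega> z n) \<in> v0 S" "\<And>f. f \<in> H2 \<Longrightarrow> (\<lambda>z. \<Omega> z n * f z) \<in> H2"
    "\<And>f. f \<in> H2 \<Longrightarrow> h2norm (\<lambda>z. \<Omega> z n * f z) \<le> h2norm f"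
proof -
  define v where "v k = (if k = n then 1 else 0 :: complex)" for k
  have "(\<lambda>k. if k = n then 1 else 0 :: real) sums 1" using sums_single[of n "\<lambda>_. 1"] by simp
  moreover have "(\<lambda>k. (cmod (v k))\<^sup>2) = (\<lambda>k. if k = n then 1 else 0)" by (auto simp: v_def)
  ultimately have v: "(\<lambda>k. (cmod (v k))\<^sup>2) sums 1" by simp
  have eq: "(\<lambda>z. \<Sum>k. \<Omega> z k * v k) = (\<lambda>z. \<Omega> z n)"
  proof
    fix z
    have "(\<Sum>k. \<Omega> z k * v k) = (\<Sum>k\<in>{n}. \<Omega> z k * v k)" by (rule suminf_finite) (auto simp: v_def)
    then show "(\<Sum>k. \<Omega> z k * v k) = \<Omega> z n" by (simp add: v_def)
  qed
  note m = combination_multiplier[OF sums_summable[OF v], unfolded eq, OF eq_refl[OF sums_unique[OF v, symmetric]]]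
  show "(\<lambda>z. \<Omega> z n) \<in> v0 S" by (rule m(1))
  show "(\<lambda>z. \<Omega> z n * f z) \<in> H2" if "f \<in> H2" for f using m(3)[OF that] by (simp add: fmult_def)
  show "h2norm (\<lambda>z. \<Omega> z n * f z) \<le> h2norm f" if "f \<in> H2" for f using m(4)[OF that] by (simp add: fmult_def)
qed

lemma h2conv_component:
  assumes "h2conv gs g" shows "h2conv (\<lambda>k z. \<Omega> z n * gs k z) (\<lambda>z. \<Omega> z n * g z)"
proof -
  note g = h2conv_H2[OF assms]
  have "h2norm (\<lambda>z. \<Omega> z n * gs k z - \<Omega> z n * g z) \<le> h2norm (\<lambda>z. gs k z - g z)" for k
    using component(3)[OF H2_diff[OF g(1) g(2)], of n k] by (simp add: right_diff_distrib)
  moreover have "(\<lambda>k. h2norm (\<lambda>z. gs k z - g z)) \<longlonglongrightarrow> 0" using assms by (simp add: h2conv_def)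
  ultimately show ?thesis by (intro h2convI component(2) g)
qed

text \<open>\<open>adj f\<close> is \<open>M\<^sub>\<Omega>\<^sup>* f\<close>, read off at \<open>w\<close> by pairing with \<open>e\<^sub>n \<otimes> k\<^sub>w\<close>.\<close>
definition adj :: "(complex^'d \<Rightarrow> complex) \<Rightarrow> nat \<Rightarrow> complex^'d \<Rightarrow> complex" where
  "adj f n w = (if w \<in> Ball_d then h2inner f (\<lambda>z. \<Omega> z n * kfun w z) else 0)"

lemma ev_adj:
  assumes f: "f \<in> H2" and T: "finite T" "T \<subseteq> Ball_d"
  shows "ev (adj f n) T b = h2inner f (\<lambda>z. \<Omega> z n * comb T b z)"
proof -
  have "(\<lambda>z. \<Omega> z n * comb T b z) = (\<lambda>z. \<Sum>w\<in>T. b w * (\<Omega> z n * kfun w z))"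
    by (auto simp: comb_def sum_distrib_left mult_ac)
  then have "h2inner f (\<lambda>z. \<Omega> z n * comb T b z) = (\<Sum>w\<in>T. h2inner f (\<lambda>z. b w * (\<Omega> z n * kfun w z)))"
    using T by (simp only:) (intro h2inner_sum_right H2_scale component(2) kfun_H2 f, auto)
  also have "\<dots> = (\<Sum>w\<in>T. cnj (b w) * adj f n w)"
  proof (intro sum.cong refl)
    fix w assume "w \<in> T"
    then have w: "w \<in> Ball_d" using T by auto
    show "h2inner f (\<lambda>z. b w * (\<Omega> z n * kfun w z)) = cnj (b w) * adj f n w"
      using h2inner_scale_right[OF f component(2)[OF kfun_H2[OF w]]] w by (simp add: adj_def)
  qed
  finally show ?thesis by (simp add: ev_def)
qed

lemma adj_H2:
  assumes f: "f \<in> H2" shows "adj f n \<in> H2"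
proof (rule H2I)
  show "adj f n z = 0" if "z \<notin> Ball_d" for z using that by (simp add: adj_def)
  show "h2_bound (adj f n) (h2norm f)"
  proof (rule h2_boundI[OF h2norm_nonneg[OF f]])
    fix T :: "(complex^'d) set" and b :: "complex^'d \<Rightarrow> complex" assume T: "finite T" "T \<subseteq> Ball_d"
    note c = comb_H2[OF T, of b]
    have "cmod (ev (adj f n) T b) \<le> h2norm f * h2norm (\<lambda>z. \<Omega> z n * comb T b z)"
      unfolding ev_adj[OF f T] by (rule h2inner_cauchy_schwarz[OF f component(2)[OF c]])
    also have "\<dots> \<le> h2norm f * sqrt (kquad T b)"
      by (intro mult_left_mono h2norm_nonneg f order_trans[OF component(3)[OF c]] h2norm_le h2_bound_comb T)
    finally show "cmod (ev (adj f n) T b) \<le> h2norm f * sqrt (kquad T b)" .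
  qed
qed

lemma h2inner_adj:
  assumes f: "f \<in> H2" and g: "g \<in> H2"
  shows "h2inner (adj f n) g = h2inner f (\<lambda>z. \<Omega> z n * g z)"
proof -
  obtain Ts bs where c: "\<And>k. finite (Ts k)" "\<And>k. Ts k \<subseteq> Ball_d" "h2conv (\<lambda>k. comb (Ts k) (bs k)) g"
    using h2conv_comb_exists[OF g] by blast
  have "(\<lambda>k. h2inner (adj f n) (comb (Ts k) (bs k))) \<longlonglongrightarrow> h2inner (adj f n) g"
    by (rule h2conv_inner[OF h2conv_const[OF adj_H2[OF f]] c(3)])
  moreover have "(\<lambda>k. h2inner f (\<lambda>z. \<Omega> z n * comb (Ts k) (bs k) z)) \<longlonglongrightarrow> h2inner f (\<lambda>z. \<Omega> z n * g z)"
    by (rule h2conv_inner[OF h2conv_const[OF f] h2conv_component[OF c(3)]])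
  moreover have "h2inner (adj f n) (comb (Ts k) (bs k)) = h2inner f (\<lambda>z. \<Omega> z n * comb (Ts k) (bs k) z)" for k
    by (simp add: h2inner_comb adj_H2 f c ev_adj)
  ultimately show ?thesis using LIMSEQ_unique by simp
qed

text \<open>A Bessel-type argument: the partial sum \<open>s\<close> is the pairing of
  \<open>f\<close> with the multiplier applied to the truncated adjoint sequence, whence
  \<open>s \<le> h2norm f * sqrt s\<close>. Truncation is essential, since square summability of
  \<open>adj f\<close> is what is being established.\<close>

lemma adj_partial_le:
  assumes f: "f \<in> H2" shows "(\<Sum>n<m. (h2norm (adj f n))\<^sup>2) \<le> (h2norm f)\<^sup>2"
proof -
  define s where "s = (\<Sum>n<m. (h2norm (adj f n))\<^sup>2)"
  have s0: "0 \<le> s" by (simp add: s_def sum_nonneg)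
  note a = adj_H2[OF f]
  have "complex_of_real s = (\<Sum>n<m. h2inner (adj f n) (adj f n))"
    by (simp only: s_def of_real_sum h2inner_self[OF a])
  also have "\<dots> = (\<Sum>n<m. h2inner f (\<lambda>z. \<Omega> z n * adj f n z))" by (simp add: h2inner_adj f a)
  also have "\<dots> = h2inner f (vapply \<Omega> (vtrunc m (adj f)))"
    unfolding vapply_vtrunc by (rule h2inner_sum_right[symmetric]) (auto intro: component(2) a f)
  finally have "s = cmod (h2inner f (vapply \<Omega> (vtrunc m (adj f))))" using s0
    by (metis abs_of_nonneg norm_of_real)
  also have "\<dots> \<le> h2norm f * h2norm (vapply \<Omega> (vtrunc m (adj f)))"
    by (intro h2inner_cauchy_schwarz f vapply_H2 vtrunc_VH2 a)
  also have "\<dots> \<le> h2norm f * sqrt s"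
    unfolding s_def vnorm_vtrunc[symmetric]
    by (intro mult_left_mono h2norm_vapply_le vtrunc_VH2 a h2norm_nonneg f)
  finally have "sqrt s * sqrt s \<le> h2norm f * sqrt s" using s0 by simp
  then have "sqrt s \<le> h2norm f" if "s \<noteq> 0"
    by (rule mult_right_le_imp_le) (use that s0 in simp)
  then have "sqrt s \<le> h2norm f" using h2norm_nonneg[OF f] by (cases "s = 0") auto
  then show ?thesis unfolding s_def[symmetric] by (rule sqrt_le_D)
qed

lemma adj_VH2:
  assumes f: "f \<in> H2" shows "adj f \<in> VH2" "vnorm (adj f) \<le> h2norm f"
proof -
  have s: "summable (\<lambda>n. (h2norm (adj f n))\<^sup>2)"
    by (rule summableI_nonneg_bounded[OF _ adj_partial_le[OF f]]) simp
  show "adj f \<in> VH2" by (rule VH2I[OF adj_H2[OF f] s])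
  have "(\<Sum>n. (h2norm (adj f n))\<^sup>2) \<le> (h2norm f)\<^sup>2" by (rule suminf_le_const[OF s adj_partial_le[OF f]])
  then show "vnorm (adj f) \<le> h2norm f"
    unfolding vnorm_def using h2norm_nonneg[OF f] by (intro real_le_lsqrt) auto
qed

text \<open>The sequence is the classical value of the adjoint multiplication operator at the kernel
  function \<open>kfun w\<close>; the factorization then says that multiplying back by \<Omega>
  gives the projected kernel function.\<close>

lemma kN_vapply:
  assumes w: "w \<in> Ball_d"
  shows "(\<lambda>n z. cnj (\<Omega> w n) * kfun w z) \<in> VH2" "vapply \<Omega> (\<lambda>n z. cnj (\<Omega> w n) * kfun w z) = kN w"
proof -
  show "(\<lambda>n z. cnj (\<Omega> w n) * kfun w z) \<in> VH2"
    by (rule combination_vapply(1)) (simp_all add: square_summable[OF w] kfun_H2 w)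
  show "vapply \<Omega> (\<lambda>n z. cnj (\<Omega> w n) * kfun w z) = kN w"
  proof
    fix z
    show "vapply \<Omega> (\<lambda>n z. cnj (\<Omega> w n) * kfun w z) z = kN w z"
    proof (cases "z \<in> Ball_d")
      case True
      then show ?thesis
        using sums_unique[OF factor_kernel[OF True w]] by (simp add: vapply_def kfun_def mult.assoc)
    next
      case False
      then show ?thesis using H2_off_ball[OF kN_H2[OF w] False] by (simp add: vapply_off_ball)
    qed
  qed
qed

text \<open>The value at \<open>w\<close> is the limit of pairings of \<open>f\<close> with partial
  sums converging in norm to \<open>kN w\<close>, and \<open>kN\<close> reproduces
  \<open>f\<close>.\<close>

lemma vapply_adj:
  assumes f: "f \<in> zero_space S" shows "vapply \<Omega> (adj f) = f"
proof
  fix w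
  note fH = zs_H2[OF f]
  show "vapply \<Omega> (adj f) w = f w"
  proof (cases "w \<in> Ball_d")
    case True
    note k = kN_vapply[OF True]
    have "(\<lambda>m. h2inner f (\<lambda>z. \<Sum>n<m. \<Omega> z n * (cnj (\<Omega> w n) * kfun w z))) \<longlonglongrightarrow> h2inner f (kN w)"
      using h2conv_inner[OF h2conv_const[OF fH] h2conv_partial[OF k(1)]] by (simp add: k(2))
    moreover have "h2inner f (\<lambda>z. \<Sum>n<m. \<Omega> z n * (cnj (\<Omega> w n) * kfun w z)) = (\<Sum>n<m. \<Omega> w n * adj f n w)" for m
    proof -
      have "h2inner f (\<lambda>z. \<Sum>n<m. \<Omega> z n * (cnj (\<Omega> w n) * kfun w z)) = (\<Sum>n<m. h2inner f (\<lambda>z. \<Omega> z n * (cnj (\<Omega> w n) * kfun w z)))"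
        by (rule h2inner_sum_right) (simp_all add: component(2) H2_scale kfun_H2 True fH)
      also have "\<dots> = (\<Sum>n<m. \<Omega> w n * adj f n w)"
      proof (intro sum.cong refl)
        fix n
        show "h2inner f (\<lambda>z. \<Omega> z n * (cnj (\<Omega> w n) * kfun w z)) = \<Omega> w n * adj f n w"
          using h2inner_scale_right[OF fH component(2)[OF kfun_H2[OF True]], of "cnj (\<Omega> w n)" n] True
          by (simp add: adj_def mult_ac)
      qed
      finally show ?thesis .
    qed
    ultimately have "(\<lambda>m. \<Sum>n<m. \<Omega> w n * adj f n w) \<longlonglongrightarrow> f w" by (simp add: repro True f)
    moreover have "(\<lambda>m. \<Sum>n<m. \<Omega> w n * adj f n w) \<longlonglongrightarrow> vapply \<Omega> (adj f) w"
      using vapply_sums[OF adj_VH2(1)[OF fH]] by (simp add: sums_def)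
    ultimately show ?thesis using LIMSEQ_unique by blast
  next
    case False
    then show ?thesis using H2_off_ball[OF fH False] by (simp add: vapply_off_ball)
  qed
qed

text \<open>With \<open>f\<close> the image of \<open>F\<close>, the sequence \<open>adj f\<close>
  has the same image, so \<open>F\<close> minus \<open>adj f\<close> lies in the kernel.
  Orthogonality of \<open>F\<close> to the kernel gives \<open>vnorm F \<le> vnorm (adj f)\<close>,
  and contractivity in both directions closes the chain of inequalities.\<close>

lemma inner: "inner_multiplier \<Omega>"
  unfolding inner_multiplier_def vmultiplier_def
proof (intro conjI allI ballI impI)
  show "\<exists>C. \<forall>F\<in>VH2. vapply \<Omega> F \<in> H2 \<and> h2norm (vapply \<Omega> F) \<le> C * vnorm F"
    by (rule exI[of _ 1]) (simp add: vapply_H2 h2norm_vapply_le)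
  fix F assume F: "F \<in> VH2" and orth: "\<forall>G\<in>VH2. vapply \<Omega> G = (\<lambda>z. 0) \<longrightarrow> vinner F G = 0"
  define f where "f = vapply \<Omega> F"
  have f: "f \<in> zero_space S" unfolding f_def by (rule vapply_zero_space[OF F])
  note a = adj_VH2[OF zs_H2[OF f]]
  have "vapply \<Omega> (\<lambda>n z. F n z - adj f n z) = (\<lambda>z. 0)"
    unfolding vapply_diff[OF F a(1)] vapply_adj[OF f] by (simp add: f_def)
  then have "vinner F (\<lambda>n z. F n z - adj f n z) = 0" using orth VH2_diff[OF F a(1)] by blast
  then have "vinner F F = vinner F (adj f)" using vinner_diff_right[OF F F a(1)] by simp
  then have "cmod (vinner F F) \<le> vnorm F * vnorm (adj f)" using vinner_cauchy_schwarz(2)[OF F a(1)] by simp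
  then have "(vnorm F)\<^sup>2 \<le> vnorm F * vnorm (adj f)" by (simp add: vinner_self[OF F] norm_power)
  then have "vnorm F \<le> vnorm (adj f)"
    using vnorm_nonneg[OF F] vnorm_nonneg[OF a(1)] by (cases "vnorm F = 0") (auto simp: power2_eq_square)
  then show "h2norm (vapply \<Omega> F) = vnorm F" using a(2) h2norm_vapply_le[OF F] by (simp add: f_def)
qed (simp_all add: off_ball square_summable)

lemma range_zero_space: "vrange \<Omega> = zero_space S"
proof
  show "vrange \<Omega> \<subseteq> zero_space S" by (auto simp: vrange_def vapply_zero_space)
  show "zero_space S \<subseteq> vrange \<Omega>"
  proof
    fix f assume f: "f \<in> zero_space S"
    show "f \<in> vrange \<Omega>" unfolding vrange_def
      using vapply_adj[OF f] adj_VH2(1)[OF zs_H2[OF f]] by force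
  qed
qed

text \<open>One inclusion is continuity of point evaluations. The other uses the factorization:
  \<open>f\<close> is the norm limit of the partial sums of \<open>\<Omega> z n * adj f n z\<close>,
  whose first factors are multipliers vanishing on \<open>S\<close>.\<close>

lemma ideal_zero_space: "idealH2 (v0 S) = zero_space S"
proof
  define P where "P = {fmult \<phi> f |\<phi> f. \<phi> \<in> v0 S \<and> f \<in> H2}"
  have P: "g \<in> zero_space S" if "g \<in> P" for g
    using that unfolding P_def v0_def Md_def zero_space_def by (auto simp: fmult_def)
  have span: "g \<in> zero_space S" if gP: "g \<in> h2span P" for g
  proof -
    obtain n c h where g: "g = (\<lambda>z. \<Sum>i<(n::nat). c i * h i z)" and h: "\<forall>i<n. h i \<in> P"
      using gP unfolding h2span_def by blast
    have "g \<in> H2" unfolding g using h P by (intro H2_sum H2_scale) (auto simp: zero_space_def)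
    then show ?thesis unfolding zero_space_def using h P by (auto simp: g zero_space_def intro!: sum.neutral)
  qed
  show "idealH2 (v0 S) \<subseteq> zero_space S"
  proof
    fix f assume "f \<in> idealH2 (v0 S)"
    then have f: "f \<in> H2" and app: "\<And>\<epsilon>. \<epsilon> > 0 \<Longrightarrow> \<exists>g\<in>h2span P. h2norm (\<lambda>z. f z - g z) < \<epsilon>"
      unfolding idealH2_def h2closed_span_def P_def by auto
    have "f z = 0" if z: "z \<in> S" for z
    proof (cases "z \<in> Ball_d")
      case True
      define K where "K = sqrt (Re (DAkernel z z))"
      have K: "0 \<le> K" unfolding K_def using psd_diag_nonneg[OF psd_DAkernel True] by simp
      have "cmod (f z) \<le> 0 + e" if e: "e > 0" for e
      proof -
        have "e / (K + 1) > 0" using e K by simp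
        then obtain g where g: "g \<in> h2span P" "h2norm (\<lambda>z. f z - g z) < e / (K + 1)" using app by blast
        note gz = span[OF g(1)]
        have "cmod (f z - g z) \<le> h2norm (\<lambda>z. f z - g z) * K"
          unfolding K_def using cmod_le_h2norm[OF H2_diff[OF f zs_H2[OF gz]] True] by simp
        also have "\<dots> \<le> e / (K + 1) * (K + 1)"
          using g(2) K e by (intro mult_mono) auto
        finally show ?thesis using gz z K by (simp add: zero_space_def)
      qed
      then have "cmod (f z) \<le> 0" by (rule field_le_epsilon)
      then show ?thesis by simp
    qed (rule H2_off_ball[OF f])
    then show "f \<in> zero_space S" using f by (simp add: zero_space_def)
  qed
  show "zero_space S \<subseteq> idealH2 (v0 S)"
  proof
    fix f assume f: "f \<in> zero_space S"
    note fH = zs_H2[OF f]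
    note c = h2conv_partial[OF adj_VH2(1)[OF fH], unfolded vapply_adj[OF f]]
    have "\<exists>g\<in>h2span P. h2norm (\<lambda>z. f z - g z) < e" if e: "e > 0" for e
    proof -
      have "eventually (\<lambda>m. h2norm (\<lambda>z. (\<Sum>n<m. \<Omega> z n * adj f n z) - f z) < e) sequentially"
        using c e unfolding h2conv_def by (intro order_tendstoD(2)[of _ 0]) auto
      then obtain m where m: "h2norm (\<lambda>z. (\<Sum>n<m. \<Omega> z n * adj f n z) - f z) < e"
        unfolding eventually_sequentially by blast
      have "fmult (\<lambda>z. \<Omega> z n) (adj f n) \<in> P" for n
        unfolding P_def using component(1) adj_H2[OF fH] by blast
      then have "(\<lambda>z. \<Sum>n<m. 1 * fmult (\<lambda>z. \<Omega> z n) (adj f n) z) \<in> h2span P"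
        unfolding h2span_def by (intro CollectI exI[of _ m] exI[of _ "\<lambda>_. 1"] exI[of _ "\<lambda>n. fmult (\<lambda>z. \<Omega> z n) (adj f n)"]) auto
      then have "(\<lambda>z. \<Sum>n<m. \<Omega> z n * adj f n z) \<in> h2span P" by (simp add: fmult_def)
      then show ?thesis using m h2norm_minus_commute[OF fH h2conv_H2(1)[OF c, of m]] by (intro bexI) auto
    qed
    then show "f \<in> idealH2 (v0 S)" using fH unfolding idealH2_def h2closed_span_def P_def by simp
  qed
qed

section \<open>Point values of \<Omega> and the extremal scalar multiplier\<close>

lemma kN_diag:
  assumes z: "z \<in> Ball_d"
  shows "(h2norm (kN z))\<^sup>2 = Re (DAkernel z z) * (vpoint_norm \<Omega> z)\<^sup>2"
proof -
  have v: "(vpoint_norm \<Omega> z)\<^sup>2 = (\<Sum>n. (cmod (\<Omega> z n))\<^sup>2)"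
    unfolding vpoint_norm_def by (intro real_sqrt_pow2 suminf_nonneg square_summable z) simp
  have "(\<lambda>n. complex_of_real ((cmod (\<Omega> z n))\<^sup>2 * Re (DAkernel z z))) sums kN z z"
    using factor_kernel[OF z z]
    unfolding of_real_mult complex_norm_square psd_diag_real[OF psd_DAkernel z, symmetric] .
  moreover have "kN z z = complex_of_real ((h2norm (kN z))\<^sup>2)"
    using repro[OF z kN[OF z]] h2inner_self[OF kN_H2[OF z]] by simp
  ultimately have "(\<lambda>n. (cmod (\<Omega> z n))\<^sup>2 * Re (DAkernel z z)) sums (h2norm (kN z))\<^sup>2"
    by (simp only: sums_of_real_iff)
  moreover have "(\<lambda>n. (cmod (\<Omega> z n))\<^sup>2 * Re (DAkernel z z)) sums ((vpoint_norm \<Omega> z)\<^sup>2 * Re (DAkernel z z))"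
    unfolding v by (intro sums_mult2 summable_sums square_summable z)
  ultimately show ?thesis using sums_unique2 by (metis mult.commute)
qed

lemma vpoint_norm_nonneg: "z \<in> Ball_d \<Longrightarrow> 0 \<le> vpoint_norm \<Omega> z"
  unfolding vpoint_norm_def by (intro real_sqrt_ge_zero suminf_nonneg square_summable) auto

text \<open>Read backwards, this is the lower bound for \<Omega>: a function in the subspace with a
  large value at \<open>z\<close> relative to its norm forces \<open>vpoint_norm \<Omega> z\<close>
  to be large.\<close>

lemma zero_space_point_bound:
  assumes z: "z \<in> Ball_d" and f: "f \<in> zero_space S"
  shows "cmod (f z) \<le> h2norm f * (h2norm (kfun z) * vpoint_norm \<Omega> z)"
proof -
  have "(h2norm (kN z))\<^sup>2 = (h2norm (kfun z) * vpoint_norm \<Omega> z)\<^sup>2"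
    unfolding kN_diag[OF z] power_mult_distrib h2norm_kfun_sq[OF z] ..
  then have "h2norm (kN z) = h2norm (kfun z) * vpoint_norm \<Omega> z"
    using h2norm_nonneg[OF kN_H2[OF z]] h2norm_nonneg[OF kfun_H2[OF z]] vpoint_norm_nonneg[OF z]
    by (auto intro: power2_eq_imp_eq)
  then show ?thesis
    using h2inner_cauchy_schwarz[OF zs_H2[OF f] kN_H2[OF z]] repro[OF z f] by simp
qed

lemma extremal_multiplier:
  assumes z: "z \<in> Ball_d"
  obtains \<omega> where "\<omega> \<in> v0 S" "mult_norm \<omega> \<le> 1" "cmod (\<omega> z) = vpoint_norm \<Omega> z"
proof -
  define r where "r = vpoint_norm \<Omega> z"
  have r0: "0 \<le> r" unfolding r_def by (rule vpoint_norm_nonneg[OF z])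
  have s: "(\<lambda>n. (cmod (\<Omega> z n))\<^sup>2) sums r\<^sup>2"
    unfolding r_def vpoint_norm_def using summable_sums[OF square_summable[OF z]] suminf_nonneg[OF square_summable[OF z]] by simp
  \<comment> \<open>The unit vector that saturates Cauchy-Schwarz against \<open>\<Omega> z\<close>.
    If \<open>r = 0\<close>, division by zero makes \<open>v\<close> zero and the computation below
    still returns \<open>r\<close>.\<close>
  define v where "v n = cnj (\<Omega> z n) / of_real r" for n
  have "(\<lambda>n. (cmod (v n))\<^sup>2) = (\<lambda>n. (cmod (\<Omega> z n))\<^sup>2 / r\<^sup>2)"
    using r0 by (simp add: v_def norm_divide power_divide)
  then have sv: "(\<lambda>n. (cmod (v n))\<^sup>2) sums (r\<^sup>2 / r\<^sup>2)" using sums_divide[OF s, of "r\<^sup>2"] by simp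
  have le: "(\<Sum>n. (cmod (v n))\<^sup>2) \<le> 1" unfolding sums_unique[OF sv, symmetric] by simp
  note m = combination_multiplier[OF sums_summable[OF sv] le]
  have "(\<lambda>n. complex_of_real ((cmod (\<Omega> z n))\<^sup>2) / of_real r) sums (of_real (r\<^sup>2) / of_real r)"
    by (intro sums_divide) (simp only: sums_of_real_iff s)
  then have "(\<lambda>n. \<Omega> z n * v n) sums of_real (r\<^sup>2 / r)"
    unfolding v_def complex_norm_square by simp
  then have "(\<Sum>n. \<Omega> z n * v n) = of_real r"
    by (simp add: sums_iff power2_eq_square)
  then show ?thesis using that[OF m(1,2)] r0 by (simp add: r_def)
qed

end

theorem zero_space_inner_multiplier:
  fixes S :: "(complex^'d) set"
  obtains \<Omega> where "inner_multiplier \<Omega>" "vrange \<Omega> = idealH2 (v0 S)"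
    "\<And>z f. z \<in> Ball_d \<Longrightarrow> f \<in> zero_space S \<Longrightarrow> cmod (f z) \<le> h2norm f * (h2norm (kfun z) * vpoint_norm \<Omega> z)"
    "\<And>z. z \<in> Ball_d \<Longrightarrow> \<exists>\<omega>\<in>v0 S. mult_norm \<omega> \<le> 1 \<and> cmod (\<omega> z) = vpoint_norm \<Omega> z"
proof -
  show ?thesis
  proof (rule zero_space_kernel_exists[of S])
    fix kN
    assume kN: "\<And>w. w \<in> Ball_d \<Longrightarrow> kN w \<in> zero_space S"
      "\<And>w h. w \<in> Ball_d \<Longrightarrow> h \<in> zero_space S \<Longrightarrow> h2inner h (kN w) = h w"
    interpret zero_kernel S kN by unfold_locales (simp_all add: kN)
    show ?thesis
    proof (rule factor_exists)
      fix \<Omega> :: "complex^'d \<Rightarrow> nat \<Rightarrow> complex"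
      assume \<Omega>: "\<And>z w. z \<in> Ball_d \<Longrightarrow> w \<in> Ball_d \<Longrightarrow> (\<lambda>n. \<Omega> z n * cnj (\<Omega> w n)) sums ((1 - cinner z w) * kN w z)"
        "\<And>z. z \<in> Ball_d \<Longrightarrow> summable (\<lambda>n. (cmod (\<Omega> z n))\<^sup>2)"
        "\<And>z. z \<notin> Ball_d \<Longrightarrow> \<Omega> z = (\<lambda>n. 0)"
      interpret zero_factor S kN \<Omega> by unfold_locales (simp_all add: \<Omega>)
      show ?thesis
      proof (rule that[of \<Omega>])
        show "inner_multiplier \<Omega>" by (rule inner)
        show "vrange \<Omega> = idealH2 (v0 S)" by (simp add: range_zero_space ideal_zero_space)
        show "\<exists>\<omega>\<in>v0 S. mult_norm \<omega> \<le> 1 \<and> cmod (\<omega> z) = vpoint_norm \<Omega> z" if "z \<in> Ball_d" for z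
          using extremal_multiplier[OF that] by metis
      qed (rule zero_space_point_bound)
    qed
  qed
qed

section \<open>Compressions of the coordinate multipliers\<close>

lemma h2span_insert:
  assumes "f \<in> h2span G" "g \<in> G"
  shows "(\<lambda>z. f z + c * g z) \<in> h2span G"
proof -
  obtain n d h where f: "f = (\<lambda>z. \<Sum>i<(n::nat). d i * h i z)" and h: "\<forall>i<n. h i \<in> G"
    using assms(1) unfolding h2span_def by blast
  have "(\<lambda>z. f z + c * g z) = (\<lambda>z. \<Sum>i<Suc n. (d(n := c)) i * (h(n := g)) i z)"
    unfolding f by (rule ext) simp
  moreover have "\<forall>i<Suc n. (h(n := g)) i \<in> G" using h assms(2) by (simp add: less_Suc_eq)
  ultimately show ?thesis unfolding h2span_def by blast
qed

lemma h2span_add_scale: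
  assumes f: "f \<in> h2span G" and g: "g \<in> h2span G"
  shows "(\<lambda>z. f z + c * g z) \<in> h2span G"
proof -
  obtain n d h where g: "g = (\<lambda>z. \<Sum>i<(n::nat). d i * h i z)" and h: "\<forall>i<n. h i \<in> G"
    using g unfolding h2span_def by blast
  have "(\<lambda>z. f z + c * (\<Sum>i<m. d i * h i z)) \<in> h2span G" if "m \<le> n" for m
    using that
  proof (induction m)
    case 0 then show ?case using f by simp
  next
    case (Suc m)
    then have "(\<lambda>z. (f z + c * (\<Sum>i<m. d i * h i z)) + (c * d m) * h m z) \<in> h2span G"
      using h by (intro h2span_insert[of "\<lambda>z. f z + c * (\<Sum>i<m. d i * h i z)"]) auto
    then show ?case by (simp add: algebra_simps)
  qed
  then show ?thesis unfolding g by simp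
qed

lemma h2span_zero: "(\<lambda>z. 0) \<in> h2span G"
  unfolding h2span_def by (rule CollectI, rule exI[of _ 0]) simp

lemma h2span_H2:
  assumes "G \<subseteq> H2" "f \<in> h2span G" shows "f \<in> H2"
proof -
  obtain n d h where f: "f = (\<lambda>z. \<Sum>i<(n::nat). d i * h i z)" and h: "\<forall>i<n. h i \<in> G"
    using assms(2) unfolding h2span_def by blast
  show ?thesis unfolding f using h assms(1) by (intro H2_sum H2_scale) auto
qed

lemma closed_subspace_closed_span:
  assumes G: "G \<subseteq> H2"
  shows "closed_subspace (h2closed_span G)"
  unfolding closed_subspace_def
proof (intro conjI ballI allI impI)
  show "h2closed_span G \<subseteq> H2" by (auto simp: h2closed_span_def)
  show "(\<lambda>z. 0) \<in> h2closed_span G"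
    unfolding h2closed_span_def using h2span_zero[of G] by (auto intro!: bexI[of _ "\<lambda>z. 0"])
  fix f g c assume f: "f \<in> h2closed_span G" and g: "g \<in> h2closed_span G"
  have H: "f \<in> H2" "g \<in> H2" using f g by (auto simp: h2closed_span_def)
  have "\<exists>h\<in>h2span G. h2norm (\<lambda>z. (f z + c * g z) - h z) < e" if e: "e > 0" for e
  proof -
    \<comment> \<open>The added \<open>1\<close> keeps the denominator positive when
      \<open>c = 0\<close>.\<close>
    define d where "d = e / 2 / (cmod c + 1)"
    have d: "d > 0" unfolding d_def using e by (simp add: add_nonneg_pos)
    have cd: "cmod c * d \<le> e / 2"
    proof -
      have "cmod c * d \<le> (cmod c + 1) * d" using d by simp
      also have "\<dots> = e / 2"
      proof -
        have "cmod c + 1 > 0" by (simp add: add_nonneg_pos)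
        then show ?thesis unfolding d_def by (metis less_irrefl nonzero_mult_div_cancel_left times_divide_eq_right)
      qed
      finally show ?thesis .
    qed
    obtain f' where f': "f' \<in> h2span G" "h2norm (\<lambda>z. f z - f' z) < e / 2"
      using f half_gt_zero[OF e] unfolding h2closed_span_def by blast
    obtain g' where g': "g' \<in> h2span G" "h2norm (\<lambda>z. g z - g' z) < d"
      using g d unfolding h2closed_span_def by blast
    note H' = h2span_H2[OF G f'(1)] h2span_H2[OF G g'(1)]
    have "h2norm (\<lambda>z. (f z - f' z) + c * (g z - g' z)) \<le> h2norm (\<lambda>z. f z - f' z) + cmod c * h2norm (\<lambda>z. g z - g' z)"
      using h2norm_triangle[OF H2_diff[OF H(1) H'(1)] H2_scale[OF H2_diff[OF H(2) H'(2)], of c]]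
      by (simp add: h2norm_scale[OF H2_diff[OF H(2) H'(2)]])
    also have "\<dots> < e / 2 + cmod c * d"
      using f'(2) g'(2) by (intro add_less_le_mono mult_left_mono) auto
    also have "\<dots> \<le> e" using cd by simp
    finally have "h2norm (\<lambda>z. (f z + c * g z) - (f' z + c * g' z)) < e" by (simp add: algebra_simps)
    then show ?thesis by (rule bexI[OF _ h2span_add_scale[OF f'(1) g'(1)]])
  qed
  then show "(\<lambda>z. f z + c * g z) \<in> h2closed_span G"
    using H by (simp add: h2closed_span_def H2_add H2_scale)
next
  fix fs f assume c: "h2conv fs f" and fs: "\<forall>n. fs n \<in> h2closed_span G"
  note H = h2conv_H2[OF c]
  have "\<exists>h\<in>h2span G. h2norm (\<lambda>z. f z - h z) < e" if e: "e > 0" for e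
  proof -
    have "eventually (\<lambda>n. h2norm (\<lambda>z. fs n z - f z) < e / 2) sequentially"
      using c e unfolding h2conv_def by (intro order_tendstoD(2)[of _ 0]) auto
    then obtain n where n: "h2norm (\<lambda>z. fs n z - f z) < e / 2" unfolding eventually_sequentially by blast
    obtain h where h: "h \<in> h2span G" "h2norm (\<lambda>z. fs n z - h z) < e / 2"
      using fs half_gt_zero[OF e] unfolding h2closed_span_def by blast
    have "h2norm (\<lambda>z. f z - h z) < e"
      using h2norm_triangle_diff[OF H(2) H(1)[of n] h2span_H2[OF G h(1)]] n h(2)
        h2norm_minus_commute[OF H(2) H(1)[of n]] by simp
    then show ?thesis using h(1) by blast
  qed
  then show "f \<in> h2closed_span G" using H by (simp add: h2closed_span_def)
qed

lemma closed_span_coord_invariant: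
  assumes G: "G \<subseteq> H2" and inv: "\<And>g. g \<in> G \<Longrightarrow> fmult (coord j) g \<in> G" and f: "f \<in> h2closed_span G"
  shows "fmult (coord j) f \<in> h2closed_span G"
proof -
  have fH: "f \<in> H2" using f by (simp add: h2closed_span_def)
  have span: "fmult (coord j) g \<in> h2span G" if g: "g \<in> h2span G" for g
  proof -
    obtain n d h where g: "g = (\<lambda>z. \<Sum>i<(n::nat). d i * h i z)" and h: "\<forall>i<n. h i \<in> G"
      using g unfolding h2span_def by blast
    have "fmult (coord j) g = (\<lambda>z. \<Sum>i<n. d i * fmult (coord j) (h i) z)"
      unfolding g fmult_def by (simp add: sum_distrib_left mult_ac)
    moreover have "\<forall>i<n. fmult (coord j) (h i) \<in> G" using h inv by blast
    ultimately show ?thesis unfolding h2span_def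
      by (intro CollectI exI[of _ n] exI[of _ d] exI[of _ "\<lambda>i. fmult (coord j) (h i)"]) simp
  qed
  have "\<exists>h\<in>h2span G. h2norm (\<lambda>z. fmult (coord j) f z - h z) < e" if e: "e > 0" for e
  proof -
    obtain g where g: "g \<in> h2span G" "h2norm (\<lambda>z. f z - g z) < e"
      using f e unfolding h2closed_span_def by blast
    have "h2norm (fmult (coord j) (\<lambda>z. f z - g z)) < e"
      using h2norm_coord_mult_le[OF H2_diff[OF fH h2span_H2[OF G g(1)]], of j] g(2) by simp
    then have "h2norm (\<lambda>z. fmult (coord j) f z - fmult (coord j) g z) < e"
      by (simp add: fmult_def right_diff_distrib)
    then show ?thesis using span[OF g(1)] by blast
  qed
  then show ?thesis using coord_mult_H2[OF fH] by (simp add: h2closed_span_def)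
qed

lemma ideal_products_H2:
  assumes "A \<subseteq> Md" shows "{fmult \<phi> f |\<phi> f. \<phi> \<in> A \<and> f \<in> H2} \<subseteq> H2"
  using assms by (auto simp: Md_def)

lemma closed_subspace_ideal: "A \<subseteq> Md \<Longrightarrow> closed_subspace (idealH2 A)"
  unfolding idealH2_def by (rule closed_subspace_closed_span[OF ideal_products_H2])

lemma ideal_coord_invariant:
  assumes "A \<subseteq> Md" "f \<in> idealH2 A" shows "fmult (coord j) f \<in> idealH2 A"
  unfolding idealH2_def
proof (rule closed_span_coord_invariant[OF ideal_products_H2[OF assms(1)] _ assms(2)[unfolded idealH2_def]])
  fix g assume "g \<in> {fmult \<phi> f |\<phi> f. \<phi> \<in> A \<and> f \<in> H2}"
  then obtain \<phi> f where g: "g = fmult \<phi> f" "\<phi> \<in> A" "f \<in> H2" by blast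
  have "fmult (coord j) g = fmult \<phi> (fmult (coord j) f)" by (simp add: g fmult_def mult_ac)
  then show "fmult (coord j) g \<in> {fmult \<phi> f |\<phi> f. \<phi> \<in> A \<and> f \<in> H2}"
    using g coord_mult_H2 by blast
qed

section \<open>Projection onto the complement of the closed ideal space\<close>

lemma closed_subspace_add_scale: "closed_subspace S \<Longrightarrow> f \<in> S \<Longrightarrow> g \<in> S \<Longrightarrow> (\<lambda>z. f z + c * g z) \<in> S"
  by (simp add: closed_subspace_def)

lemma Ha_add_scale:
  assumes "A \<subseteq> Md" "f \<in> Ha A" "g \<in> Ha A" shows "(\<lambda>z. f z + c * g z) \<in> Ha A"
proof -
  have "h \<in> H2" if "h \<in> idealH2 A" for h
    using that by (simp add: idealH2_def h2closed_span_def)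
  then show ?thesis
    using assms by (simp add: Ha_def H2_add H2_scale h2inner_add_left h2inner_scale_left)
qed

text \<open>Replaces the definite description by an orthogonal decomposition to be exhibited.
  Uniqueness holds because the difference of two candidates is orthogonal to itself.\<close>

lemma h2proj_eqI:
  assumes A: "A \<subseteq> Md" and f: "f \<in> H2" and g: "g \<in> Ha A" and d: "(\<lambda>z. f z - g z) \<in> idealH2 A"
  shows "h2proj (Ha A) f = g"
  unfolding h2proj_def
proof (rule the_equality)
  have orth: "h2inner (\<lambda>z. f z - g z) h = 0" if h: "h \<in> Ha A" for h
  proof -
    have "h2inner h (\<lambda>z. f z - g z) = 0" "h \<in> H2" "g \<in> H2" using h d g by (auto simp: Ha_def)
    then show ?thesis using h2inner_commute[of h "\<lambda>z. f z - g z"] H2_diff[OF f] by simp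
  qed
  then show "g \<in> Ha A \<and> (\<forall>h\<in>Ha A. h2inner (\<lambda>z. f z - g z) h = 0)" using g by blast
  fix g' assume g': "g' \<in> Ha A \<and> (\<forall>h\<in>Ha A. h2inner (\<lambda>z. f z - g' z) h = 0)"
  have H: "g \<in> H2" "g' \<in> H2" using g g' by (auto simp: Ha_def)
  define h where "h = (\<lambda>z. g' z - g z)"
  have h: "h \<in> Ha A" using Ha_add_scale[OF A, of g' g "- 1"] g g' by (simp add: h_def)
  have hH: "h \<in> H2" unfolding h_def by (rule H2_diff[OF H(2,1)])
  have "h2inner h h = h2inner (\<lambda>z. (f z - g z) - (f z - g' z)) h" by (simp add: h_def)
  also have "\<dots> = 0"
    using h2inner_diff_left[OF H2_diff[OF f H(1)] H2_diff[OF f H(2)] hH] orth[OF h] g' h by simp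
  finally have "h2norm h = 0" by (simp add: h2inner_self[OF hH])
  then have "h = (\<lambda>z. 0)" by (rule h2norm_eq_zero[OF hH])
  then show "g' = g" by (auto simp: h_def fun_eq_iff)
qed

text \<open>Existence is obtained on the other summand: \<open>f\<close> is projected onto the
  closed space \<open>idealH2 A\<close>, and the remainder is the required element of
  \<open>Ha A\<close>.\<close>

lemma h2proj_Ha:
  assumes A: "A \<subseteq> Md" and f: "f \<in> H2"
  shows "h2proj (Ha A) f \<in> Ha A" "(\<lambda>z. f z - h2proj (Ha A) f z) \<in> idealH2 A"
    "h2norm (h2proj (Ha A) f) \<le> h2norm f"
proof -
  obtain u where u: "u \<in> idealH2 A" "\<And>h. h \<in> idealH2 A \<Longrightarrow> h2inner (\<lambda>z. f z - u z) h = 0"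
    using projection_exists[OF closed_subspace_ideal[OF A] f] by metis
  have uH: "u \<in> H2" using u(1) by (simp add: idealH2_def h2closed_span_def)
  define v where "v = (\<lambda>z. f z - u z)"
  have vH: "v \<in> H2" unfolding v_def by (rule H2_diff[OF f uH])
  have v: "v \<in> Ha A" using vH u(2) by (simp add: Ha_def v_def)
  have d: "(\<lambda>z. f z - v z) \<in> idealH2 A" using u(1) by (simp add: v_def)
  have p: "h2proj (Ha A) f = v" by (rule h2proj_eqI[OF A f v d])
  show "h2proj (Ha A) f \<in> Ha A" "(\<lambda>z. f z - h2proj (Ha A) f z) \<in> idealH2 A" unfolding p by (fact v d)+
  have "h2inner v u = 0" using v u(1) by (simp add: Ha_def)
  then have "h2inner u v = 0" using h2inner_commute[OF vH uH] by simp
  then have "h2inner v v = h2inner f v" using h2inner_diff_left[OF f uH vH] by (simp add: v_def)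
  then have "cmod (h2inner v v) \<le> h2norm f * h2norm v" using h2inner_cauchy_schwarz[OF f vH] by simp
  then have "(h2norm v)\<^sup>2 \<le> h2norm f * h2norm v" by (simp add: h2inner_self[OF vH] norm_power)
  then show "h2norm (h2proj (Ha A) f) \<le> h2norm f"
    unfolding p using h2norm_nonneg[OF vH] h2norm_nonneg[OF f]
    by (cases "h2norm v = 0") (auto simp: power2_eq_square)
qed

lemma h2proj_Ha_id:
  assumes A: "A \<subseteq> Md" and "f \<in> Ha A" shows "h2proj (Ha A) f = f"
  using assms closed_subspace_ideal[OF A] by (intro h2proj_eqI) (auto simp: closed_subspace_def Ha_def)

lemma h2proj_Ha_add_scale:
  assumes A: "A \<subseteq> Md" and f: "f \<in> H2" and g: "g \<in> H2"
  shows "h2proj (Ha A) (\<lambda>z. f z + c * g z) = (\<lambda>z. h2proj (Ha A) f z + c * h2proj (Ha A) g z)"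
proof (rule h2proj_eqI[OF A])
  note pf = h2proj_Ha[OF A f] and pg = h2proj_Ha[OF A g]
  show "(\<lambda>z. f z + c * g z) \<in> H2" by (intro H2_add H2_scale f g)
  show "(\<lambda>z. h2proj (Ha A) f z + c * h2proj (Ha A) g z) \<in> Ha A" by (rule Ha_add_scale[OF A pf(1) pg(1)])
  show "(\<lambda>z. f z + c * g z - (h2proj (Ha A) f z + c * h2proj (Ha A) g z)) \<in> idealH2 A"
    using closed_subspace_add_scale[OF closed_subspace_ideal[OF A] pf(2) pg(2), of c] by (simp add: algebra_simps)
qed

text \<open>The part of \<open>f\<close> lying in \<open>idealH2 A\<close> stays there under
  multiplication by a coordinate, so the projection discards it both before and after the
  multiplication.\<close>

lemma h2proj_Ha_coord:
  assumes A: "A \<subseteq> Md" and f: "f \<in> H2"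
  shows "h2proj (Ha A) (fmult (coord j) f) = Zop A j (h2proj (Ha A) f)"
proof (rule h2proj_eqI[OF A coord_mult_H2[OF f]])
  define g where "g = h2proj (Ha A) f"
  note pf = h2proj_Ha[OF A f, folded g_def]
  have g: "g \<in> H2" using pf(1) by (simp add: Ha_def)
  note pg = h2proj_Ha[OF A coord_mult_H2[OF g, of j]]
  show "Zop A j (h2proj (Ha A) f) \<in> Ha A" unfolding Zop_def g_def[symmetric] by (rule pg(1))
  have "(\<lambda>z. (fmult (coord j) g z - h2proj (Ha A) (fmult (coord j) g) z) + 1 * fmult (coord j) (\<lambda>z. f z - g z) z) \<in> idealH2 A"
    by (rule closed_subspace_add_scale[OF closed_subspace_ideal[OF A] pg(2) ideal_coord_invariant[OF A pf(2)]])
  then show "(\<lambda>z. fmult (coord j) f z - Zop A j (h2proj (Ha A) f) z) \<in> idealH2 A"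
    unfolding Zop_def g_def[symmetric] by (simp add: fmult_def algebra_simps)
qed

text \<open>On the ball \<open>kfun 0\<close> is the constant 1. The eigenvalue relation turns the
  expansion of \<open>kfun w\<close> by coordinate multiples into a scalar equation that determines
  the functional on \<open>kfun w\<close>, the factor \<open>1 - cinner l w\<close> being nonzero.
  Linearity and boundedness then reach all of \<open>H2\<close> through kernel combinations.\<close>

lemma functional_is_evaluation:
  fixes \<phi> :: "(complex^'d \<Rightarrow> complex) \<Rightarrow> complex"
  assumes lin: "\<And>f g c. f \<in> H2 \<Longrightarrow> g \<in> H2 \<Longrightarrow> \<phi> (\<lambda>z. f z + c * g z) = \<phi> f + c * \<phi> g"
    and bound: "\<And>f. f \<in> H2 \<Longrightarrow> cmod (\<phi> f) \<le> C * h2norm f"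
    and eig: "\<And>f j. f \<in> H2 \<Longrightarrow> \<phi> (fmult (coord j) f) = l $ j * \<phi> f"
    and l: "l \<in> Ball_d" and f: "f \<in> H2"
  shows "\<phi> f = \<phi> (kfun 0) * f l"
proof -
  have zero: "\<phi> (\<lambda>z. 0) = 0" using bound[OF H2_zero] by simp
  have sum_lin: "\<phi> (\<lambda>z. g z + (\<Sum>i\<in>I. c i * h i z)) = \<phi> g + (\<Sum>i\<in>I. c i * \<phi> (h i))"
    if "finite I" "g \<in> H2" "\<And>i. i \<in> I \<Longrightarrow> h i \<in> H2" for I :: "'i set" and c g h
    using that(1,3)
  proof (induction I rule: finite_induct)
    case empty then show ?case by simp
  next
    case (insert x F)
    have "\<phi> (\<lambda>z. (g z + (\<Sum>i\<in>F. c i * h i z)) + c x * h x z) = \<phi> (\<lambda>z. g z + (\<Sum>i\<in>F. c i * h i z)) + c x * \<phi> (h x)"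
      using insert.prems by (intro lin H2_add H2_sum H2_scale insert.hyps that(2)) auto
    then show ?case using insert by (simp add: algebra_simps)
  qed
  have k0: "kfun 0 \<in> H2" by (rule kfun_H2) (simp add: Ball_d_def)
  have ker: "\<phi> (kfun w) = \<phi> (kfun 0) * kfun w l" if w: "w \<in> Ball_d" for w
  proof -
    have "kfun w = (\<lambda>z. kfun 0 z + (\<Sum>j\<in>UNIV. cnj (w $ j) * fmult (coord j) (kfun w) z))"
    proof
      fix z
      show "kfun w z = kfun 0 z + (\<Sum>j\<in>UNIV. cnj (w $ j) * fmult (coord j) (kfun w) z)"
      proof (cases "z \<in> Ball_d")
        case True
        have "(\<Sum>j\<in>UNIV. cnj (w $ j) * fmult (coord j) (kfun w) z) = cinner z w * DAkernel z w"
          using True by (simp add: fmult_def coord_def kfun_def cinner_def sum_distrib_left mult_ac)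
        then show ?thesis using DAkernel_eq[OF True w] True by (simp add: kfun_def DAkernel_def cinner_def)
      qed (simp add: kfun_def fmult_def)
    qed
    then have "\<phi> (kfun w) = \<phi> (\<lambda>z. kfun 0 z + (\<Sum>j\<in>UNIV. cnj (w $ j) * fmult (coord j) (kfun w) z))" by simp
    also have "\<dots> = \<phi> (kfun 0) + (\<Sum>j\<in>UNIV. cnj (w $ j) * \<phi> (fmult (coord j) (kfun w)))"
      by (rule sum_lin) (simp_all add: k0 coord_mult_H2 kfun_H2 w)
    also have "\<dots> = \<phi> (kfun 0) + cinner l w * \<phi> (kfun w)"
      by (simp add: eig kfun_H2 w cinner_def sum_distrib_left mult_ac)
    finally have "\<phi> (kfun w) * (1 - cinner l w) = \<phi> (kfun 0)" by (simp add: algebra_simps)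
    then show ?thesis using one_minus_cinner_nonzero[OF l w] l by (simp add: kfun_def DAkernel_def field_simps)
  qed
  obtain Ts bs where c: "\<And>n. finite (Ts n)" "\<And>n. Ts n \<subseteq> Ball_d" "h2conv (\<lambda>n. comb (Ts n) (bs n)) f"
    using h2conv_comb_exists[OF f] by blast
  have comb: "\<phi> (comb (Ts n) (bs n)) = \<phi> (kfun 0) * comb (Ts n) (bs n) l" for n
  proof -
    have "\<phi> (comb (Ts n) (bs n)) = \<phi> (\<lambda>z. 0) + (\<Sum>w\<in>Ts n. bs n w * \<phi> (kfun w))"
      unfolding comb_def using sum_lin[OF c(1)[of n] H2_zero, of kfun "bs n"] c(2)[of n] kfun_H2 by auto
    also have "\<dots> = (\<Sum>w\<in>Ts n. bs n w * (\<phi> (kfun 0) * kfun w l))"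
      unfolding zero using c(2)[of n] ker by (simp add: subset_iff)
    finally show ?thesis by (simp add: comb_def sum_distrib_left mult_ac)
  qed
  have "(\<lambda>n. \<phi> (comb (Ts n) (bs n)) - \<phi> f) \<longlonglongrightarrow> 0"
  proof (rule Lim_null_comparison)
    have "\<phi> (comb (Ts n) (bs n)) - \<phi> f = \<phi> (\<lambda>z. comb (Ts n) (bs n) z - f z)" for n
      using lin[OF h2conv_H2(1)[OF c(3), of n] f, of "- 1"] by simp
    then show "eventually (\<lambda>n. norm (\<phi> (comb (Ts n) (bs n)) - \<phi> f) \<le> C * h2norm (\<lambda>z. comb (Ts n) (bs n) z - f z)) sequentially"
      using bound[OF H2_diff[OF h2conv_H2(1)[OF c(3)] f]] by simp
    show "(\<lambda>n. C * h2norm (\<lambda>z. comb (Ts n) (bs n) z - f z)) \<longlonglongrightarrow> 0"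
      using c(3) unfolding h2conv_def by (intro tendsto_mult_right_zero) simp
  qed
  then have "(\<lambda>n. \<phi> (kfun 0) * comb (Ts n) (bs n) l) \<longlonglongrightarrow> \<phi> f" by (simp add: LIM_zero_iff comb)
  moreover have "(\<lambda>n. \<phi> (kfun 0) * comb (Ts n) (bs n) l) \<longlonglongrightarrow> \<phi> (kfun 0) * f l"
    by (intro tendsto_intros h2conv_point[OF c(3)])
  ultimately show ?thesis using LIMSEQ_unique by blast
qed

section \<open>The diagonal side: square-summable functions on \<open>L\<close>\<close>

lemma l2_scale:
  assumes "e \<in> l2 L"
  shows "(\<lambda>x. c * e x) \<in> l2 L" "l2norm L (\<lambda>x. c * e x) = cmod c * l2norm L e"
proof -
  have s: "(\<lambda>x. (cmod (e x))\<^sup>2) summable_on L" using assms by (simp add: l2_def)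
  show "(\<lambda>x. c * e x) \<in> l2 L"
    using assms summable_on_cmult_right[OF s, of "(cmod c)\<^sup>2"] by (simp add: l2_def norm_mult power_mult_distrib)
  have "(\<Sum>\<^sub>\<infinity>x\<in>L. (cmod (c * e x))\<^sup>2) = (cmod c)\<^sup>2 * (\<Sum>\<^sub>\<infinity>x\<in>L. (cmod (e x))\<^sup>2)"
    unfolding norm_mult power_mult_distrib by (rule infsum_cmult_right) (rule s)
  then show "l2norm L (\<lambda>x. c * e x) = cmod c * l2norm L e"
    unfolding l2norm_def by (simp add: real_sqrt_mult)
qed

lemma l2_add:
  assumes "e \<in> l2 L" "e' \<in> l2 L" shows "(\<lambda>x. e x + e' x) \<in> l2 L"
proof -
  have s: "(\<lambda>x. 2 * (cmod (e x))\<^sup>2 + 2 * (cmod (e' x))\<^sup>2) summable_on L"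
    using assms by (intro summable_on_add summable_on_cmult_right) (simp_all add: l2_def)
  have "(\<lambda>x. (cmod (e x + e' x))\<^sup>2) summable_on L"
  proof (rule summable_on_comparison_test[OF s])
    fix x
    have "(cmod (e x + e' x))\<^sup>2 \<le> (cmod (e x) + cmod (e' x))\<^sup>2"
      by (intro power_mono norm_triangle_ineq) simp
    also have "\<dots> \<le> 2 * (cmod (e x))\<^sup>2 + 2 * (cmod (e' x))\<^sup>2"
      using sum_squares_bound[of "cmod (e x)" "cmod (e' x)"] by (simp add: power2_sum)
    finally show "(cmod (e x + e' x))\<^sup>2 \<le> 2 * (cmod (e x))\<^sup>2 + 2 * (cmod (e' x))\<^sup>2" .
  qed simp
  then show ?thesis using assms by (simp add: l2_def)
qed

lemma diag_op_l2:
  assumes "L \<subseteq> Ball_d" "e \<in> l2 L" shows "diag_op j e \<in> l2 L"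
proof -
  have s: "(\<lambda>x. (cmod (e x))\<^sup>2) summable_on L" using assms by (simp add: l2_def)
  have "(\<lambda>x. (cmod (diag_op j e x))\<^sup>2) summable_on L"
  proof (rule summable_on_comparison_test[OF s])
    fix x assume "x \<in> L"
    then have "cmod (x $ j) \<le> 1"
      using assms(1) order_trans[OF Finite_Cartesian_Product.norm_nth_le[of x j], of 1] by (auto simp: Ball_d_def)
    then show "(cmod (diag_op j e x))\<^sup>2 \<le> (cmod (e x))\<^sup>2"
      unfolding diag_op_def norm_mult by (intro power_mono mult_left_le_one_le) auto
  qed simp
  then show ?thesis using assms by (simp add: l2_def diag_op_def)
qed

lemma cmod_le_l2norm:
  assumes "e \<in> l2 L" "x \<in> L" shows "cmod (e x) \<le> l2norm L e"
proof -
  have s: "(\<lambda>x. (cmod (e x))\<^sup>2) summable_on L" using assms by (simp add: l2_def)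
  have "(\<Sum>x\<in>{x}. (cmod (e x))\<^sup>2) \<le> (\<Sum>\<^sub>\<infinity>x\<in>L. (cmod (e x))\<^sup>2)"
    by (rule finite_sum_le_infsum[OF s]) (use assms in auto)
  then show ?thesis unfolding l2norm_def by (intro real_le_rsqrt) simp
qed

lemma l2norm_nonneg: "0 \<le> l2norm L e"
  unfolding l2norm_def by (intro real_sqrt_ge_zero infsum_nonneg) simp

lemma l2_unit:
  assumes "l \<in> L"
  shows "(\<lambda>x. if x = l then 1 else 0) \<in> l2 L" "l2norm L (\<lambda>x. if x = l then 1 else 0) = 1"
proof -
  have "((\<lambda>x. (cmod (if x = l then 1 else 0))\<^sup>2) has_sum 1) {l}"
    using has_sum_finite[of "{l}" "\<lambda>x. (cmod (if x = l then 1 else 0))\<^sup>2"] by simp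
  then have hs: "((\<lambda>x. (cmod (if x = l then 1 else 0))\<^sup>2) has_sum 1) L"
    by (rule has_sum_cong_neutral[THEN iffD1, rotated -1]) (use assms in auto)
  show "(\<lambda>x. if x = l then 1 else 0) \<in> l2 L"
    using has_sum_imp_summable[OF hs] assms by (auto simp: l2_def)
  show "l2norm L (\<lambda>x. if x = l then 1 else 0) = 1"
    unfolding l2norm_def infsumI[OF hs] by simp
qed

section \<open>From the similarity to the separation estimate\<close>

theorem theorem5p3:
  fixes L :: "(complex^'d::finite) set"
    and A :: "(complex^'d \<Rightarrow> complex) set"
    and X :: "(complex^'d \<Rightarrow> complex) \<Rightarrow> (complex^'d \<Rightarrow> complex)"
  assumes "countable L" and "L \<subseteq> Ball_d"
    and "is_ideal A" and "wstar_closed A"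
    and "\<forall>e\<in>l2 L. \<forall>e'\<in>l2 L. X (\<lambda>x. e x + e' x) = (\<lambda>z. X e z + X e' z)"
    and "\<forall>e\<in>l2 L. \<forall>c. X (\<lambda>x. c * e x) = (\<lambda>z. c * X e z)"
    and "bij_betw X (l2 L) (Ha A)"
    and "\<exists>C. \<forall>e\<in>l2 L. h2norm (X e) \<le> C * l2norm L e"
    and "\<exists>C. \<forall>e\<in>l2 L. l2norm L e \<le> C * h2norm (X e)"
    and "\<forall>j. \<forall>e\<in>l2 L. Zop A j (X e) = X (diag_op j e)"
  shows "strongly_separated L \<and>
    (\<forall>l\<in>L. \<exists>\<Omega>. inner_multiplier \<Omega> \<and> vrange \<Omega> = idealH2 (v0 (L - {l})) \<and>
       vpoint_norm \<Omega> l \<ge>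
         1 / (Sup {h2norm (X e) | e. e \<in> l2 L \<and> l2norm L e \<le> 1} *
              Sup {l2norm L e | e. e \<in> l2 L \<and> h2norm (X e) \<le> 1}))"
proof -
  have A: "A \<subseteq> Md" using assms(3) by (simp add: is_ideal_def)
  have inj: "inj_on X (l2 L)" and img: "X ` l2 L = Ha A" using assms(7) by (auto simp: bij_betw_def)
  have XHa: "X e \<in> Ha A" if "e \<in> l2 L" for e using img that by blast
  have XH: "X e \<in> H2" if "e \<in> l2 L" for e using XHa[OF that] by (simp add: Ha_def)
  define S1 where "S1 = Sup {h2norm (X e) | e. e \<in> l2 L \<and> l2norm L e \<le> 1}"
  define S2 where "S2 = Sup {l2norm L e | e. e \<in> l2 L \<and> h2norm (X e) \<le> 1}"
  have S1: "h2norm (X e) \<le> S1" if e: "e \<in> l2 L" "l2norm L e \<le> 1" for e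
  proof -
    obtain C where C: "\<forall>e\<in>l2 L. h2norm (X e) \<le> C * l2norm L e" using assms(8) by blast
    have "h2norm (X e) \<le> \<bar>C\<bar>" if "e \<in> l2 L" "l2norm L e \<le> 1" for e
    proof -
      have "h2norm (X e) \<le> C * l2norm L e" using C that by blast
      also have "\<dots> \<le> \<bar>C\<bar> * 1" using that l2norm_nonneg by (intro mult_mono) auto
      finally show ?thesis by simp
    qed
    then show ?thesis unfolding S1_def using e by (intro cSup_upper bdd_aboveI[of _ "\<bar>C\<bar>"]) auto
  qed
  have S2: "l2norm L e \<le> S2 * h2norm (X e)" if e: "e \<in> l2 L" for e
  proof -
    obtain C where C: "\<forall>e\<in>l2 L. l2norm L e \<le> C * h2norm (X e)" using assms(9) by blast
    have b: "l2norm L e \<le> \<bar>C\<bar>" if "e \<in> l2 L" "h2norm (X e) \<le> 1" for e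
    proof -
      have "l2norm L e \<le> C * h2norm (X e)" using C that by blast
      also have "\<dots> \<le> \<bar>C\<bar> * 1" using that h2norm_nonneg[OF XH] by (intro mult_mono) auto
      finally show ?thesis by simp
    qed
    show ?thesis
    proof (cases "h2norm (X e) = 0")
      case True then show ?thesis using C e by force
    next
      case False
      define h where "h = h2norm (X e)"
      have h: "h > 0" using False h2norm_nonneg[OF XH[OF e]] by (simp add: h_def)
      \<comment> \<open>The supremum \<open>S2\<close> is taken over vectors whose image has norm at
        most 1, so \<open>e\<close> is rescaled to make the norm of its image exactly 1.\<close>
      define e' where "e' = (\<lambda>x. of_real (1 / h) * e x)"
      have e': "e' \<in> l2 L" unfolding e'_def by (rule l2_scale(1)[OF e])
      have "X e' = (\<lambda>z. of_real (1 / h) * X e z)" unfolding e'_def using assms(6) e by blast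
      then have "h2norm (X e') = 1" using h2norm_scale[OF XH[OF e], of "of_real (1 / h)"] h by (simp add: h_def norm_divide)
      then have "l2norm L e' \<le> S2"
        unfolding S2_def using e' b by (intro cSup_upper bdd_aboveI[of _ "\<bar>C\<bar>"]) auto
      moreover have "l2norm L e' = l2norm L e / h"
        unfolding e'_def l2_scale(2)[OF e] using h by (simp add: norm_divide)
      ultimately show ?thesis using h by (simp add: h_def[symmetric] pos_divide_le_eq)
    qed
  qed
  \<comment> \<open>Projecting first extends the inverse of \<open>X\<close> to all of
    \<open>H2\<close>, so that the intertwining involves true coordinate multiplication and no
    compression.\<close>
  define Y where "Y f = inv_into (l2 L) X (h2proj (Ha A) f)" for f
  have Y: "Y f \<in> l2 L" "X (Y f) = h2proj (Ha A) f" if "f \<in> H2" for f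
    using h2proj_Ha(1)[OF A that] img unfolding Y_def by (auto intro: inv_into_into simp: f_inv_into_f)
  have Yeq: "Y f = e" if "f \<in> H2" "e \<in> l2 L" "X e = h2proj (Ha A) f" for f e
    using Y[OF that(1)] that inj by (metis inj_onD)
  have Ylin: "Y (\<lambda>z. f z + c * g z) = (\<lambda>x. Y f x + c * Y g x)" if f: "f \<in> H2" and g: "g \<in> H2" for f g c
  proof (rule Yeq)
    show "(\<lambda>z. f z + c * g z) \<in> H2" by (intro H2_add H2_scale f g)
    note s = l2_scale(1)[OF Y(1)[OF g], of c]
    show "(\<lambda>x. Y f x + c * Y g x) \<in> l2 L" by (rule l2_add[OF Y(1)[OF f] s])
    have "X (\<lambda>x. Y f x + c * Y g x) = (\<lambda>z. X (Y f) z + X (\<lambda>x. c * Y g x) z)"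
      by (rule assms(5)[rule_format, OF Y(1)[OF f] s])
    also have "X (\<lambda>x. c * Y g x) = (\<lambda>z. c * X (Y g) z)" using assms(6) Y(1)[OF g] by blast
    finally show "X (\<lambda>x. Y f x + c * Y g x) = h2proj (Ha A) (\<lambda>z. f z + c * g z)"
      unfolding Y(2)[OF f] Y(2)[OF g] h2proj_Ha_add_scale[OF A f g] .
  qed
  have Ycoord: "Y (fmult (coord j) f) = diag_op j (Y f)" if f: "f \<in> H2" for f j
  proof (rule Yeq[OF coord_mult_H2[OF f] diag_op_l2[OF assms(2) Y(1)[OF f]]])
    show "X (diag_op j (Y f)) = h2proj (Ha A) (fmult (coord j) f)"
      using assms(10) Y[OF f] h2proj_Ha_coord[OF A f] by metis
  qed
  define c where "c m = Y (kfun 0) m" for m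
  have Ybound: "cmod (Y f m) \<le> S2 * h2norm f" if f: "f \<in> H2" and m: "m \<in> L" for f m
  proof -
    have "cmod (Y f m) \<le> l2norm L (Y f)" by (rule cmod_le_l2norm[OF Y(1)[OF f] m])
    also have "\<dots> \<le> S2 * h2norm (h2proj (Ha A) f)" using S2[OF Y(1)[OF f]] Y(2)[OF f] by simp
    also have "\<dots> \<le> S2 * h2norm f"
    proof (intro mult_left_mono h2proj_Ha(3)[OF A f])
      \<comment> \<open>The sign of \<open>S2\<close> is read off from the unit vector at
        \<open>m\<close>: its image has nonnegative norm, and \<open>S2\<close> times that norm is
        at least 1.\<close>
      let ?u = "\<lambda>x. if x = m then 1 else 0 :: complex"
      have "1 \<le> S2 * h2norm (X ?u)" using S2[OF l2_unit(1)[OF m]] l2_unit(2)[OF m] by simp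
      then show "0 \<le> S2"
        using mult_nonpos_nonneg[OF _ h2norm_nonneg[OF XH[OF l2_unit(1)[OF m]]], of S2] by linarith
    qed
    finally show ?thesis .
  qed
  have Yeval: "Y f m = c m * f m" if f: "f \<in> H2" and m: "m \<in> L" for f m
    unfolding c_def
  proof (rule functional_is_evaluation[where \<phi> = "\<lambda>f. Y f m", OF _ Ybound[OF _ m] _ _ f])
    show "Y (\<lambda>z. f z + c * g z) m = Y f m + c * Y g m" if "f \<in> H2" "g \<in> H2" for f g c
      by (simp add: Ylin that)
    show "Y (fmult (coord j) f) m = m $ j * Y f m" if "f \<in> H2" for f j
      by (simp add: Ycoord that diag_op_def)
    show "m \<in> Ball_d" using m assms(2) by blast
  qed
  define fl where "fl l = X (\<lambda>x. if x = l then 1 else 0)" for l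
  have flH: "fl l \<in> H2" and Yfl: "Y (fl l) = (\<lambda>x. if x = l then 1 else 0)"
    if l: "l \<in> L" for l
  proof -
    show "fl l \<in> H2" unfolding fl_def by (rule XH[OF l2_unit(1)[OF l]])
    then show "Y (fl l) = (\<lambda>x. if x = l then 1 else 0)"
      using h2proj_Ha_id[OF A XHa[OF l2_unit(1)[OF l]]] by (intro Yeq l2_unit(1)[OF l]) (auto simp: fl_def)
  qed
  have cfl: "c l * fl l l = 1" if l: "l \<in> L" for l
    using Yeval[OF flH[OF l] l] Yfl[OF l] by simp
  have flz: "fl l \<in> zero_space (L - {l})" if l: "l \<in> L" for l
  proof -
    \<comment> \<open>The relation \<open>cfl\<close> at \<open>m\<close> shows that
      \<open>c m\<close> is nonzero, so a zero coordinate of \<open>Y (fl l)\<close> forces a zero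
      value of \<open>fl l\<close>.\<close>
    have "fl l m = 0" if m: "m \<in> L - {l}" for m
      using Yeval[OF flH[OF l], of m] Yfl[OF l] cfl[of m] m by auto
    then show ?thesis using flH[OF l] by (simp add: zero_space_def)
  qed
  \<comment> \<open>Here \<open>v\<close> stands for the norm of the inner multiplier at
    \<open>l\<close>, and the premise is its point bound applied to \<open>fl l\<close>.\<close>
  have key: "S1 * S2 > 0 \<and> 1 / (S1 * S2) \<le> v"
    if l: "l \<in> L" and v: "cmod (fl l l) \<le> h2norm (fl l) * (h2norm (kfun l) * v)" for l v
  proof -
    have lB: "l \<in> Ball_d" using l assms(2) by blast
    define k where "k = h2norm (kfun l)"
    define r where "r = cmod (c l)"
    have kl: "kfun l l = of_real (k\<^sup>2)"
      using h2inner_kfun[OF kfun_H2[OF lB] lB] h2inner_self[OF kfun_H2[OF lB]] by (simp add: k_def)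
    have "kfun l l \<noteq> 0" using lB one_minus_cinner_nonzero[OF lB lB] by (simp add: kfun_def DAkernel_def)
    then have k: "k > 0" using kl h2norm_nonneg[OF kfun_H2[OF lB]] by (auto simp: k_def less_le)
    have "r * cmod (fl l l) = 1" using cfl[OF l] by (metis norm_mult norm_one r_def)
    moreover have r: "r > 0" using cfl[OF l] by (auto simp: r_def)
    ultimately have fll: "cmod (fl l l) = 1 / r" by (simp add: field_simps)
    \<comment> \<open>The bound on \<open>Y\<close> is tested on the kernel function at
      \<open>l\<close>, whose value there is its squared norm; this is how the norm of the inverse
      of \<open>X\<close> enters.\<close>
    have "r * k\<^sup>2 \<le> S2 * k"
      using Ybound[OF kfun_H2[OF lB] l] unfolding Yeval[OF kfun_H2[OF lB] l] norm_mult kl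
      by (simp add: r_def k_def norm_power)
    then have rk: "r * k \<le> S2" using k by (simp add: power2_eq_square)
    then have S2p: "S2 > 0" using mult_pos_pos[OF r k] by linarith
    have n0: "h2norm (fl l) \<le> S1" unfolding fl_def using S1 l2_unit[OF l] by simp
    have "h2norm (fl l) \<noteq> 0"
    proof
      assume "h2norm (fl l) = 0"
      then have "fl l = (\<lambda>z. 0)" by (rule h2norm_eq_zero[OF flH[OF l]])
      then show False using cfl[OF l] by simp
    qed
    then have n1: "h2norm (fl l) > 0" using h2norm_nonneg[OF flH[OF l]] by simp
    then have S1p: "S1 > 0" using n0 by simp
    have "1 / r \<le> h2norm (fl l) * (k * v)" using v fll by (simp add: k_def)
    then have "0 < h2norm (fl l) * (k * v)" using divide_pos_pos[OF zero_less_one r] by linarith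
    then have v0: "v > 0" using n1 k by (simp add: zero_less_mult_iff)
    have "1 \<le> r * (h2norm (fl l) * (k * v))"
      using \<open>1 / r \<le> h2norm (fl l) * (k * v)\<close> r by (simp add: pos_divide_le_eq mult.commute)
    also have "\<dots> = h2norm (fl l) * (r * k) * v" by simp
    also have "\<dots> \<le> S1 * S2 * v"
      using n0 rk v0 S1p r k by (intro mult_right_mono mult_mono) auto
    finally have "1 \<le> S1 * S2 * v" .
    then show ?thesis using S1p S2p by (simp add: pos_divide_le_eq mult.commute)
  qed
  have main: "\<exists>\<Omega>. inner_multiplier \<Omega> \<and> vrange \<Omega> = idealH2 (v0 (L - {l})) \<and> S1 * S2 > 0 \<and>
      1 / (S1 * S2) \<le> vpoint_norm \<Omega> l \<and> (\<exists>\<omega>\<in>v0 (L - {l}). mult_norm \<omega> \<le> 1 \<and> cmod (\<omega> l) = vpoint_norm \<Omega> l)"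
    if l: "l \<in> L" for l
  proof -
    have lB: "l \<in> Ball_d" using l assms(2) by blast
    show ?thesis
    proof (rule zero_space_inner_multiplier[of "L - {l}"])
      fix \<Omega> :: "complex^'d \<Rightarrow> nat \<Rightarrow> complex"
      assume 1: "inner_multiplier \<Omega>" "vrange \<Omega> = idealH2 (v0 (L - {l}))"
        and 2: "\<And>z f. z \<in> Ball_d \<Longrightarrow> f \<in> zero_space (L - {l}) \<Longrightarrow> cmod (f z) \<le> h2norm f * (h2norm (kfun z) * vpoint_norm \<Omega> z)"
        and 3: "\<And>z. z \<in> Ball_d \<Longrightarrow> \<exists>\<omega>\<in>v0 (L - {l}). mult_norm \<omega> \<le> 1 \<and> cmod (\<omega> z) = vpoint_norm \<Omega> z"
      show ?thesis using 1 key[OF l 2[OF lB flz[OF l]]] 3[OF lB] by blast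
    qed
  qed
  have "strongly_separated L"
  proof (cases "L = {}")
    \<comment> \<open>For empty \<open>L\<close> both suprema are 0, so \<open>1 / (S1 * S2)\<close>
      is 0 and cannot serve as a separation constant; any positive number does.\<close>
    case True
    then show ?thesis by (auto simp: strongly_separated_def intro: exI[of _ 1])
  next
    case False
    then have pos: "S1 * S2 > 0" using main by blast
    show ?thesis unfolding strongly_separated_def
    proof (intro exI[of _ "1 / (S1 * S2)"] conjI ballI)
      show "1 / (S1 * S2) > 0" using pos by simp
      fix l assume "l \<in> L"
      then obtain \<Omega> \<omega> where "1 / (S1 * S2) \<le> vpoint_norm \<Omega> l" and \<omega>: "\<omega> \<in> v0 (L - {l})" "mult_norm \<omega> \<le> 1"
        "cmod (\<omega> l) = vpoint_norm \<Omega> l" using main by blast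
      then show "\<exists>\<omega>\<in>Md. mult_norm \<omega> \<le> 1 \<and> 1 / (S1 * S2) \<le> cmod (\<omega> l) \<and> (\<forall>m\<in>L. m \<noteq> l \<longrightarrow> \<omega> m = 0)"
        by (intro bexI[of _ \<omega>]) (auto simp: v0_def)
    qed
  qed
  then show ?thesis unfolding S1_def[symmetric] S2_def[symmetric] using main by blast
qed

end
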